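(* Let $G$ be a finite group, let $p$ be a prime, and let $k\ge 2$ be an integer such that $p^k$ divides $|G|$. Assume that $\mathbf{O}_{p'}(G)=1$. Then $G\in\mathcal{M}(p^k)$ if and only if there exist a Sylow $p$-subgroup $P$ of $G$ and an element $x\in G$ such that the following three statements hold: (1) $G=\langle x\rangle\ltimes P$ (i.e. $P$ is normal in $G$, $G=\langle x\rangle P$ and $\langle x\rangle\cap P=1$); (2) $\Phi(G)=\Phi(P)$, and this subgroup is contained in every subgroup of $G$ of order $p^{k-1}$; (3) $\langle x\rangle$ acts (by conjugation) faithfully on the $\mathbb{F}_p$-vector space $P/\Phi(P)$, and $x$ acts on it via scalar multiplication.
   Context: All groups are finite. $\Phi(X)$ denotes the Frattini subgroup of $X$ and $\mathbf{O}_{p'}(X)$ the largest normal subgroup of $X$ of order prime to $p$. $A<B$ means that $A$ is a proper subgroup of $B$. A subgroup $H$ of $G$ is $\mathcal{M}$-supplemented in $G$ if there exists a subgroup $K$ of $G$ such that $G=HK$ and $H_iK<G$ (that is, $H_iK$ is a proper subgroup of $G$) for every maximal subgroup $H_i$ of $H$. For a prime power $p^k$ with $p\le p^k\le |G|_p$, where $|G|_p$ is the order of a Sylow $p$-subgroup of $G$, we write $G\in\mathcal{M}(p^k)$ if all subgroups of $G$ of order $p^k$ are $\mathcal{M}$-supplemented in $G$. *)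

theory Defs
  imports "HOL-Algebra.Algebra" "HOL-Number_Theory.Residues"
begin

text \<open>
  Subgroups of \<open>G\<close> are carrier sets, as in HOL-Algebra; a subgroup \<open>H\<close> is regarded as a group in its
  own right through the record \<open>G\<lparr>carrier := H\<rparr>\<close>.
\<close>

definition maximal_subgroup :: "'a set \<Rightarrow> ('a, 'b) monoid_scheme \<Rightarrow> bool" where
  "maximal_subgroup M G \<longleftrightarrow>
     subgroup M G \<and> M \<noteq> carrier G \<and>
     (\<forall>L. subgroup L G \<and> M \<subseteq> L \<longrightarrow> L = M \<or> L = carrier G)"

text \<open>
  The intersection with \<open>carrier G\<close> only matters for the trivial group, which has no maximal
  subgroups and is its own Frattini subgroup.
\<close>

definition frattini :: "('a, 'b) monoid_scheme \<Rightarrow> 'a set" where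
  "frattini G = carrier G \<inter> \<Inter> {M. maximal_subgroup M G}"

text \<open>The largest element with respect to inclusion; it exists by \<open>p'_core_greatest\<close> below.\<close>

definition p'_core :: "('a, 'b) monoid_scheme \<Rightarrow> nat \<Rightarrow> 'a set" where
  "p'_core G p = (GREATEST N. N \<lhd> G \<and> coprime (card N) p)"

definition proper_subgroup :: "'a set \<Rightarrow> ('a, 'b) monoid_scheme \<Rightarrow> bool" where
  "proper_subgroup H G \<longleftrightarrow> subgroup H G \<and> H \<noteq> carrier G"

definition M_supplemented :: "'a set \<Rightarrow> ('a, 'b) monoid_scheme \<Rightarrow> bool" where
  "M_supplemented H G \<longleftrightarrow>
     (\<exists>K. subgroup K G \<and> carrier G = H <#>\<^bsub>G\<^esub> K \<and>
        (\<forall>H'. maximal_subgroup H' (G\<lparr>carrier := H\<rparr>) \<longrightarrow> proper_subgroup (H' <#>\<^bsub>G\<^esub> K) G))"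

text \<open>\<open>M_class q\<close> is meant for prime powers \<open>q > 1\<close> dividing the group order.\<close>

definition M_class :: "nat \<Rightarrow> ('a, 'b) monoid_scheme \<Rightarrow> bool" where
  "M_class q G \<longleftrightarrow> (\<forall>H. subgroup H G \<and> card H = q \<longrightarrow> M_supplemented H G)"

definition sylow_subgroup :: "nat \<Rightarrow> 'a set \<Rightarrow> ('a, 'b) monoid_scheme \<Rightarrow> bool" where
  "sylow_subgroup p P G \<longleftrightarrow> subgroup P G \<and> card P = p ^ multiplicity p (order G)"

text \<open>Internal semidirect product \<open>H \<ltimes> N\<close>, with \<open>N\<close> the normal factor.\<close>

definition semidirect_decomp :: "('a, 'b) monoid_scheme \<Rightarrow> 'a set \<Rightarrow> 'a set \<Rightarrow> bool" where
  "semidirect_decomp G H N \<longleftrightarrow>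
     subgroup H G \<and> N \<lhd> G \<and> carrier G = H <#>\<^bsub>G\<^esub> N \<and> H \<inter> N = {\<one>\<^bsub>G\<^esub>}"

definition frattini_quotient :: "('a, 'b) monoid_scheme \<Rightarrow> 'a set \<Rightarrow> 'a set monoid" where
  "frattini_quotient G P = G\<lparr>carrier := P\<rparr> Mod frattini (G\<lparr>carrier := P\<rparr>)"

text \<open>
  For a finite \<open>p\<close>-group \<open>P\<close> the group \<open>P/\<Phi>(P)\<close> is elementary abelian. The record below is this group
  as a vector space over \<open>residue_ring p\<close>: vector addition is the group operation, and a residue
  \<open>c\<close> acts by taking \<open>c\<close>-th powers. The fields \<open>mult\<close> and \<open>one\<close> are not used by the locale \<open>module\<close>.
\<close>

definition frattini_space :: "('a, 'b) monoid_scheme \<Rightarrow> 'a set \<Rightarrow> (int, 'a set) module" where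
  "frattini_space G P =
     (let V = frattini_quotient G P in
      \<lparr>carrier = carrier V, monoid.mult = monoid.mult V, one = one V,
       ring.zero = one V, ring.add = monoid.mult V,
       smult = (\<lambda>c v. v [^]\<^bsub>V\<^esub> c)\<rparr>)"

text \<open>
  Conjugation \<open>v \<mapsto> g v g\<^sup>-\<^sup>1\<close> on \<open>P/\<Phi>(P)\<close>, restricted to the carrier because the permutation group
  \<open>BijGroup\<close> used by \<open>group_action\<close> consists of extensional functions.
\<close>

definition conj_action :: "('a, 'b) monoid_scheme \<Rightarrow> 'a set \<Rightarrow> 'a \<Rightarrow> 'a set \<Rightarrow> 'a set" where
  "conj_action G P g =
     (\<lambda>v \<in> carrier (frattini_space G P). g <#\<^bsub>G\<^esub> v #>\<^bsub>G\<^esub> inv\<^bsub>G\<^esub> g)"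

lemma (in group) coprime_card_normal_mult:
  assumes M: "M \<lhd> G" and N: "N \<lhd> G"
    and cop: "coprime (card M) p" "coprime (card N) p"
  shows "coprime (card (M <#> N)) p"
proof -
  interpret second_isomorphism_grp M G N
    using M N normal_imp_subgroup
    by (simp add: second_isomorphism_grp_def second_isomorphism_grp_axioms_def)
  let ?Q = "G\<lparr>carrier := M <#> N\<rparr>" and ?S = "G\<lparr>carrier := N\<rparr>"
  have sub: "subgroup (M <#> N) G" by (rule normal_set_mult_subgroup)
  have gQ: "group ?Q" using sub subgroup_imp_group by blast
  have gS: "group ?S" using subgrpS subgroup_imp_group by blast
  have MQ: "subgroup M ?Q"
    using subgroup_incl[OF normal_imp_subgroup[OF M] sub] H_contained_in_set_mult by blast
  have IS: "subgroup (M \<inter> N) ?S"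
    using subgroup_incl[OF subgroups_Inter_pair[OF normal_imp_subgroup[OF M] subgrpS] subgrpS]
    by blast
  have "card (carrier (?S Mod (M \<inter> N))) = card (carrier (?Q Mod M))"
    using normal_intersection_quotient_isom bij_betw_same_card unfolding iso_def by blast
  hence eq: "card (rcosets\<^bsub>?S\<^esub> (M \<inter> N)) = card (rcosets\<^bsub>?Q\<^esub> M)"
    by (simp add: FactGroup_def)
  have "card (rcosets\<^bsub>?S\<^esub> (M \<inter> N)) * card (M \<inter> N) = card N"
    using group.lagrange[OF gS IS] by (simp add: order_def)
  hence "coprime (card (rcosets\<^bsub>?S\<^esub> (M \<inter> N))) p"
    using cop(2) coprime_divisors by (metis coprime_mult_left_iff)
  moreover have "card (rcosets\<^bsub>?Q\<^esub> M) * card M = card (M <#> N)"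
    using group.lagrange[OF gQ MQ] by (simp add: order_def)
  ultimately show ?thesis
    using cop(1) eq by (metis coprime_mult_left_iff)
qed

lemma (in group) p'_core_greatest:
  assumes fin: "finite (carrier G)"
  shows "p'_core G p \<lhd> G" "coprime (card (p'_core G p)) p"
    and "N \<lhd> G \<Longrightarrow> coprime (card N) p \<Longrightarrow> N \<subseteq> p'_core G p"
proof -
  let ?A = "{N. N \<lhd> G \<and> coprime (card N) p}"
  have "?A \<subseteq> Pow (carrier G)"
    using normal_imp_subgroup subgroup.subset by blast
  hence finA: "finite ?A" using fin finite_subset by blast
  have "{\<one>} \<in> ?A" using one_is_normal by simp
  then obtain M where M: "M \<in> ?A" and Mmax: "\<And>N. N \<in> ?A \<Longrightarrow> M \<subseteq> N \<Longrightarrow> N = M"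
    using finite_has_maximal[OF finA] by blast
  have top: "N \<subseteq> M" if "N \<in> ?A" for N
  proof -
    interpret second_isomorphism_grp M G N
      using M that normal_imp_subgroup[of N]
      by (auto simp add: second_isomorphism_grp_def second_isomorphism_grp_axioms_def)
    have "M <#> N \<in> ?A"
      using M that coprime_card_normal_mult normal_subgroup_set_mult_closed by blast
    hence "M <#> N = M" using Mmax H_contained_in_set_mult by blast
    thus ?thesis using S_contained_in_set_mult by simp
  qed
  have "p'_core G p = M"
    unfolding p'_core_def using M top by (intro Greatest_equality) auto
  thus "p'_core G p \<lhd> G" "coprime (card (p'_core G p)) p"
    and "N \<lhd> G \<Longrightarrow> coprime (card N) p \<Longrightarrow> N \<subseteq> p'_core G p"
    using M top by auto
qed

end

theory Submission
  imports Defs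
begin

text \<open>
  If \<open>K\<close> supplements a subgroup \<open>H\<close> of order \<open>p\<^sup>k\<close> of the Sylow subgroup \<open>P\<close> as required, then
  \<open>H\<^sub>i K\<close> has index \<open>p\<close> for each maximal subgroup \<open>H\<^sub>i\<close> of \<open>H\<close>, and it meets \<open>H\<close> in \<open>H\<^sub>i\<close>. Subgroups
  of index \<open>p\<close> contain \<open>\<Phi>(P)\<close>, which yields \<open>\<Phi>(P) \<inter> H = \<Phi>(H)\<close> and condition (2) for \<open>\<Phi>(P)\<close>. The
  normal core \<open>N\<close> of all subgroups of index \<open>p\<close> satisfies \<open>N \<inter> P = \<Phi>(P)\<close>, so by Tate's theorem and
  the triviality of the \<open>p'\<close>-core \<open>N = \<Phi>(P)\<close>. If \<open>|\<Phi>(P)| \<le> p\<^bsup>k-2\<^esup>\<close>, the group acts on the cosets of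
  \<open>K\<close> as a group of dilatations of an affine space of dimension at least two, and the translations
  give the normality of \<open>P\<close>. If \<open>|\<Phi>(P)| = p\<^bsup>k-1\<^esup>\<close> and \<open>p\<close> is odd, \<open>P\<close> is cyclic of order \<open>p\<^sup>k\<close> and the
  transfer from the centralizer of \<open>\<Phi>(P)\<close> to \<open>P\<close> shows that this centralizer is \<open>P\<close>. If \<open>p = 2\<close>,
  subgroups of index \<open>p\<close> contain all elements of odd order, so \<open>G = P\<close>. Once \<open>P\<close> is normal, the
  subgroups \<open>H\<^sub>i K \<inter> P\<close> are normal in \<open>G\<close>, hence so is every subgroup between \<open>\<Phi>(P)\<close> and \<open>P\<close>, and \<open>G\<close>
  acts on \<open>P/\<Phi>(P)\<close> by scalars. A second use of Tate's theorem shows that the kernel of this action is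
  \<open>P\<close>, so \<open>G/P\<close> is cyclic of order prime to \<open>p\<close>.

  Conversely, scalar action makes every subgroup between \<open>\<Phi>(P)\<close> and \<open>P\<close> normal in \<open>G\<close>; if \<open>C/\<Phi>(P)\<close>
  is a complement of \<open>H/\<Phi>(P)\<close> in \<open>P/\<Phi>(P)\<close>, then \<open>C\<langle>x\<rangle>\<close> is the required supplement of \<open>H\<close>.
\<close>

text \<open>The bound \<open>k \<ge> 2\<close> is essential: for \<open>p = 5\<close> and
  \<open>k = 1\<close>, every subgroup of order 5 of the alternating group of degree 5 is
  supplemented by a subgroup of order 12, yet the Sylow 5-subgroups are not normal. The hypothesis
  speaks about one \<open>H\<close> at a time and not about elements of order prime to
  \<open>p\<close>. Hence a recurring pattern: build a normal subgroup that meets \<open>P\<close>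
  inside \<Phi>(P) and let Tate's theorem, together with the trivial p'-core, force it into
  \<open>P\<close>. The split by the order of \<Phi>(P) has a geometric reason. The affine argument
  recognizes dilatations by the lines they preserve, and on a single line this is no restriction;
  there the cyclic structure of \<open>P\<close> must replace geometry. Cyclicity in turn fails for
  \<open>p = 2\<close>: the quaternion group of order 8 satisfies the hypothesis with
  \<open>k = 2\<close>.\<close>

lemma (in group) inv_mult_cancel [simp]:
  "x \<in> carrier G \<Longrightarrow> y \<in> carrier G \<Longrightarrow> inv x \<otimes> (x \<otimes> y) = y"
  "x \<in> carrier G \<Longrightarrow> y \<in> carrier G \<Longrightarrow> x \<otimes> (inv x \<otimes> y) = y"
  by (simp_all add: m_assoc[symmetric])

section \<open>Counting in finite groups and fixed points of p-groups\<close>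

locale prime_group = group G for G (structure) +
  fixes p :: nat
  assumes fin: "finite (carrier G)" and prime_p: "Factorial_Ring.prime p"
begin

definition p_subgroup :: "'a set \<Rightarrow> bool" where
  "p_subgroup P \<longleftrightarrow> subgroup P G \<and> (\<exists>n. card P = p ^ n)"

abbreviation Phi :: "'a set \<Rightarrow> 'a set" where
  "Phi P \<equiv> frattini (G\<lparr>carrier := P\<rparr>)"

abbreviation maximal_in :: "'a set \<Rightarrow> 'a set \<Rightarrow> bool" where
  "maximal_in M P \<equiv> maximal_subgroup M (G\<lparr>carrier := P\<rparr>)"

lemma restrict_group: "subgroup J G \<Longrightarrow> prime_group (G\<lparr>carrier := J\<rparr>) p"
  using fin prime_p finite_subset[OF subgroup.subset]
  by (auto intro!: prime_group.intro prime_group_axioms.intro simp: subgroup_imp_group)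

lemma subgroup_finite: "subgroup H G \<Longrightarrow> finite H"
  using fin finite_subset subgroup.subset by blast

lemma subgroup_card_pos: "subgroup H G \<Longrightarrow> card H > 0"
  using fin subgroup.finite_imp_card_positive by blast

lemma subgroup_carrier: "subgroup H G \<Longrightarrow> x \<in> H \<Longrightarrow> x \<in> carrier G"
  using subgroup.mem_carrier by fast

lemma p_subgroupD: "p_subgroup P \<Longrightarrow> subgroup P G"
  by (simp add: p_subgroup_def)

lemma subgroup_card_dvd:
  assumes "subgroup L G" "subgroup H G" "L \<subseteq> H"
  shows "card L dvd card H"
proof -
  have "card (rcosets\<^bsub>G\<lparr>carrier := H\<rparr>\<^esub> L) * card L = card H"
    using group.lagrange[OF subgroup_imp_group[OF assms(2)] subgroup_incl[OF assms]]
    by (simp add: order_def)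
  thus ?thesis by (metis dvd_triv_right)
qed

lemma p_subgroup_subset:
  assumes "p_subgroup P" "subgroup L G" "L \<subseteq> P"
  shows "p_subgroup L"
  using assms subgroup_card_dvd[of L P] prime_p divides_primepow_nat
  unfolding p_subgroup_def by metis

lemma p_subgroup_card_less:
  assumes "p_subgroup P" "subgroup L G" "L \<subset> P"
  shows "p * card L dvd card P"
proof -
  obtain n m where nm: "card P = p ^ n" "card L = p ^ m"
    using assms p_subgroup_subset unfolding p_subgroup_def by (meson psubset_imp_subset)
  have "card L < card P"
    using assms p_subgroupD subgroup_finite psubset_card_mono by blast
  hence "m < n" using nm prime_gt_1_nat[OF prime_p] power_less_imp_less_exp by metis
  hence "Suc m \<le> n" by simp
  thus ?thesis using nm le_imp_power_dvd by (metis power_Suc)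
qed

lemma pow_card_eq_one:
  assumes "subgroup H G" "x \<in> H"
  shows "x [^] card H = \<one>"
proof -
  have "x [^]\<^bsub>G\<lparr>carrier := H\<rparr>\<^esub> order (G\<lparr>carrier := H\<rparr>) = \<one>"
    using group.pow_order_eq_1[OF subgroup_imp_group[OF assms(1)], of x] assms(2) by simp
  thus ?thesis by (simp add: order_def nat_pow_consistent[symmetric])
qed

lemma subgroup_pow: "subgroup H G \<Longrightarrow> x \<in> H \<Longrightarrow> x [^] (n::nat) \<in> H"
  by (induction n) (auto simp: subgroup.one_closed subgroup.m_closed)

lemma pow_pow_commute:
  "x \<in> carrier G \<Longrightarrow> x [^] (a::nat) \<otimes> x [^] (b::nat) = x [^] b \<otimes> x [^] a"
  by (simp add: nat_pow_mult add.commute)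

text \<open>Bezout writes \<open>x\<close> as a product of powers of \<open>x [^] a\<close> and
  \<open>x [^] b\<close>. This stands in for splitting an element into its p-part and p'-part:
  usually one exponent is a power of \<open>p\<close> and the other is prime to
  \<open>p\<close>.\<close>

lemma pow_mem_coprime:
  assumes H: "subgroup H G" and x: "x \<in> carrier G" and a: "x [^] (a::nat) \<in> H"
    and b: "x [^] (b::nat) \<in> H" and cop: "coprime a b"
  shows "x \<in> H"
proof -
  obtain u v :: int where uv: "u * int a + v * int b = 1"
    using cop bezout_int[of "int a" "int b"] by auto
  have pw: "y [^] (i::int) \<in> H" if "y \<in> H" for y i
  proof -
    have "y [^] i = (if i < 0 then inv (y [^] nat (- i)) else y [^] nat i)" by (rule int_pow_def2)
    thus ?thesis
      using subgroup_pow[OF H that, of "nat i"]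
        subgroup.m_inv_closed[OF H subgroup_pow[OF H that, of "nat (- i)"]]
      by (cases "i < 0") (simp_all only: if_True if_False)
  qed
  have "x = x [^] (int a * u + int b * v)" using uv x by (simp add: mult.commute)
  also have "\<dots> = x [^] (int a * u) \<otimes> x [^] (int b * v)" using x by (simp add: int_pow_mult)
  also have "\<dots> = (x [^] a) [^] u \<otimes> (x [^] b) [^] v"
    using x by (simp add: int_pow_pow[symmetric] int_pow_int)
  also have "\<dots> \<in> H" using pw[OF a] pw[OF b] subgroup.m_closed[OF H] by blast
  finally show ?thesis .
qed

text \<open>Each fibre of the multiplication map on \<open>H \<times> K\<close> is a copy of
  \<open>H \<inter> K\<close>, by moving an element \<open>d\<close> from one factor to the
  other.\<close>

lemma card_set_mult:
  assumes H: "subgroup H G" and K: "subgroup K G"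
  shows "card (H <#> K) * card (H \<inter> K) = card H * card K"
proof -
  let ?f = "\<lambda>(h,k). h \<otimes> k"
  have fH: "finite H" "finite K" using H K subgroup_finite by auto
  have im: "?f ` (H \<times> K) = H <#> K" by (auto simp: set_mult_def)
  have fib: "card {z \<in> H \<times> K. ?f z = x} = card (H \<inter> K)" if x: "x \<in> H <#> K" for x
  proof -
    obtain h k where hk: "h \<in> H" "k \<in> K" "x = h \<otimes> k" using x by (auto simp: set_mult_def)
    note c = subgroup_carrier[OF H] subgroup_carrier[OF K]
    let ?g = "\<lambda>d. (h \<otimes> d, inv d \<otimes> k)"
    have "bij_betw ?g (H \<inter> K) {z \<in> H \<times> K. ?f z = x}"
    proof (rule bij_betw_byWitness[where f' = "\<lambda>(a,b). inv h \<otimes> a"])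
      show "\<forall>a\<in>H \<inter> K. (case ?g a of (a, b) \<Rightarrow> inv h \<otimes> a) = a" using c hk by auto
      show "\<forall>a'\<in>{z \<in> H \<times> K. ?f z = x}. ?g (case a' of (a, b) \<Rightarrow> inv h \<otimes> a) = a'"
      proof (clarsimp simp: hk)
        fix a b assume ab: "a \<in> H" "b \<in> K" "a \<otimes> b = h \<otimes> k"
        have "inv (inv h \<otimes> a) \<otimes> k = inv a \<otimes> (h \<otimes> k)"
          using ab hk c by (simp add: inv_mult_group m_assoc)
        also have "\<dots> = b" using ab c by (simp add: ab(3)[symmetric])
        finally show "h \<otimes> (inv h \<otimes> a) = a \<and> inv (inv h \<otimes> a) \<otimes> k = b"
          using ab hk c by simp
      qed
      show "?g ` (H \<inter> K) \<subseteq> {z \<in> H \<times> K. ?f z = x}"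
        using hk c subgroup.m_closed[OF H] subgroup.m_closed[OF K] subgroup.m_inv_closed[OF K]
        by (auto simp: m_assoc)
      show "(\<lambda>(a, b). inv h \<otimes> a) ` {z \<in> H \<times> K. ?f z = x} \<subseteq> H \<inter> K"
      proof (intro subsetI)
        fix d assume "d \<in> (\<lambda>(a, b). inv h \<otimes> a) ` {z \<in> H \<times> K. ?f z = x}"
        then obtain a b where ab: "a \<in> H" "b \<in> K" "x = a \<otimes> b" "d = inv h \<otimes> a" by auto
        hence "d \<otimes> b = inv h \<otimes> (h \<otimes> k)" using hk c by (simp add: m_assoc)
        hence "d = k \<otimes> inv b" using hk c ab by (simp add: inv_solve_right)
        thus "d \<in> H \<inter> K"
          using ab(1,2,4) hk H K by (metis IntI subgroup.m_closed subgroup.m_inv_closed)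
      qed
    qed
    from bij_betw_same_card[OF this] show ?thesis by (rule sym)
  qed
  have "card H * card K = card (H \<times> K)" by (simp add: card_cartesian_product)
  also have "\<dots> = (\<Sum>x\<in>H <#> K. card {z \<in> H \<times> K. ?f z = x})"
    using fH im sum.image_gen[of "H \<times> K" "\<lambda>_. 1::nat" ?f] by simp
  also have "\<dots> = card (H <#> K) * card (H \<inter> K)" using fib by simp
  finally show ?thesis by simp
qed

text \<open>An orbit that is not a single fixed point has size a positive power of \<open>p\<close>.
  The action is a plain function with its laws as hypotheses, which suits translation and
  conjugation of cosets; its restriction \<open>\<phi>\<close> supplies the extensional permutations
  that \<open>group_action\<close> demands.\<close>

lemma fixed_points_dvd:
  assumes gr: "group L" and ord: "order L = p ^ n" and S: "finite S"
    and cl: "\<And>g x. g \<in> carrier L \<Longrightarrow> x \<in> S \<Longrightarrow> act g x \<in> S"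
    and one: "\<And>x. x \<in> S \<Longrightarrow> act \<one>\<^bsub>L\<^esub> x = x"
    and mul: "\<And>g h x. g \<in> carrier L \<Longrightarrow> h \<in> carrier L \<Longrightarrow> x \<in> S \<Longrightarrow>
        act (g \<otimes>\<^bsub>L\<^esub> h) x = act g (act h x)"
    and dvd: "p dvd card S"
  shows "p dvd card {x \<in> S. \<forall>g\<in>carrier L. act g x = x}"
proof -
  interpret L: group L by (rule gr)
  define \<phi> where "\<phi> g = restrict (act g) S" for g
  have bij: "bij_betw (act g) S S" if g: "g \<in> carrier L" for g
  proof (rule bij_betw_byWitness[where f' = "act (inv\<^bsub>L\<^esub> g)"])
    show "\<forall>a\<in>S. act (inv\<^bsub>L\<^esub> g) (act g a) = a" using g one by (simp add: mul[symmetric])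
    show "\<forall>a\<in>S. act g (act (inv\<^bsub>L\<^esub> g) a) = a" using g one by (simp add: mul[symmetric])
  qed (use g cl in auto)
  have "group_action L S \<phi>"
  proof (intro group_action.intro group_hom.intro group_hom_axioms.intro homI)
    show "group (BijGroup S)" by (rule group_BijGroup)
    show BG: "\<phi> g \<in> carrier (BijGroup S)" if "g \<in> carrier L" for g
      using bij[OF that] by (simp add: \<phi>_def BijGroup_def Bij_def bij_betw_restrict_eq)
    show "\<phi> (g \<otimes>\<^bsub>L\<^esub> h) = \<phi> g \<otimes>\<^bsub>BijGroup S\<^esub> \<phi> h" if "g \<in> carrier L" "h \<in> carrier L" for g h
    proof -
      have "\<phi> g \<otimes>\<^bsub>BijGroup S\<^esub> \<phi> h = compose S (\<phi> g) (\<phi> h)"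
        using BG[OF that(1)] BG[OF that(2)] by (simp add: BijGroup_def)
      also have "\<dots> = \<phi> (g \<otimes>\<^bsub>L\<^esub> h)"
        using that by (auto simp: \<phi>_def compose_def mul cl)
      finally show ?thesis by simp
    qed
  qed (rule gr)
  then interpret A: group_action L S \<phi> .
  let ?F = "{x \<in> S. \<forall>g\<in>carrier L. act g x = x}"
  have orb: "orbit L \<phi> x = {act g x | g. g \<in> carrier L}" if "x \<in> S" for x
    using that by (auto simp: orbit_def \<phi>_def)
  let ?C = "{B \<in> orbits L S \<phi>. \<not> B \<subseteq> ?F}"
  have fixorb: "orbit L \<phi> x = {x}" if "x \<in> ?F" for x
    using that orb[of x] L.one_closed by force
  have un: "\<Union>?C = S - ?F"
  proof (intro equalityI subsetI)
    fix x assume "x \<in> \<Union>?C"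
    then obtain B where B: "B \<in> orbits L S \<phi>" "\<not> B \<subseteq> ?F" "x \<in> B" by auto
    then obtain y where y: "y \<in> S" "B = orbit L \<phi> y" by (auto simp: orbits_def)
    have xX: "x \<in> S" using B A.orbits_coverture by blast
    hence "y \<in> orbit L \<phi> x" using A.orbit_sym y B by blast
    moreover have "\<not> x \<in> ?F"
    proof
      assume xF: "x \<in> ?F"
      hence "y = x" using fixorb \<open>y \<in> orbit L \<phi> x\<close> by blast
      thus False using B y fixorb[OF xF] xF by simp
    qed
    ultimately show "x \<in> S - ?F" using xX by blast
  next
    fix x assume x: "x \<in> S - ?F"
    hence "x \<in> orbit L \<phi> x" by (simp add: A.orbit_refl)
    thus "x \<in> \<Union>?C" using x by (auto simp: orbits_def)
  qed
  have "p dvd card (\<Union>?C)"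
  proof (rule dvd_partition)
    show "finite (\<Union>?C)" using un S by simp
    show "\<forall>c\<in>?C. p dvd card c"
    proof
      fix B assume B: "B \<in> ?C"
      then obtain y where y: "y \<in> S" "B = orbit L \<phi> y" by (auto simp: orbits_def)
      hence "card B * card (stabilizer L \<phi> y) = p ^ n" using A.orbit_stabilizer_theorem ord by simp
      hence "card B dvd p ^ n" by (metis dvd_triv_left)
      then obtain m where m: "card B = p ^ m" using prime_p divides_primepow_nat by blast
      show "p dvd card B"
      proof (cases m)
        case 0
        then obtain z where z: "B = {z}" using m by (auto simp: card_1_singleton_iff)
        hence "z = y" using y(2) A.orbit_refl[OF y(1)] by simp
        hence "act g y = y" if "g \<in> carrier L" for g using orb[OF y(1)] y(2) z that by auto
        hence "B \<subseteq> ?F" using z \<open>z = y\<close> y by auto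
        thus ?thesis using B by blast
      qed (simp add: m)
    qed
    show "\<forall>c1\<in>?C. \<forall>c2\<in>?C. c1 \<noteq> c2 \<longrightarrow> c1 \<inter> c2 = {}" using A.disjoint_union by blast
  qed
  moreover have "card S = card (S - ?F) + card ?F"
    using S card_Un_disjoint[of "S - ?F" ?F] by (simp add: Un_absorb2 Int_commute)
  ultimately show ?thesis using dvd un by (simp add: dvd_add_right_iff)
qed

subsection \<open>Maximal and Frattini subgroups of finite p-groups\<close>

lemma finite_submonoid_subgroup:
  assumes "S \<subseteq> carrier G" "\<one> \<in> S" "\<And>x y. x \<in> S \<Longrightarrow> y \<in> S \<Longrightarrow> x \<otimes> y \<in> S"
  shows "subgroup S G"
proof (rule subgroupI)
  fix x assume x: "x \<in> S"
  have pw: "x [^] (n::nat) \<in> S" for n using assms x by (induction n) auto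
  have xc: "x \<in> carrier G" using assms x by blast
  have "order G > 0" using fin order_gt_0_iff_finite by blast
  then obtain n where n: "order G = Suc n" by (cases "order G") auto
  have "x [^] n \<otimes> x = \<one>" using pow_order_eq_1[OF xc] n by simp
  hence "inv x = x [^] n" using xc by (simp add: inv_equality)
  thus "inv x \<in> S" using pw by simp
qed (use assms in auto)

lemma conj_closed:
  assumes "subgroup L G" "w \<in> carrier G" "\<forall>l\<in>L. w \<otimes> l \<otimes> inv w \<in> L" "l \<in> L"
  shows "w [^] (i::nat) \<otimes> l \<otimes> inv (w [^] i) \<in> L"
proof (induction i)
  case 0 thus ?case using assms subgroup_carrier by simp
next
  case (Suc i)
  have e: "w [^] Suc i = w \<otimes> w [^] i" using assms(2) by (rule nat_pow_Suc2)
  have "w [^] Suc i \<otimes> l \<otimes> inv (w [^] Suc i) = w \<otimes> (w [^] i \<otimes> l \<otimes> inv (w [^] i)) \<otimes> inv w"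
    unfolding e using assms(2) subgroup_carrier[OF assms(1,4)]
    by (simp add: inv_mult_group m_assoc)
  thus ?case using Suc assms(3) by simp
qed

text \<open>\<open>L1\<close> is the product of \<open>L\<close> with the cyclic group of
  \<open>w\<close>. Exponents below \<open>p\<close> represent all cosets of \<open>L\<close> in it,
  which only bounds the order from above; in p-groups the lower bound comes from
  divisibility.\<close>

lemma adjoin_power:
  assumes L: "subgroup L G" and w: "w \<in> carrier G" and nm: "\<forall>l\<in>L. w \<otimes> l \<otimes> inv w \<in> L"
    and wp: "w [^] p \<in> L"
  defines "L1 \<equiv> {l \<otimes> w [^] (i::nat) | l i. l \<in> L}"
  shows "subgroup L1 G" "L \<subseteq> L1" "w \<in> L1" "card L1 \<le> p * card L"
proof -
  note c = subgroup_carrier[OF L]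
  have one: "\<one> \<in> L" using L subgroup.one_closed by blast
  show LL1: "L \<subseteq> L1"
  proof
    fix l assume "l \<in> L"
    thus "l \<in> L1" unfolding L1_def using c by (intro CollectI exI[of _ l] exI[of _ "0::nat"]) auto
  qed
  show "w \<in> L1" unfolding L1_def using w one
    by (intro CollectI exI[of _ \<one>] exI[of _ "1::nat"]) auto
  show "subgroup L1 G"
  proof (rule finite_submonoid_subgroup)
    show "L1 \<subseteq> carrier G" using c w by (auto simp: L1_def)
    show "\<one> \<in> L1" using LL1 one by blast
    fix x y assume "x \<in> L1" "y \<in> L1"
    then obtain l i l' j where xy: "x = l \<otimes> w [^] (i::nat)" "y = l' \<otimes> w [^] (j::nat)" "l \<in> L" "l' \<in> L"
      by (auto simp: L1_def)
    have "x \<otimes> y = l \<otimes> (w [^] i \<otimes> l' \<otimes> inv (w [^] i)) \<otimes> w [^] (i + j)"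
      using xy c w by (simp add: nat_pow_mult[symmetric] m_assoc)
    thus "x \<otimes> y \<in> L1" using conj_closed[OF L w nm xy(4)] subgroup.m_closed[OF L] xy(3)
      by (auto simp: L1_def)
  qed
  have "L1 \<subseteq> (\<Union>i\<in>{..<p}. L #> w [^] i)"
  proof
    fix x assume "x \<in> L1"
    then obtain l i where x: "x = l \<otimes> w [^] (i::nat)" "l \<in> L" by (auto simp: L1_def)
    have "w [^] i = w [^] (p * (i div p) + i mod p)" by simp
    also have "\<dots> = (w [^] p) [^] (i div p) \<otimes> w [^] (i mod p)"
      using w by (simp add: nat_pow_mult nat_pow_pow del: mult_div_mod_eq)
    finally have "x = (l \<otimes> (w [^] p) [^] (i div p)) \<otimes> w [^] (i mod p)"
      using x w c by (simp add: m_assoc)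
    moreover have "l \<otimes> (w [^] p) [^] (i div p) \<in> L"
      using subgroup_pow[OF L wp] subgroup.m_closed[OF L] x by blast
    moreover have "i mod p < p" using prime_p prime_gt_0_nat by simp
    ultimately show "x \<in> (\<Union>i\<in>{..<p}. L #> w [^] i)" by (auto simp: r_coset_def)
  qed
  hence "card L1 \<le> card (\<Union>i\<in>{..<p}. L #> w [^] i)"
    using subgroup_finite[OF L] by (intro card_mono) (auto simp: r_coset_def)
  also have "\<dots> \<le> (\<Sum>i\<in>{..<p}. card (L #> w [^] i))" by (rule card_UN_le) simp
  also have "\<dots> = (\<Sum>i\<in>{..<p}. card L)"
    by (intro sum.cong refl card_rcosets_equal[symmetric] rcosetsI subgroup.subset[OF L] nat_pow_closed w)
  finally show "card L1 \<le> p * card L" by simp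
qed

text \<open>\<open>L\<close> permutes its right cosets in \<open>P\<close> by right multiplication.
  The coset \<open>L\<close> is fixed and the number of fixed cosets is divisible by
  \<open>p\<close>, so another coset \<open>L #> x\<close> is fixed, and then \<open>x\<close>
  normalizes \<open>L\<close>.\<close>

lemma normalizer_grows:
  assumes P: "p_subgroup P" and L: "subgroup L G" and lt: "L \<subset> P"
  shows "\<exists>x\<in>P - L. \<forall>l\<in>L. x \<otimes> l \<otimes> inv x \<in> L"
proof -
  have sP: "subgroup P G" using P p_subgroupD by blast
  note cP = subgroup_carrier[OF sP] and cL = subgroup_carrier[OF L]
  let ?P = "G\<lparr>carrier := P\<rparr>"
  define R where "R = rcosets\<^bsub>?P\<^esub> L"
  have R: "R = (\<lambda>x. L #> x) ` P" by (auto simp: R_def RCOSETS_def)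
  have finR: "finite R" using R subgroup_finite[OF sP] by simp
  have LPsub: "subgroup L ?P" using subgroup_incl[OF L sP] lt by blast
  have "card R * card L = card P"
    using group.lagrange[OF subgroup_imp_group[OF sP] LPsub] by (simp add: order_def R_def)
  moreover have "p * card L dvd card P" using p_subgroup_card_less[OF P L lt] .
  ultimately have "p * card L dvd card R * card L" by simp
  hence dR: "p dvd card R" using subgroup_card_pos[OF L] by simp
  obtain m where m: "card L = p ^ m"
    using p_subgroup_subset[OF P L] lt unfolding p_subgroup_def by blast
  let ?F = "{C \<in> R. \<forall>l\<in>carrier (G\<lparr>carrier := L\<rparr>). C #> inv l = C}"
  have sub: "C \<subseteq> carrier G" if "C \<in> R" for C
    using that R r_coset_subset_G subgroup.subset[OF L] cP by auto
  have "p dvd card ?F"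
  proof (rule fixed_points_dvd[where L = "G\<lparr>carrier := L\<rparr>" and n = m])
    show "group (G\<lparr>carrier := L\<rparr>)" using subgroup_imp_group[OF L] .
    show "order (G\<lparr>carrier := L\<rparr>) = p ^ m" by (simp add: order_def m)
    fix g h C assume g: "g \<in> carrier (G\<lparr>carrier := L\<rparr>)" and C: "C \<in> R"
    then obtain x where x: "x \<in> P" "C = L #> x" using R by blast
    have "C #> inv g = L #> (x \<otimes> inv g)"
      using x g cP cL subgroup.subset[OF L] by (simp add: coset_mult_assoc)
    moreover have "x \<otimes> inv g \<in> P"
      using x g lt subgroup.m_closed[OF sP] subgroup.m_inv_closed[OF sP] by auto
    ultimately show "C #> inv g \<in> R" using R by blast
    assume h: "h \<in> carrier (G\<lparr>carrier := L\<rparr>)"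
    show "C #> inv (g \<otimes>\<^bsub>G\<lparr>carrier := L\<rparr>\<^esub> h) = C #> inv h #> inv g"
      using g h cL sub[OF C] by (simp add: inv_mult_group coset_mult_assoc)
  qed (use finR dR sub in auto)
  moreover have LF: "L \<in> ?F"
  proof -
    have "L #> \<one> = L" using subgroup.subset[OF L] by simp
    moreover have "\<one> \<in> P" using sP subgroup.one_closed by blast
    ultimately have "L \<in> R" using R by (metis imageI)
    thus ?thesis using cL L by (simp add: coset_join2 subgroup.m_inv_closed)
  qed
  ultimately have "?F \<noteq> {L}" using prime_gt_1_nat[OF prime_p]
    by (metis card_1_singleton_iff nat_dvd_1_iff_1 One_nat_def less_irrefl)
  then obtain C where C: "C \<in> R" "\<forall>l\<in>L. C #> inv l = C" "C \<noteq> L" using LF by auto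
  then obtain x where x: "x \<in> P" "C = L #> x" using R by blast
  have "x \<otimes> l \<otimes> inv x \<in> L" if l: "l \<in> L" for l
  proof -
    have "C #> inv (inv l) = C" using C(2) subgroup.m_inv_closed[OF L l] by blast
    hence "L #> (x \<otimes> l) = L #> x"
      using x l cP cL subgroup.subset[OF L] by (simp add: coset_mult_assoc)
    hence "x \<otimes> l \<in> L #> x" using rcos_self[of "x \<otimes> l" L] L l x cP cL by simp
    thus ?thesis using subgroup.rcos_module_imp[OF L is_group] x cP by blast
  qed
  moreover have "x \<notin> L" using C x coset_join2 L cL by auto
  ultimately show ?thesis using x by blast
qed

lemma p_subgroup_extend:
  assumes P: "p_subgroup P" and L: "subgroup L G" and lt: "L \<subset> P"
  obtains L1 w where "subgroup L1 G" "L \<subset> L1" "L1 \<subseteq> P" "card L1 = p * card L" "w \<in> P" "w [^] p \<in> L"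
    "\<forall>l\<in>L. w \<otimes> l \<otimes> inv w \<in> L" "L1 = {l \<otimes> w [^] (i::nat) | l i. l \<in> L}"
proof -
  have sP: "subgroup P G" using P p_subgroupD by blast
  note cP = subgroup_carrier[OF sP]
  obtain x where x: "x \<in> P" "x \<notin> L" and nm: "\<forall>l\<in>L. x \<otimes> l \<otimes> inv x \<in> L"
    using normalizer_grows[OF assms] by blast
  obtain n where n: "card P = p ^ n" using P p_subgroup_def by blast
  have ex: "x [^] (p ^ n) \<in> L" using pow_card_eq_one[OF sP x(1)] n subgroup.one_closed[OF L] by simp
  \<comment> \<open>Among the iterated p-th powers of \<open>x\<close>, the last one outside
    \<open>L\<close> has its own p-th power in \<open>L\<close>, so adjoining it gives index
    \<open>p\<close>.\<close>
  define j where "j = (LEAST j. x [^] (p ^ j) \<in> L)"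
  have j: "x [^] (p ^ j) \<in> L" unfolding j_def by (rule LeastI[of _ n]) (rule ex)
  have "j \<noteq> 0" using j x cP by (cases j) auto
  then obtain i where i: "j = Suc i" by (cases j) auto
  have ni: "x [^] (p ^ i) \<notin> L" using not_less_Least[of i "\<lambda>j. x [^] (p ^ j) \<in> L"] i j_def by simp
  define w where "w = x [^] (p ^ i)"
  have wP: "w \<in> P" using subgroup_pow[OF sP x(1)] w_def by simp
  have wp: "w [^] p \<in> L" using j i x cP by (simp add: w_def nat_pow_pow mult.commute)
  have nmw: "\<forall>l\<in>L. w \<otimes> l \<otimes> inv w \<in> L" unfolding w_def using conj_closed[OF L _ nm] x cP by blast
  define L1 where "L1 = {l \<otimes> w [^] (i::nat) | l i. l \<in> L}"
  have L1: "subgroup L1 G" "L \<subseteq> L1" "w \<in> L1" "card L1 \<le> p * card L"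
    unfolding L1_def using adjoin_power[OF L _ nmw wp] wP cP by blast+
  have L1P: "L1 \<subseteq> P"
    unfolding L1_def using lt subgroup_pow[OF sP wP] subgroup.m_closed[OF sP] by blast
  have lt1: "L \<subset> L1" using L1 ni w_def by blast
  have "p * card L dvd card L1"
    using p_subgroup_card_less[OF p_subgroup_subset[OF P L1(1) L1P] L lt1] .
  from dvd_imp_le[OF this subgroup_card_pos[OF L1(1)]]
  have c1: "card L1 = p * card L" using L1(4) by simp
  show ?thesis using that[OF L1(1) lt1 L1P c1 wP wp nmw L1_def] .
qed

lemma p_subgroup_between:
  assumes P: "p_subgroup P" and L: "subgroup L G" "L \<subseteq> P" and le: "card L \<le> p ^ k" "p ^ k \<le> card P"
  shows "\<exists>H. subgroup H G \<and> L \<subseteq> H \<and> H \<subseteq> P \<and> card H = p ^ k"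
proof -
  have p1: "p > 1" using prime_gt_1_nat[OF prime_p] .
  obtain m where m: "card L = p ^ m" using p_subgroup_subset[OF P L] p_subgroup_def by blast
  have "m \<le> k" using le(1) m p1 by simp
  thus ?thesis using le(2)
  proof (induction k rule: dec_induct)
    case base thus ?case using L m by blast
  next
    case (step j)
    have "p ^ j < p ^ Suc j" using p1 by simp
    hence "p ^ j < card P" using step.prems by linarith
    then obtain H where H: "subgroup H G" "L \<subseteq> H" "H \<subseteq> P" "card H = p ^ j"
      using step.IH by auto
    have "H \<subset> P" using H \<open>p ^ j < card P\<close> by auto
    then obtain H1 where "subgroup H1 G" "H \<subset> H1" "H1 \<subseteq> P" "card H1 = p * card H"
      by (rule p_subgroup_extend[OF P H(1)])
    thus ?case using H by (intro exI[of _ H1]) auto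
  qed
qed

lemma maximal_subgroup_restrict:
  assumes "subgroup P G"
  shows "maximal_in M P \<longleftrightarrow>
    subgroup M G \<and> M \<subset> P \<and> (\<forall>L. subgroup L G \<and> M \<subseteq> L \<and> L \<subseteq> P \<longrightarrow> L = M \<or> L = P)"
proof -
  have "subgroup L (G\<lparr>carrier := P\<rparr>) \<longleftrightarrow> subgroup L G \<and> L \<subseteq> P" for L
    using incl_subgroup[OF assms] subgroup_incl[OF _ assms] subgroup.subset
    by (metis partial_object.select_convs(1) partial_object.update_convs(1) partial_object.surjective)
  thus ?thesis unfolding maximal_subgroup_def by auto
qed

lemma maximalD:
  assumes "subgroup P G" "maximal_in M P"
  shows "subgroup M G" "M \<subset> P" "M \<subseteq> P" "\<And>L. subgroup L G \<Longrightarrow> M \<subseteq> L \<Longrightarrow> L \<subseteq> P \<Longrightarrow> L = M \<or> L = P"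
  using assms(2) unfolding maximal_subgroup_restrict[OF assms(1)] by auto

lemma maximalI:
  assumes "subgroup P G" "subgroup M G" "M \<subset> P"
    "\<And>L. subgroup L G \<Longrightarrow> M \<subseteq> L \<Longrightarrow> L \<subseteq> P \<Longrightarrow> L = M \<or> L = P"
  shows "maximal_in M P"
  unfolding maximal_subgroup_restrict[OF assms(1)] using assms(2-4) by auto

text \<open>Normalizers grow, so a maximal subgroup is normal of index \<open>p\<close>. The
  explicit form of \<open>P\<close> is a normal form for computing modulo \<open>M\<close> without
  the quotient group.\<close>

lemma maximal_p_subgroup:
  assumes P: "p_subgroup P" and M: "maximal_in M P"
  obtains w where "card P = p * card M" "w \<in> P" "w [^] p \<in> M" "\<forall>l\<in>M. w \<otimes> l \<otimes> inv w \<in> M"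
     "P = {l \<otimes> w [^] (i::nat) | l i. l \<in> M}"
proof -
  note M' = maximalD[OF p_subgroupD[OF P] M]
  obtain L1 w where L1: "subgroup L1 G" "M \<subset> L1" "L1 \<subseteq> P" "card L1 = p * card M" "w \<in> P" "w [^] p \<in> M"
    "\<forall>l\<in>M. w \<otimes> l \<otimes> inv w \<in> M" "L1 = {l \<otimes> w [^] (i::nat) | l i. l \<in> M}"
    by (rule p_subgroup_extend[OF P M'(1,2)])
  have e: "L1 = P" using M'(4)[OF L1(1) _ L1(3)] L1(2) by blast
  show ?thesis using that[OF L1(4-8)[unfolded e]] .
qed

lemma maximal_card:
  assumes "p_subgroup P" "maximal_in M P"
  shows "card P = p * card M"
  using assms by (rule maximal_p_subgroup)

lemma index_p_maximal:
  assumes P: "p_subgroup P" and M: "subgroup M G" "M \<subseteq> P" "card P = p * card M"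
  shows "maximal_in M P"
proof -
  have sP: "subgroup P G" using P p_subgroupD by blast
  have pos: "card M > 0" using M subgroup_card_pos by blast
  have "M \<noteq> P" using M(3) pos prime_gt_1_nat[OF prime_p] by auto
  moreover have "L = M \<or> L = P" if L: "subgroup L G" "M \<subseteq> L" "L \<subseteq> P" for L
  proof (rule ccontr)
    assume n: "\<not> (L = M \<or> L = P)"
    have "p * card M dvd card L"
      using p_subgroup_card_less[OF p_subgroup_subset[OF P L(1,3)] M(1)] L n by blast
    hence "card P \<le> card L" using M(3) subgroup_card_pos[OF L(1)] by (simp add: dvd_imp_le)
    thus False using n L card_seteq[OF subgroup_finite[OF sP] L(3)] by blast
  qed
  ultimately show ?thesis using M by (intro maximalI[OF sP]) auto
qed

lemma exists_maximal:
  assumes P: "subgroup P G" and L: "subgroup L G" "L \<subset> P"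
  shows "\<exists>M. maximal_in M P \<and> L \<subseteq> M"
proof -
  let ?A = "{M. subgroup M G \<and> M \<subset> P}"
  have "finite ?A" using subgroup_finite[OF P] by (auto intro: finite_subset[of _ "Pow P"])
  from finite_has_maximal2[OF this, of L]
  obtain M where M: "M \<in> ?A" "L \<subseteq> M" "\<And>N. N \<in> ?A \<Longrightarrow> M \<subseteq> N \<Longrightarrow> M = N"
    using L by auto
  have "maximal_in M P"
  proof (rule maximalI[OF P])
    fix N assume "subgroup N G" "M \<subseteq> N" "N \<subseteq> P"
    thus "N = M \<or> N = P" using M(3)[of N] by blast
  qed (use M(1) in auto)
  thus ?thesis using M(2) by blast
qed

lemma Phi_iff: "x \<in> Phi P \<longleftrightarrow> x \<in> P \<and> (\<forall>M. maximal_in M P \<longrightarrow> x \<in> M)"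
  by (auto simp: frattini_def)

lemma Phi_subset: "Phi P \<subseteq> P"
  by (auto simp: frattini_def)

lemma Phi_subgroup:
  assumes P: "subgroup P G" shows "subgroup (Phi P) G"
proof -
  have "Phi P = \<Inter> (insert P {M. maximal_in M P})"
    by (auto simp: frattini_def)
  also have "subgroup \<dots> G"
    using P maximalD(1)[OF P] by (intro subgroups_Inter) auto
  finally show ?thesis .
qed

lemma Phi_nongenerator:
  assumes P: "subgroup P G" and L: "subgroup L G" "L \<subseteq> P" and g: "P \<subseteq> L <#> S" "S \<subseteq> Phi P"
  shows "L = P"
proof (rule ccontr)
  assume "L \<noteq> P"
  then obtain M where M: "maximal_in M P" "L \<subseteq> M"
    using exists_maximal[OF P L(1)] L by blast
  have "S \<subseteq> M" using g M Phi_iff by blast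
  hence "L <#> S \<subseteq> M"
    using M(2) subgroup.m_closed[OF maximalD(1)[OF P M(1)]] by (auto simp: set_mult_def)
  thus False using g maximalD(2)[OF P M(1)] by blast
qed

text \<open>\<open>P/M\<close> is cyclic of order \<open>p\<close> for each maximal
  \<open>M\<close>: in normal form, the p-th power carries a power of \<open>w [^] p\<close>, which
  lies in \<open>M\<close>.\<close>

lemma Phi_power:
  assumes P: "p_subgroup P" and x: "x \<in> P"
  shows "x [^] p \<in> Phi P"
proof -
  have sP: "subgroup P G" using P p_subgroupD by blast
  note cP = subgroup_carrier[OF sP]
  have "x [^] p \<in> M" if M: "maximal_in M P" for M
  proof -
    note sM = maximalD(1)[OF sP M]
    obtain w where w: "w \<in> P" "w [^] p \<in> M" "\<forall>l\<in>M. w \<otimes> l \<otimes> inv w \<in> M"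
      "P = {l \<otimes> w [^] (i::nat) | l i. l \<in> M}" by (rule maximal_p_subgroup[OF P M])
    obtain l i where li: "x = l \<otimes> w [^] (i::nat)" "l \<in> M" using x w(4) by blast
    have "\<exists>m\<in>M. x [^] n = m \<otimes> w [^] (i * n)" for n :: nat
    proof (induction n)
      case 0 thus ?case using subgroup.one_closed[OF sM] by (intro bexI[of _ \<one>]) auto
    next
      case (Suc n)
      then obtain m where m: "m \<in> M" "x [^] n = m \<otimes> w [^] (i * n)" by blast
      have "x [^] Suc n = m \<otimes> (w [^] (i * n) \<otimes> l \<otimes> inv (w [^] (i * n))) \<otimes> w [^] (i * n + i)"
        using m li w(1) cP subgroup_carrier[OF sM] by (simp add: nat_pow_mult[symmetric] m_assoc)
      moreover have "m \<otimes> (w [^] (i * n) \<otimes> l \<otimes> inv (w [^] (i * n))) \<in> M"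
        using m conj_closed[OF sM _ w(3) li(2)] w(1) cP subgroup.m_closed[OF sM] by blast
      ultimately show ?case by (metis add.commute mult_Suc_right)
    qed
    then obtain m where "m \<in> M" "x [^] p = m \<otimes> w [^] (i * p)" by blast
    moreover have "w [^] (i * p) = (w [^] p) [^] i" using w cP by (simp add: nat_pow_pow mult.commute)
    ultimately show ?thesis using subgroup_pow[OF sM w(2)] subgroup.m_closed[OF sM] by simp
  qed
  thus ?thesis using Phi_iff subgroup_pow[OF sP x] by blast
qed

text \<open>\<open>P/M\<close> is abelian for each maximal \<open>M\<close>: the normal forms of
  \<open>x \<otimes> y\<close> and \<open>y \<otimes> x\<close> have the same exponent of
  \<open>w\<close>, which cancels in the commutator.\<close>

lemma Phi_commutator:
  assumes P: "p_subgroup P" and x: "x \<in> P" and y: "y \<in> P"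
  shows "x \<otimes> y \<otimes> inv x \<otimes> inv y \<in> Phi P"
proof -
  have sP: "subgroup P G" using P p_subgroupD by blast
  note cP = subgroup_carrier[OF sP]
  have "x \<otimes> y \<otimes> inv x \<otimes> inv y \<in> M" if M: "maximal_in M P" for M
  proof -
    note sM = maximalD(1)[OF sP M]
    obtain w where w: "w \<in> P" "w [^] p \<in> M" "\<forall>l\<in>M. w \<otimes> l \<otimes> inv w \<in> M"
      "P = {l \<otimes> w [^] (i::nat) | l i. l \<in> M}" by (rule maximal_p_subgroup[OF P M])
    have pr: "\<exists>m\<in>M. l \<otimes> w [^] i \<otimes> (l' \<otimes> w [^] j) = m \<otimes> w [^] (i + j)"
      if "l \<in> M" "l' \<in> M" for l l' and i j :: nat
    proof -
      have "l \<otimes> w [^] i \<otimes> (l' \<otimes> w [^] j) = l \<otimes> (w [^] i \<otimes> l' \<otimes> inv (w [^] i)) \<otimes> w [^] (i + j)"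
        using that w(1) cP subgroup_carrier[OF sM] by (simp add: nat_pow_mult[symmetric] m_assoc)
      moreover have "l \<otimes> (w [^] i \<otimes> l' \<otimes> inv (w [^] i)) \<in> M"
        using that conj_closed[OF sM _ w(3)] w(1) cP subgroup.m_closed[OF sM] by blast
      ultimately show ?thesis by blast
    qed
    obtain l i where li: "x = l \<otimes> w [^] (i::nat)" "l \<in> M" using x w(4) by blast
    obtain l' j where lj: "y = l' \<otimes> w [^] (j::nat)" "l' \<in> M" using y w(4) by blast
    obtain m m' where m: "m \<in> M" "m' \<in> M" "x \<otimes> y = m \<otimes> w [^] (i + j)" "y \<otimes> x = m' \<otimes> w [^] (j + i)"
      using pr[OF li(2) lj(2), of i j] pr[OF lj(2) li(2), of j i] li lj by blast
    have "x \<otimes> y \<otimes> inv x \<otimes> inv y = x \<otimes> y \<otimes> inv (y \<otimes> x)"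
      using x y cP by (simp add: inv_mult_group m_assoc)
    also have "\<dots> = m \<otimes> inv m'"
      unfolding m(3,4) using m(1,2) w(1) cP subgroup_carrier[OF sM]
      by (simp add: inv_mult_group m_assoc add.commute)
    finally show ?thesis using m subgroup.m_closed[OF sM] subgroup.m_inv_closed[OF sM] by simp
  qed
  moreover have "x \<otimes> y \<otimes> inv x \<otimes> inv y \<in> P"
    using x y subgroup.m_closed[OF sP] subgroup.m_inv_closed[OF sP] by simp
  ultimately show ?thesis using Phi_iff by blast
qed

text \<open>A maximal subgroup of \<open>P\<close> has index \<open>p\<close>, so it either contains
  \<open>H\<close> or meets \<open>H\<close> in a subgroup of index \<open>p\<close>, which is
  maximal in \<open>H\<close>.\<close>

lemma Phi_mono:
  assumes P: "p_subgroup P" and H: "subgroup H G" "H \<subseteq> P"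
  shows "Phi H \<subseteq> Phi P"
proof
  fix x assume x: "x \<in> Phi H"
  have sP: "subgroup P G" using P p_subgroupD by blast
  have "x \<in> M" if M: "maximal_in M P" for M
  proof (cases "H \<subseteq> M")
    case True thus ?thesis using x Phi_subset by blast
  next
    case False
    note sM = maximalD(1,3)[OF sP M]
    have I: "subgroup (H \<inter> M) G" using H sM subgroups_Inter_pair by blast
    have "H <#> M \<subseteq> P" using H sM subgroup.m_closed[OF sP] by (auto simp: set_mult_def)
    hence "card (H <#> M) \<le> p * card M"
      using maximal_card[OF P M] card_mono[OF subgroup_finite[OF sP]] by metis
    hence "card H * card M \<le> p * card (H \<inter> M) * card M"
      using card_set_mult[OF H(1) sM(1)] by (metis mult.assoc mult.commute mult_le_mono1)
    hence "card H \<le> p * card (H \<inter> M)" using subgroup_card_pos[OF sM(1)] by simp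
    moreover have "p * card (H \<inter> M) dvd card H"
      using p_subgroup_card_less[OF p_subgroup_subset[OF P H] I] False by blast
    ultimately have "card H = p * card (H \<inter> M)"
      using subgroup_card_pos[OF H(1)] dvd_imp_le le_antisym by blast
    hence "maximal_in (H \<inter> M) H"
      using index_p_maximal[OF p_subgroup_subset[OF P H] I] by blast
    thus ?thesis using x Phi_iff by blast
  qed
  thus "x \<in> Phi P" using x Phi_subset H Phi_iff by blast
qed

text \<open>Conjugation by \<open>g\<close> is invertible on \<open>P\<close>, so it permutes the
  maximal subgroups; \<open>?N\<close> is the preimage of \<open>M\<close>. The lemma is also
  applied with \<open>P = carrier G\<close>.\<close>

lemma Phi_conj:
  assumes P: "subgroup P G" and g: "g \<in> carrier G"
    and nm: "\<And>x. x \<in> P \<Longrightarrow> g \<otimes> x \<otimes> inv g \<in> P" "\<And>x. x \<in> P \<Longrightarrow> inv g \<otimes> x \<otimes> g \<in> P"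
    and x: "x \<in> Phi P"
  shows "g \<otimes> x \<otimes> inv g \<in> Phi P"
proof -
  note cP = subgroup_carrier[OF P]
  have preimage: "subgroup {y \<in> P. h \<otimes> y \<otimes> inv h \<in> L} G" if L: "subgroup L G" and h: "h \<in> carrier G" for L h
  proof (rule finite_submonoid_subgroup)
    fix a b assume a: "a \<in> {y \<in> P. h \<otimes> y \<otimes> inv h \<in> L}" and b: "b \<in> {y \<in> P. h \<otimes> y \<otimes> inv h \<in> L}"
    have "h \<otimes> (a \<otimes> b) \<otimes> inv h = (h \<otimes> a \<otimes> inv h) \<otimes> (h \<otimes> b \<otimes> inv h)"
      using a b h cP by (simp add: m_assoc)
    thus "a \<otimes> b \<in> {y \<in> P. h \<otimes> y \<otimes> inv h \<in> L}"
      using a b subgroup.m_closed[OF P] subgroup.m_closed[OF L] by simp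
  qed (use cP h subgroup.one_closed[OF P] subgroup.one_closed[OF L] in auto)
  have undo: "inv g \<otimes> (g \<otimes> y \<otimes> inv g) \<otimes> inv (inv g) = y" "g \<otimes> (inv g \<otimes> y \<otimes> g) \<otimes> inv g = y"
    if "y \<in> P" for y using that g cP by (simp_all add: m_assoc)
  have "g \<otimes> x \<otimes> inv g \<in> M" if M: "maximal_in M P" for M
  proof -
    note M' = maximalD[OF P M]
    let ?N = "{y \<in> P. g \<otimes> y \<otimes> inv g \<in> M}"
    have "maximal_in ?N P"
    proof (rule maximalI[OF P preimage[OF M'(1) g]])
      obtain y where y: "y \<in> P" "y \<notin> M" using M'(2) by blast
      hence "inv g \<otimes> y \<otimes> g \<notin> ?N" using undo(2) by simp
      thus "?N \<subset> P" using nm(2)[OF y(1)] by blast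
    next
      fix L assume L: "subgroup L G" "?N \<subseteq> L" "L \<subseteq> P"
      let ?L = "{y \<in> P. inv g \<otimes> y \<otimes> inv (inv g) \<in> L}"
      have "M \<subseteq> ?L"
      proof
        fix y assume y: "y \<in> M"
        hence yP: "y \<in> P" using M'(3) by blast
        have "inv g \<otimes> y \<otimes> g \<in> ?N" using nm(2)[OF yP] undo(2)[OF yP] y by simp
        thus "y \<in> ?L" using L(2) yP g by auto
      qed
      moreover have "subgroup ?L G" using preimage[OF L(1), of "inv g"] g by simp
      ultimately have "?L = M \<or> ?L = P" using M'(4)[of ?L] by blast
      moreover have "y \<in> L \<longleftrightarrow> g \<otimes> y \<otimes> inv g \<in> ?L" if "y \<in> P" for y
        using that nm(1) undo(1) by simp
      ultimately show "L = ?N \<or> L = P" using L(3) nm(1) by blast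
    qed
    thus ?thesis using x Phi_iff[of x P] by blast
  qed
  thus ?thesis using Phi_iff[of _ P] nm(1)[of x] x by simp
qed

subsection \<open>Transfer\<close>

lemma hom_kernel_card:
  assumes A: "group A" and f: "f \<in> hom G A"
  shows "card (f ` carrier G) * card (kernel G A f) = order G" "subgroup (f ` carrier G) A"
proof -
  interpret h: group_hom G A f using A f by (simp add: group_hom_def group_hom_axioms_def)
  let ?A = "A\<lparr>carrier := f ` carrier G\<rparr>"
  show sub: "subgroup (f ` carrier G) A" by (rule h.img_is_subgroup)
  interpret h2: group_hom G ?A f
    using h.H.subgroup_imp_group[OF sub] f
    by (auto simp: group_hom_def group_hom_axioms_def hom_def)
  have "(\<lambda>S. the_elem (f ` S)) \<in> iso (G Mod kernel G ?A f) ?A"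
    by (rule h2.FactGroup_iso_set) simp
  hence "card (carrier (G Mod kernel G ?A f)) = card (f ` carrier G)"
    using bij_betw_same_card by (fastforce simp: iso_def)
  moreover have "kernel G ?A f = kernel G A f" by (simp add: kernel_def)
  ultimately show "card (f ` carrier G) * card (kernel G A f) = order G"
    using lagrange[OF h.subgroup_kernel] by (simp add: FactGroup_def)
qed

text \<open>\<open>Q1\<close> is maximal among the P-invariant proper subgroups of \<open>Q\<close>,
  and \<open>F\<close> is the preimage of the fixed points of \<open>P\<close> on
  \<open>Q/Q1\<close>. Since \<open>P\<close> is a p-group, \<open>F\<close> is larger than
  \<open>Q1\<close>; being P-invariant, it is \<open>Q\<close>. So \<open>Q/Q1\<close> is a central
  chief factor.\<close>

lemma chief_step:
  assumes P: "p_subgroup P" and Q: "subgroup Q G" "Q \<subseteq> P" "Q \<noteq> {\<one>}"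
    and nm: "\<And>x q. x \<in> P \<Longrightarrow> q \<in> Q \<Longrightarrow> x \<otimes> q \<otimes> inv x \<in> Q"
  obtains Q1 where "subgroup Q1 G" "Q1 \<subset> Q"
    "\<And>x q. x \<in> P \<Longrightarrow> q \<in> Q \<Longrightarrow> x \<otimes> q \<otimes> inv x \<otimes> inv q \<in> Q1"
proof -
  note sP = p_subgroupD[OF P]
  note cP = subgroup_carrier[OF sP] and cQ = subgroup_carrier[OF Q(1)]
  let ?A = "{L. subgroup L G \<and> L \<subset> Q \<and> (\<forall>x\<in>P. \<forall>q\<in>L. x \<otimes> q \<otimes> inv x \<in> L)}"
  have "finite ?A" using subgroup_finite[OF Q(1)] by (auto intro: finite_subset[of _ "Pow Q"])
  moreover have "{\<one>} \<in> ?A" using triv_subgroup Q subgroup.one_closed[OF Q(1)] cP by auto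
  ultimately obtain Q1 where Q1: "Q1 \<in> ?A" "\<And>L. L \<in> ?A \<Longrightarrow> Q1 \<subseteq> L \<Longrightarrow> Q1 = L"
    using finite_has_maximal2[of ?A "{\<one>}"] by (metis (no_types, lifting))
  have s1: "subgroup Q1 G" and lt: "Q1 \<subset> Q" and n1: "\<And>x q. x \<in> P \<Longrightarrow> q \<in> Q1 \<Longrightarrow> x \<otimes> q \<otimes> inv x \<in> Q1"
    using Q1(1) by auto
  note c1 = subgroup_carrier[OF s1]
  define F where "F = {q \<in> Q. \<forall>x\<in>P. x \<otimes> q \<otimes> inv x \<otimes> inv q \<in> Q1}"
  have invP: "inv x \<in> P" if "x \<in> P" for x using subgroup.m_inv_closed[OF sP that] .
  have "\<exists>q\<in>F. q \<notin> Q1"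
  proof -
    let ?Q = "G\<lparr>carrier := Q\<rparr>" and ?P = "G\<lparr>carrier := P\<rparr>"
    define R where "R = rcosets\<^bsub>?Q\<^esub> Q1"
    have R: "R = (\<lambda>x. Q1 #> x) ` Q" by (auto simp: R_def RCOSETS_def)
    have finR: "finite R" using R subgroup_finite[OF Q(1)] by simp
    have "card R * card Q1 = card Q"
      using group.lagrange[OF subgroup_imp_group[OF Q(1)] subgroup_incl[OF s1 Q(1)]] lt
      by (simp add: order_def R_def)
    moreover have "p * card Q1 dvd card Q"
      using p_subgroup_card_less[OF p_subgroup_subset[OF P Q(1,2)] s1 lt] .
    ultimately have "p * card Q1 dvd card R * card Q1" by simp
    hence dR: "p dvd card R" using subgroup_card_pos[OF s1] by simp
    obtain m where m: "card P = p ^ m" using P unfolding p_subgroup_def by blast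
    let ?act = "\<lambda>x C. (\<lambda>c. x \<otimes> c \<otimes> inv x) ` C"
    let ?F = "{C \<in> R. \<forall>x\<in>carrier ?P. ?act x C = C}"
    have sub: "C \<subseteq> carrier G" if "C \<in> R" for C
      using that R r_coset_subset_G[OF subgroup.subset[OF s1]] cQ by auto
    have act: "?act x (Q1 #> q) = Q1 #> (x \<otimes> q \<otimes> inv x)" if x: "x \<in> P" and q: "q \<in> Q" for x q
    proof (intro equalityI subsetI)
      fix y assume "y \<in> ?act x (Q1 #> q)"
      then obtain l where l: "l \<in> Q1" "y = x \<otimes> (l \<otimes> q) \<otimes> inv x" by (auto simp: r_coset_def)
      hence "y = (x \<otimes> l \<otimes> inv x) \<otimes> (x \<otimes> q \<otimes> inv x)" using x q cP cQ c1 by (simp add: m_assoc)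
      thus "y \<in> Q1 #> (x \<otimes> q \<otimes> inv x)" using n1[OF x l(1)] by (auto simp: r_coset_def)
    next
      fix y assume "y \<in> Q1 #> (x \<otimes> q \<otimes> inv x)"
      then obtain l where l: "l \<in> Q1" "y = l \<otimes> (x \<otimes> q \<otimes> inv x)" by (auto simp: r_coset_def)
      hence "y = x \<otimes> ((inv x \<otimes> l \<otimes> inv (inv x)) \<otimes> q) \<otimes> inv x" using x q cP cQ c1 by (simp add: m_assoc)
      moreover have "inv x \<otimes> l \<otimes> inv (inv x) \<in> Q1" using n1[OF invP[OF x] l(1)] .
      ultimately show "y \<in> ?act x (Q1 #> q)" unfolding r_coset_def by blast
    qed
    have "p dvd card ?F"
    proof (rule fixed_points_dvd[where L = ?P and n = m])
      show "group ?P" using subgroup_imp_group[OF sP] .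
      show "order ?P = p ^ m" by (simp add: order_def m)
      fix C assume C: "C \<in> R"
      show "?act \<one>\<^bsub>?P\<^esub> C = C" using sub[OF C] by (auto simp: image_iff subset_iff)
      fix g h assume g: "g \<in> carrier ?P"
      show "?act g C \<in> R" using C g act nm R by auto
      assume h: "h \<in> carrier ?P"
      show "?act (g \<otimes>\<^bsub>?P\<^esub> h) C = ?act g (?act h C)"
        unfolding image_image using g h cP sub[OF C]
        by (intro image_cong refl) (auto simp: inv_mult_group m_assoc)
    qed (use finR dR in auto)
    moreover have LF: "Q1 \<in> ?F"
    proof -
      have e: "Q1 #> \<one> = Q1" using subgroup.subset[OF s1] by simp
      have o: "\<one> \<in> Q" using Q subgroup.one_closed by blast
      have "?act x Q1 = Q1" if "x \<in> P" for x using act[OF that o] that cP e by simp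
      moreover have "Q1 \<in> R" using R e o by (metis imageI)
      ultimately show ?thesis by simp
    qed
    ultimately have "?F \<noteq> {Q1}" using prime_gt_1_nat[OF prime_p]
      by (metis card_1_singleton_iff nat_dvd_1_iff_1 One_nat_def less_irrefl)
    then obtain C where C: "C \<in> R" "\<forall>x\<in>P. ?act x C = C" "C \<noteq> Q1" using LF by auto
    then obtain q where q: "q \<in> Q" "C = Q1 #> q" using R by blast
    have "x \<otimes> q \<otimes> inv x \<otimes> inv q \<in> Q1" if x: "x \<in> P" for x
    proof -
      have xc: "x \<otimes> q \<otimes> inv x \<in> carrier G" using x q cP cQ by simp
      have "Q1 #> (x \<otimes> q \<otimes> inv x) = Q1 #> q" using C(2) act[OF x q(1)] x q by simp
      hence "x \<otimes> q \<otimes> inv x \<in> Q1 #> q" using rcos_self[OF xc s1] by simp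
      thus ?thesis using subgroup.rcos_module_imp[OF s1 is_group] q cQ by blast
    qed
    moreover have "q \<notin> Q1" using C(3) q coset_join2[OF _ s1] cQ by auto
    ultimately show ?thesis using q F_def by blast
  qed
  moreover have "Q1 \<subseteq> F"
  proof
    fix q assume q: "q \<in> Q1"
    thus "q \<in> F" unfolding F_def
      using n1 lt subgroup.m_closed[OF s1] subgroup.m_inv_closed[OF s1] by auto
  qed
  moreover have "F \<subseteq> Q" by (auto simp: F_def)
  moreover have "subgroup F G"
  proof (rule finite_submonoid_subgroup)
    show "F \<subseteq> carrier G" using cQ by (auto simp: F_def)
    show "\<one> \<in> F" using \<open>Q1 \<subseteq> F\<close> subgroup.one_closed[OF s1] by blast
    fix a b assume a: "a \<in> F" and b: "b \<in> F"
    have "x \<otimes> (a \<otimes> b) \<otimes> inv x \<otimes> inv (a \<otimes> b) \<in> Q1" if x: "x \<in> P" for x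
    proof -
      have "x \<otimes> (a \<otimes> b) \<otimes> inv x \<otimes> inv (a \<otimes> b) =
        (x \<otimes> a \<otimes> inv x \<otimes> inv a) \<otimes> (a \<otimes> (x \<otimes> b \<otimes> inv x \<otimes> inv b) \<otimes> inv a)"
        using a b x cP cQ by (simp add: F_def m_assoc inv_mult_group)
      thus ?thesis using a b x n1 Q(2) subgroup.m_closed[OF s1] by (auto simp: F_def)
    qed
    thus "a \<otimes> b \<in> F" using a b subgroup.m_closed[OF Q(1)] by (auto simp: F_def)
  qed
  moreover have "y \<otimes> q \<otimes> inv y \<in> F" if y: "y \<in> P" and q: "q \<in> F" for y q
  proof -
    have "x \<otimes> (y \<otimes> q \<otimes> inv y) \<otimes> inv x \<otimes> inv (y \<otimes> q \<otimes> inv y) \<in> Q1" if x: "x \<in> P" for x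
    proof -
      have "x \<otimes> (y \<otimes> q \<otimes> inv y) \<otimes> inv x \<otimes> inv (y \<otimes> q \<otimes> inv y) =
        ((x \<otimes> y) \<otimes> q \<otimes> inv (x \<otimes> y) \<otimes> inv q) \<otimes> inv (y \<otimes> q \<otimes> inv y \<otimes> inv q)"
        using q x y cP cQ by (simp add: F_def m_assoc inv_mult_group)
      moreover have "x \<otimes> y \<in> P" using x y subgroup.m_closed[OF sP] by blast
      ultimately show ?thesis
        using q y subgroup.m_closed[OF s1] subgroup.m_inv_closed[OF s1] by (auto simp: F_def)
    qed
    thus ?thesis using nm q y by (auto simp: F_def)
  qed
  ultimately have "F = Q" using Q1(2)[of F] by blast
  thus ?thesis using that[OF s1 lt] by (auto simp: F_def)
qed

text \<open>Representatives come from a prescribed set \<open>S\<close>, which Tate's theorem takes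
  to be a normal subgroup. \<open>\<tau>\<close> is constant on left cosets of \<open>P\<close>
  because the predicates under \<open>SOME\<close> agree on them.\<close>

lemma exists_transversal:
  assumes P: "subgroup P G" and S: "S \<subseteq> carrier G" "\<And>g. g \<in> carrier G \<Longrightarrow> \<exists>s\<in>S. inv s \<otimes> g \<in> P"
  shows "\<exists>\<tau>. \<forall>g\<in>carrier G. \<tau> g \<in> S \<and> inv (\<tau> g) \<otimes> g \<in> P \<and> (\<forall>x\<in>P. \<tau> (g \<otimes> x) = \<tau> g)"
proof -
  define \<tau> where "\<tau> g = (SOME s. s \<in> S \<and> inv s \<otimes> g \<in> P)" for g
  have t: "\<tau> g \<in> S \<and> inv (\<tau> g) \<otimes> g \<in> P" if "g \<in> carrier G" for g
    unfolding \<tau>_def by (rule someI_ex) (use S(2)[OF that] in blast)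
  have "\<tau> (g \<otimes> x) = \<tau> g" if g: "g \<in> carrier G" and x: "x \<in> P" for g x
  proof -
    have "inv s \<otimes> (g \<otimes> x) \<in> P \<longleftrightarrow> inv s \<otimes> g \<in> P" if "s \<in> S" for s
    proof
      have c: "s \<in> carrier G" "x \<in> carrier G" using that S subgroup_carrier[OF P x] by auto
      show "inv s \<otimes> g \<in> P" if h: "inv s \<otimes> (g \<otimes> x) \<in> P"
      proof -
        have "inv s \<otimes> g = inv s \<otimes> (g \<otimes> x) \<otimes> inv x" using c g by (simp add: m_assoc)
        thus ?thesis using subgroup.m_closed[OF P h subgroup.m_inv_closed[OF P x]] by simp
      qed
      show "inv s \<otimes> (g \<otimes> x) \<in> P" if h: "inv s \<otimes> g \<in> P"
        using subgroup.m_closed[OF P h x] c g by (simp add: m_assoc)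
    qed
    thus ?thesis unfolding \<tau>_def by metis
  qed
  thus ?thesis using t by (intro exI[of _ \<tau>]) simp
qed

end

locale transversal = prime_group G p for G (structure) and p +
  fixes P :: "'a set" and \<tau> :: "'a \<Rightarrow> 'a"
  assumes subP: "subgroup P G"
    and tau_closed: "\<And>g. g \<in> carrier G \<Longrightarrow> \<tau> g \<in> carrier G"
    and tau_coset: "\<And>g. g \<in> carrier G \<Longrightarrow> inv (\<tau> g) \<otimes> g \<in> P"
    and tau_mult: "\<And>g x. g \<in> carrier G \<Longrightarrow> x \<in> P \<Longrightarrow> \<tau> (g \<otimes> x) = \<tau> g"
begin

definition T where "T = \<tau> ` carrier G"

text \<open>The \<open>P\<close>-component of \<open>g \<otimes> t\<close> in the decomposition of
  \<open>G\<close> as \<open>T\<close> times \<open>P\<close>; the transfer is a product over its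
  values.\<close>

definition \<pi> where "\<pi> g t = inv (\<tau> (g \<otimes> t)) \<otimes> g \<otimes> t"

lemmas cP = subgroup_carrier[OF subP]

lemma T_carrier: "t \<in> T \<Longrightarrow> t \<in> carrier G"
  using tau_closed by (auto simp: T_def)

lemma finite_T: "finite T"
  using fin by (simp add: T_def)

lemma tau_in_T: "g \<in> carrier G \<Longrightarrow> \<tau> g \<in> T"
  by (simp add: T_def)

lemma tau_eq:
  assumes "g \<in> carrier G" "h \<in> carrier G" "inv g \<otimes> h \<in> P"
  shows "\<tau> g = \<tau> h"
  using tau_mult[OF assms(1,3)] assms(1,2) by simp

lemma tau_idem: "t \<in> T \<Longrightarrow> \<tau> t = t"
proof -
  assume "t \<in> T"
  then obtain g where g: "g \<in> carrier G" "t = \<tau> g" by (auto simp: T_def)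
  show "\<tau> t = t" using tau_eq[OF tau_closed[OF g(1)] g(1) tau_coset[OF g(1)]] g(2) by simp
qed

lemma pi_closed: "g \<in> carrier G \<Longrightarrow> t \<in> T \<Longrightarrow> \<pi> g t \<in> P"
  using tau_coset[of "g \<otimes> t"] T_carrier tau_closed by (simp add: \<pi>_def m_assoc)

lemma pi_mult:
  assumes g: "g \<in> carrier G" and h: "h \<in> carrier G" and t: "t \<in> T"
  shows "\<pi> (g \<otimes> h) t = \<pi> g (\<tau> (h \<otimes> t)) \<otimes> \<pi> h t"
proof -
  have tc: "t \<in> carrier G" using T_carrier t .
  let ?s = "\<tau> (h \<otimes> t)"
  have sc: "?s \<in> carrier G" using tau_closed h tc by simp
  have "inv (g \<otimes> ?s) \<otimes> (g \<otimes> h \<otimes> t) \<in> P"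
    using tau_coset[of "h \<otimes> t"] g h tc sc by (simp add: inv_mult_group m_assoc)
  hence e: "\<tau> (g \<otimes> ?s) = \<tau> (g \<otimes> h \<otimes> t)" using tau_eq g h tc sc by simp
  have "\<tau> (g \<otimes> h \<otimes> t) \<in> carrier G" using tau_closed g h tc by simp
  thus ?thesis using g h tc sc unfolding \<pi>_def e by (simp add: m_assoc)
qed

lemma bij_T:
  assumes h: "h \<in> carrier G"
  shows "inj_on (\<lambda>t. \<tau> (h \<otimes> t)) T" "(\<lambda>t. \<tau> (h \<otimes> t)) ` T = T"
proof -
  show i: "inj_on (\<lambda>t. \<tau> (h \<otimes> t)) T"
  proof (rule inj_onI)
    fix s t assume st: "s \<in> T" "t \<in> T" and e: "\<tau> (h \<otimes> s) = \<tau> (h \<otimes> t)"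
    have c: "s \<in> carrier G" "t \<in> carrier G" "\<tau> (h \<otimes> t) \<in> carrier G"
      using st T_carrier tau_closed h by auto
    have "inv (inv (\<tau> (h \<otimes> s)) \<otimes> (h \<otimes> s)) \<otimes> (inv (\<tau> (h \<otimes> t)) \<otimes> (h \<otimes> t)) \<in> P"
      using tau_coset[of "h \<otimes> s"] tau_coset[of "h \<otimes> t"] h c
        subgroup.m_closed[OF subP] subgroup.m_inv_closed[OF subP] by simp
    hence "inv s \<otimes> t \<in> P" unfolding e using h c by (simp add: inv_mult_group m_assoc)
    thus "s = t" using tau_eq[OF c(1,2)] tau_idem st by simp
  qed
  show "(\<lambda>t. \<tau> (h \<otimes> t)) ` T = T"
    using i finite_T h T_carrier by (intro endo_inj_surj) (auto intro: tau_in_T)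
qed

lemma card_T: "card T * card P = order G"
proof -
  have "bij_betw (\<lambda>(t,x). t \<otimes> x) (T \<times> P) (carrier G)"
  proof (rule bij_betw_byWitness[where f' = "\<lambda>g. (\<tau> g, inv (\<tau> g) \<otimes> g)"])
    show "\<forall>a\<in>T \<times> P. (\<lambda>g. (\<tau> g, inv (\<tau> g) \<otimes> g)) (case a of (t, x) \<Rightarrow> t \<otimes> x) = a"
      using T_carrier cP by (auto simp: tau_mult tau_idem)
    show "\<forall>g\<in>carrier G. (case (\<tau> g, inv (\<tau> g) \<otimes> g) of (t, x) \<Rightarrow> t \<otimes> x) = g"
      using tau_closed by simp
    show "(\<lambda>(t,x). t \<otimes> x) ` (T \<times> P) \<subseteq> carrier G" using T_carrier cP by auto
    show "(\<lambda>g. (\<tau> g, inv (\<tau> g) \<otimes> g)) ` carrier G \<subseteq> T \<times> P" using tau_in_T tau_coset by auto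
  qed
  from bij_betw_same_card[OF this] show ?thesis by (simp add: order_def card_cartesian_product)
qed

text \<open>\<open>\<mu>\<close> is an arbitrary map, as Tate's theorem transfers one that is
  multiplicative only up to a cocycle. The permutation of \<open>T\<close> induced by
  \<open>h\<close> reindexes the first product, so that the factors pair up as in
  \<open>pi_mult\<close>.\<close>

lemma transfer_mult:
  assumes A: "comm_group A" and \<mu>: "\<mu> \<in> P \<rightarrow> carrier A" and g: "g \<in> carrier G" and h: "h \<in> carrier G"
  shows "finprod A (\<lambda>t. \<mu> (\<pi> g t)) T \<otimes>\<^bsub>A\<^esub> finprod A (\<lambda>t. \<mu> (\<pi> h t)) T =
    finprod A (\<lambda>t. \<mu> (\<pi> g (\<tau> (h \<otimes> t))) \<otimes>\<^bsub>A\<^esub> \<mu> (\<pi> h t)) T"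
proof -
  interpret A: comm_group A by (rule A)
  have m: "(\<lambda>t. \<mu> (\<pi> g t)) \<in> T \<rightarrow> carrier A" if "g \<in> carrier G" for g
    using pi_closed[OF that] \<mu> by auto
  have t: "\<tau> (h \<otimes> t) \<in> T" if "t \<in> T" for t using that T_carrier h by (simp add: tau_in_T)
  have "finprod A (\<lambda>t. \<mu> (\<pi> g t)) T = finprod A (\<lambda>t. \<mu> (\<pi> g t)) ((\<lambda>t. \<tau> (h \<otimes> t)) ` T)"
    using bij_T(2)[OF h] by simp
  also have "\<dots> = finprod A (\<lambda>t. \<mu> (\<pi> g (\<tau> (h \<otimes> t)))) T"
    using m[OF g] t by (intro A.finprod_reindex bij_T(1)[OF h]) auto
  finally show ?thesis using m[OF g] m[OF h] t by (simp add: A.finprod_multf Pi_def)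
qed

lemma transfer_hom:
  assumes A: "comm_group A" and \<mu>: "\<mu> \<in> hom (G\<lparr>carrier := P\<rparr>) A"
  shows "(\<lambda>g. finprod A (\<lambda>t. \<mu> (\<pi> g t)) T) \<in> hom G A"
proof (rule homI)
  interpret A: comm_group A by (rule A)
  have m: "\<mu> \<in> P \<rightarrow> carrier A" using \<mu> by (auto simp: hom_def)
  show "finprod A (\<lambda>t. \<mu> (\<pi> g t)) T \<in> carrier A" if "g \<in> carrier G" for g
    using pi_closed[OF that] m by (intro A.finprod_closed) auto
  fix g h assume gh: "g \<in> carrier G" "h \<in> carrier G"
  show "finprod A (\<lambda>t. \<mu> (\<pi> (g \<otimes> h) t)) T =
    finprod A (\<lambda>t. \<mu> (\<pi> g t)) T \<otimes>\<^bsub>A\<^esub> finprod A (\<lambda>t. \<mu> (\<pi> h t)) T"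
    unfolding transfer_mult[OF A m gh]
  proof (rule A.finprod_cong')
    show "(\<lambda>t. \<mu> (\<pi> g (\<tau> (h \<otimes> t))) \<otimes>\<^bsub>A\<^esub> \<mu> (\<pi> h t)) \<in> T \<rightarrow> carrier A"
      using m pi_closed gh T_carrier tau_in_T by (fastforce intro!: A.m_closed)
    fix t assume t: "t \<in> T"
    have "\<pi> g (\<tau> (h \<otimes> t)) \<in> P" "\<pi> h t \<in> P"
      using pi_closed gh t T_carrier tau_in_T by auto
    thus "\<mu> (\<pi> (g \<otimes> h) t) = \<mu> (\<pi> g (\<tau> (h \<otimes> t))) \<otimes>\<^bsub>A\<^esub> \<mu> (\<pi> h t)"
      using \<mu> pi_mult[OF gh t] by (simp add: hom_def)
  qed simp
qed

text \<open>All conjugates of \<open>z\<close> lie in \<open>P\<close>, so \<open>z\<close> fixes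
  every coset of \<open>P\<close>, and each factor of the transfer comes from a conjugate of
  \<open>z\<close>.\<close>

lemma transfer_eval:
  assumes A: "comm_group A" and \<mu>: "\<mu> \<in> hom (G\<lparr>carrier := P\<rparr>) A" and z: "z \<in> P"
    and inv: "\<And>t. t \<in> carrier G \<Longrightarrow> inv t \<otimes> z \<otimes> t \<in> P"
      "\<And>t. t \<in> carrier G \<Longrightarrow> \<mu> (inv t \<otimes> z \<otimes> t) = \<mu> z"
  shows "finprod A (\<lambda>t. \<mu> (\<pi> z t)) T = \<mu> z [^]\<^bsub>A\<^esub> card T"
proof -
  interpret A: comm_group A by (rule A)
  have mz: "\<mu> z \<in> carrier A" using \<mu> z by (auto simp: hom_def)
  have "finprod A (\<lambda>t. \<mu> (\<pi> z t)) T = finprod A (\<lambda>t. \<mu> z) T"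
  proof (rule A.finprod_cong')
    fix t assume t: "t \<in> T"
    note tc = T_carrier[OF t]
    have "\<tau> (z \<otimes> t) = \<tau> t"
      using tau_eq[of t "z \<otimes> t"] inv(1)[OF tc] tc cP[OF z] by (simp add: m_assoc)
    hence "\<pi> z t = inv t \<otimes> z \<otimes> t" using tau_idem[OF t] by (simp add: \<pi>_def)
    thus "\<mu> (\<pi> z t) = \<mu> z" using inv(2)[OF tc] by simp
  qed (use mz in auto)
  thus ?thesis using A.finprod_const[OF mz] by simp
qed

end

context prime_group
begin

subsection \<open>Tate's theorem on normal p-complements\<close>

text \<open>The index of \<open>R <#> P\<close> divides both the index of \<open>R\<close>, a power
  of \<open>p\<close>, and the index of \<open>P\<close>, which is prime to
  \<open>p\<close>.\<close>

lemma p_power_index_complement: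
  assumes P: "subgroup P G" "card P = p ^ n" "order G = p ^ n * m" "coprime m p"
    and R: "R \<lhd> G" "order G = p ^ j * card R"
  shows "carrier G = R <#> P"
proof -
  interpret S: second_isomorphism_grp R G P
    using R P by (simp add: second_isomorphism_grp_def second_isomorphism_grp_axioms_def)
  note sJ = S.normal_set_mult_subgroup
  note sR = normal_imp_subgroup[OF R(1)]
  have "card (R <#> P) dvd order G"
    using subgroup_card_dvd[OF sJ subgroup_self subgroup.subset[OF sJ]] by (simp add: order_def)
  then obtain q where q: "order G = card (R <#> P) * q" by auto
  have "card R dvd card (R <#> P)" "card P dvd card (R <#> P)"
    using subgroup_card_dvd[OF sR sJ S.H_contained_in_set_mult]
      subgroup_card_dvd[OF P(1) sJ S.S_contained_in_set_mult] .
  then obtain a b where ab: "card (R <#> P) = card R * a" "card (R <#> P) = p ^ n * b"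
    using P(2) unfolding dvd_def by metis
  have pos: "card R > 0" "p ^ n > 0" using subgroup_card_pos[OF sR] prime_p by (auto simp: prime_gt_0_nat)
  have "card R * (a * q) = card R * p ^ j" using q ab(1) R(2) by (metis mult.assoc mult.commute)
  hence "q dvd p ^ j" using pos by (metis dvd_triv_right mult_cancel1 not_gr0)
  moreover have "p ^ n * (b * q) = p ^ n * m" using q ab(2) P(3) by (metis mult.assoc)
  hence "q dvd m" using pos by (metis dvd_triv_right mult_cancel1 not_gr0)
  moreover have "coprime m (p ^ j)" using P(4) by simp
  ultimately have "q = 1" by (meson coprime_common_divisor_nat nat_dvd_1_iff_1)
  hence "card (R <#> P) = card (carrier G)" using q by (simp add: order_def)
  thus ?thesis using card_seteq[OF fin subgroup.subset[OF sJ]] by simp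
qed

text \<open>
  After replacing \<open>N\<close> by a minimal normal subgroup \<open>R\<close> of \<open>p\<close>-power index below it, suppose that
  \<open>Q = P \<inter> R\<close> is not trivial and let \<open>lam\<close> be the projection of \<open>Q\<close> onto a central chief factor
  \<open>A = Q/Q1\<close> of \<open>P\<close>. Extend \<open>lam\<close> to a map \<open>mu\<close> on \<open>P\<close> with \<open>mu (q x) = lam q * mu x\<close>; it is
  multiplicative up to a cocycle that only depends on cosets of \<open>Q\<close>. If the transversal of \<open>P\<close> is
  taken inside \<open>R\<close>, the transfer \<open>f\<close> of \<open>mu\<close> has the \<open>M\<close>-th power of the same cocycle, with
  \<open>M\<close> the index of \<open>P\<close>. By minimality of \<open>R\<close>, \<open>f\<close> is trivial on \<open>R\<close>, so \<open>mu\<^sup>M / f\<close> is a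
  homomorphism \<open>P \<rightarrow> A\<close> that is \<open>lam\<^sup>M\<close> on \<open>Q\<close>. Hence \<open>Q\<close> does not lie in the Frattini
  subgroup of \<open>P\<close>, a contradiction.
\<close>

theorem tate_normal_complement:
  assumes P: "subgroup P G" "card P = p ^ n" "order G = p ^ n * m" "coprime m p"
    and N: "N \<lhd> G" and PN: "carrier G = P <#> N" and int: "P \<inter> N \<subseteq> Phi P"
  obtains R where "R \<lhd> G" "R \<subseteq> N" "coprime (card R) p" "carrier G = R <#> P"
proof -
  note cP = subgroup_carrier[OF P(1)]
  have pP: "p_subgroup P" using P p_subgroup_def by blast
  have p0: "p > 0" using prime_p prime_gt_0_nat by blast
  let ?A = "{R. R \<lhd> G \<and> R \<subseteq> N \<and> (\<exists>j. order G = p ^ j * card R)}"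
  have "N \<in> ?A"
  proof -
    note sN = normal_imp_subgroup[OF N]
    have e: "order G * card (P \<inter> N) = p ^ n * card N"
      using card_set_mult[OF P(1) sN] P(2) PN by (simp add: order_def)
    have I: "subgroup (P \<inter> N) G" using P(1) sN subgroups_Inter_pair by blast
    then obtain i where i: "card (P \<inter> N) = p ^ i" "i \<le> n"
      using subgroup_card_dvd[OF I P(1)] P(2) prime_p divides_primepow_nat[of p "card (P \<inter> N)" n] by auto
    have "p ^ n = p ^ (n - i) * p ^ i" using i(2) by (simp add: power_add[symmetric])
    hence "order G * p ^ i = p ^ (n - i) * card N * p ^ i" using e unfolding i(1) by (metis mult.assoc mult.commute)
    hence "order G = p ^ (n - i) * card N" using p0 by (metis mult_cancel2 power_not_zero not_gr0)
    thus ?thesis using N by blast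
  qed
  then obtain R where R: "R \<in> ?A" "\<And>K. K \<in> ?A \<Longrightarrow> card R \<le> card K"
    using ex_has_least_nat[of "\<lambda>R. R \<in> ?A" N card] by blast
  then obtain j where Rn: "R \<lhd> G" "R \<subseteq> N" "order G = p ^ j * card R" by blast
  note sR = normal_imp_subgroup[OF Rn(1)]
  note cR = subgroup_carrier[OF sR]
  have RP: "carrier G = R <#> P" by (rule p_power_index_complement[OF P Rn(1,3)])
  have nR: "x \<otimes> r \<otimes> inv x \<in> R" if "x \<in> carrier G" "r \<in> R" for x r
    using normal.inv_op_closed2[OF Rn(1)] that by blast
  have nR': "inv x \<otimes> r \<otimes> x \<in> R" if "x \<in> carrier G" "r \<in> R" for x r
    using normal.inv_op_closed1[OF Rn(1)] that by blast
  define Q where "Q = P \<inter> R"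
  have sQ: "subgroup Q G" "Q \<subseteq> P" "Q \<subseteq> R"
    using P(1) sR subgroups_Inter_pair by (auto simp: Q_def)
  have nQ: "x \<otimes> q \<otimes> inv x \<in> Q" if "x \<in> P" "q \<in> Q" for x q
    using that nR cP subgroup.m_closed[OF P(1)] subgroup.m_inv_closed[OF P(1)] by (auto simp: Q_def)
  note cQ = subgroup_carrier[OF sQ(1)]
  have "Q = {\<one>}"
  proof (rule ccontr)
    assume ne: "Q \<noteq> {\<one>}"
    have "\<exists>Q1. subgroup Q1 G \<and> Q1 \<subset> Q \<and> (\<forall>x\<in>P. \<forall>q\<in>Q. x \<otimes> q \<otimes> inv x \<otimes> inv q \<in> Q1)"
      by (rule chief_step[OF pP sQ(1,2) ne]) (use nQ in blast)+
    then obtain Q1 where Q1: "subgroup Q1 G" "Q1 \<subset> Q"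
      "\<And>x q. x \<in> P \<Longrightarrow> q \<in> Q \<Longrightarrow> x \<otimes> q \<otimes> inv x \<otimes> inv q \<in> Q1" by auto
    note c1 = subgroup_carrier[OF Q1(1)]
    have inQ1: "x \<otimes> q \<otimes> inv x \<in> Q1" if "x \<in> P" "q \<in> Q1" for x q
    proof -
      have "x \<otimes> q \<otimes> inv x = (x \<otimes> q \<otimes> inv x \<otimes> inv q) \<otimes> q" using that cP c1 by (simp add: m_assoc)
      moreover have "x \<otimes> q \<otimes> inv x \<otimes> inv q \<in> Q1" using Q1(2,3) that by blast
      ultimately show ?thesis using subgroup.m_closed[OF Q1(1) _ that(2)] by metis
    qed
    let ?Q = "G\<lparr>carrier := Q\<rparr>"
    interpret gQ: group ?Q using subgroup_imp_group[OF sQ(1)] .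
    have n1: "Q1 \<lhd> ?Q"
    proof (rule gQ.normal_invI)
      show "subgroup Q1 ?Q" using subgroup_incl[OF Q1(1) sQ(1)] Q1(2) by blast
      fix x h assume "x \<in> carrier ?Q" "h \<in> Q1"
      thus "x \<otimes>\<^bsub>?Q\<^esub> h \<otimes>\<^bsub>?Q\<^esub> inv\<^bsub>?Q\<^esub> x \<in> Q1"
        using inQ1 sQ by (auto simp: m_inv_consistent)
    qed
    define A where "A = ?Q Mod Q1"
    define lam where "lam q = Q1 #> q" for q
    have gA: "group A" unfolding A_def by (rule normal.factorgroup_is_group[OF n1])
    have carA: "carrier A = lam ` Q" by (auto simp: A_def lam_def carrier_FactGroup)
    have lam_mult: "lam (a \<otimes> b) = lam a \<otimes>\<^bsub>A\<^esub> lam b" if "a \<in> Q" "b \<in> Q" for a b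
      using normal.rcos_sum[OF n1, of a b] that by (simp add: A_def lam_def)
    have lam_eq: "lam a = lam b" if "a \<otimes> inv b \<in> Q1" "a \<in> Q" "b \<in> Q" for a b
      unfolding lam_def
      by (rule repr_independence[OF subgroup.rcos_module_rev[OF Q1(1) is_group] _ Q1(1), symmetric])
        (use that cQ in auto)
    have lam_conj: "lam (x \<otimes> q \<otimes> inv x) = lam q" if "x \<in> P" "q \<in> Q" for x q
      using lam_eq[OF Q1(3)] that nQ by blast
    have lam_one: "lam \<one> = \<one>\<^bsub>A\<^esub>" using subgroup.subset[OF Q1(1)] by (simp add: A_def lam_def)
    have lam_one_iff: "q \<in> Q1" if "lam q = \<one>\<^bsub>A\<^esub>" "q \<in> Q" for q
      using coset_join1[OF _ cQ Q1(1)] that by (simp add: A_def lam_def)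
    have A: "comm_group A"
    proof (rule group.group_comm_groupI[OF gA])
      fix a b assume "a \<in> carrier A" "b \<in> carrier A"
      then obtain u v where uv: "u \<in> Q" "v \<in> Q" "a = lam u" "b = lam v" using carA by auto
      have "lam u \<otimes>\<^bsub>A\<^esub> lam v = lam ((u \<otimes> v \<otimes> inv u) \<otimes> u)"
        using uv cQ lam_mult by (simp add: m_assoc)
      also have "\<dots> = lam v \<otimes>\<^bsub>A\<^esub> lam u" using uv lam_mult lam_conj nQ sQ by auto
      finally show "a \<otimes>\<^bsub>A\<^esub> b = b \<otimes>\<^bsub>A\<^esub> a" using uv by simp
    qed
    interpret A: comm_group A by (rule A)
    have lamA: "lam q \<in> carrier A" if "q \<in> Q" for q using carA that by blast
    have lam_pow: "lam (q [^] (i::nat)) = lam q [^]\<^bsub>A\<^esub> i" if "q \<in> Q" for q i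
      by (induction i) (use that lam_mult subgroup_pow[OF sQ(1)] lam_one in auto)

    \<comment> \<open>A representative of the coset of \<open>x\<close> modulo \<open>Q\<close>. The
      coset \<open>Q\<close> itself gets \<open>\<one>\<close>, so that \<open>mu\<close> restricts
      to \<open>lam\<close> on \<open>Q\<close>.\<close>
    define r where "r x = (if x \<in> Q then \<one> else SOME y. y \<in> P \<and> x \<otimes> inv y \<in> Q)" for x
    have r: "r x \<in> P \<and> x \<otimes> inv (r x) \<in> Q" if x: "x \<in> P" for x
    proof (cases "x \<in> Q")
      case True thus ?thesis using subgroup.one_closed[OF P(1)] cP[OF x] by (simp add: r_def)
    next
      case False
      have "x \<in> P \<and> x \<otimes> inv x \<in> Q" using x cP subgroup.one_closed[OF sQ(1)] by simp
      thus ?thesis unfolding r_def using False someI_ex[of "\<lambda>y. y \<in> P \<and> x \<otimes> inv y \<in> Q"] by auto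
    qed
    have r_mult: "r (q \<otimes> x) = r x" if q: "q \<in> Q" and x: "x \<in> P" for q x
    proof -
      have *: "q \<otimes> z \<in> Q \<longleftrightarrow> z \<in> Q" if z: "z \<in> carrier G" for z
      proof
        assume "q \<otimes> z \<in> Q"
        hence "inv q \<otimes> (q \<otimes> z) \<in> Q" using q subgroup.m_closed[OF sQ(1)] subgroup.m_inv_closed[OF sQ(1)] by blast
        thus "z \<in> Q" using q z cQ by simp
      qed (use q subgroup.m_closed[OF sQ(1)] in blast)
      have "q \<otimes> x \<otimes> inv y \<in> Q \<longleftrightarrow> x \<otimes> inv y \<in> Q" if "y \<in> P" for y
        using *[of "x \<otimes> inv y"] that x q cP cQ by (simp add: m_assoc)
      hence "(\<lambda>y. y \<in> P \<and> q \<otimes> x \<otimes> inv y \<in> Q) = (\<lambda>y. y \<in> P \<and> x \<otimes> inv y \<in> Q)" by blast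
      thus ?thesis using *[of x] cP[OF x] by (simp add: r_def)
    qed
    define mu where "mu x = lam (x \<otimes> inv (r x))" for x
    have muA: "mu x \<in> carrier A" if "x \<in> P" for x using lamA r that by (simp add: mu_def)
    have muP: "mu \<in> P \<rightarrow> carrier A" using muA by blast
    have mu_mult: "mu (q \<otimes> x) = lam q \<otimes>\<^bsub>A\<^esub> mu x" if q: "q \<in> Q" and x: "x \<in> P" for q x
      using lam_mult[OF q, of "x \<otimes> inv (r x)"] r[OF x] cP cQ[OF q] x
      by (simp add: mu_def r_mult[OF q x] m_assoc)
    have mu_Q: "mu q = lam q" if "q \<in> Q" for q using that cQ by (simp add: mu_def r_def)
    have mu_one: "mu \<one> = \<one>\<^bsub>A\<^esub>" using mu_Q lam_one subgroup.one_closed[OF sQ(1)] by simp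
    \<comment> \<open>The quotient of \<open>mu (x \<otimes> y)\<close> by the product of
      \<open>mu x\<close> and \<open>mu y\<close> depends only on the cosets modulo
      \<open>Q\<close>; multiplying crosswise avoids inverses.\<close>
    have mu_cocycle: "mu (x' \<otimes> y') \<otimes>\<^bsub>A\<^esub> (mu x \<otimes>\<^bsub>A\<^esub> mu y) = mu x' \<otimes>\<^bsub>A\<^esub> mu y' \<otimes>\<^bsub>A\<^esub> mu (x \<otimes> y)"
      if x: "x \<in> P" "y \<in> P" "x' \<in> P" "y' \<in> P" "x' \<otimes> inv x \<in> Q" "y' \<otimes> inv y \<in> Q" for x y x' y'
    proof -
      define a b where "a = x' \<otimes> inv x" and "b = y' \<otimes> inv y"
      have ab: "a \<in> Q" "b \<in> Q" using x by (auto simp: a_def b_def)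
      have xy: "x' = a \<otimes> x" "y' = b \<otimes> y" using x cP by (simp_all add: a_def b_def m_assoc)
      have c: "x \<otimes> b \<otimes> inv x \<in> Q" using nQ x ab by blast
      have m: "x \<otimes> y \<in> P" using x subgroup.m_closed[OF P(1)] by blast
      have "x' \<otimes> y' = (a \<otimes> (x \<otimes> b \<otimes> inv x)) \<otimes> (x \<otimes> y)"
        unfolding xy using x ab cP cQ by (simp add: m_assoc)
      hence "mu (x' \<otimes> y') = lam a \<otimes>\<^bsub>A\<^esub> lam b \<otimes>\<^bsub>A\<^esub> mu (x \<otimes> y)"
        using mu_mult[OF subgroup.m_closed[OF sQ(1) ab(1) c] m] lam_mult[OF ab(1) c] lam_conj[OF x(1) ab(2)]
        by simp
      moreover have "mu x' = lam a \<otimes>\<^bsub>A\<^esub> mu x" "mu y' = lam b \<otimes>\<^bsub>A\<^esub> mu y"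
        unfolding xy using mu_mult ab x by blast+
      ultimately show ?thesis using lamA ab muA x m by (simp add: A.m_ac)
    qed

    have cov: "\<exists>s\<in>R. inv s \<otimes> g \<in> P" if g: "g \<in> carrier G" for g
    proof -
      obtain s x where "s \<in> R" "x \<in> P" "g = s \<otimes> x" using g RP by (auto simp: set_mult_def)
      thus ?thesis using cR cP by (intro bexI[of _ s]) auto
    qed
    obtain \<tau> where "\<forall>g\<in>carrier G. \<tau> g \<in> R \<and> inv (\<tau> g) \<otimes> g \<in> P \<and> (\<forall>x\<in>P. \<tau> (g \<otimes> x) = \<tau> g)"
      using exists_transversal[OF P(1) subgroup.subset[OF sR] cov] by blast
    hence \<tau>: "\<And>g. g \<in> carrier G \<Longrightarrow> \<tau> g \<in> R" "\<And>g. g \<in> carrier G \<Longrightarrow> inv (\<tau> g) \<otimes> g \<in> P"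
      "\<And>g x. g \<in> carrier G \<Longrightarrow> x \<in> P \<Longrightarrow> \<tau> (g \<otimes> x) = \<tau> g" by auto
    interpret T: transversal G p P \<tau>
      by (intro transversal.intro transversal_axioms.intro prime_group_axioms) (use P(1) \<tau> cR in auto)
    define M where "M = card T.T"
    have M: "coprime M p"
    proof -
      have "M * p ^ n = m * p ^ n" using T.card_T P(2,3) by (simp add: M_def ac_simps)
      thus ?thesis using P(4) p0 by simp
    qed
    define f where "f g = finprod A (\<lambda>t. mu (T.\<pi> g t)) T.T" for g
    have fA: "f g \<in> carrier A" if "g \<in> carrier G" for g
      unfolding f_def using muA T.pi_closed[OF that] by (intro A.finprod_closed) auto
    \<comment> \<open>Because the transversal lies in \<open>R\<close>, every
      \<open>T.\<pi> g t\<close> is congruent to \<open>g\<close> modulo \<open>R\<close>. All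
      \<open>M\<close> factors of the transfer therefore see the same cocycle value.\<close>
    have pi_Q: "T.\<pi> g t \<otimes> inv x \<in> Q"
      if g: "g \<in> carrier G" and x: "x \<in> P" "g \<otimes> inv x \<in> R" and t: "t \<in> T.T" for g x t
    proof -
      have tR: "t \<in> R" using t \<tau> by (auto simp: T.T_def)
      have sR': "\<tau> (g \<otimes> t) \<in> R" using \<tau>(1) g cR[OF tR] by simp
      have "T.\<pi> g t \<otimes> inv x = inv (\<tau> (g \<otimes> t)) \<otimes> (g \<otimes> t \<otimes> inv g) \<otimes> (g \<otimes> inv x)"
        using g cR[OF tR] cR[OF sR'] cP[OF x(1)] by (simp add: T.\<pi>_def m_assoc)
      also have "\<dots> \<in> R"
        using subgroup.m_closed[OF sR subgroup.m_closed[OF sR subgroup.m_inv_closed[OF sR sR'] nR[OF g tR]] x(2)] .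
      finally show ?thesis
        using T.pi_closed[OF g t] x(1) subgroup.m_closed[OF P(1)] subgroup.m_inv_closed[OF P(1)]
        by (auto simp: Q_def)
    qed
    have f_mult: "f (g \<otimes> h) \<otimes>\<^bsub>A\<^esub> (mu x \<otimes>\<^bsub>A\<^esub> mu y) [^]\<^bsub>A\<^esub> M = f g \<otimes>\<^bsub>A\<^esub> f h \<otimes>\<^bsub>A\<^esub> mu (x \<otimes> y) [^]\<^bsub>A\<^esub> M"
      if g: "g \<in> carrier G" "h \<in> carrier G" and x: "x \<in> P" "y \<in> P" "g \<otimes> inv x \<in> R" "h \<otimes> inv y \<in> R"
      for g h x y
    proof -
      have xy: "mu x \<otimes>\<^bsub>A\<^esub> mu y \<in> carrier A" "mu (x \<otimes> y) \<in> carrier A"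
        using x muA subgroup.m_closed[OF P(1)] by auto
      have gh: "g \<otimes> h \<in> carrier G" using g by simp
      have tT: "\<tau> (h \<otimes> t) \<in> T.T" if "t \<in> T.T" for t using that T.T_carrier g T.tau_in_T by simp
      have m1: "(\<lambda>t. mu (T.\<pi> (g \<otimes> h) t)) \<in> T.T \<rightarrow> carrier A" using muA T.pi_closed[OF gh] by blast
      have m2: "(\<lambda>t. mu (T.\<pi> g (\<tau> (h \<otimes> t))) \<otimes>\<^bsub>A\<^esub> mu (T.\<pi> h t)) \<in> T.T \<rightarrow> carrier A"
        using muA T.pi_closed tT g by auto
      have "f (g \<otimes> h) \<otimes>\<^bsub>A\<^esub> (mu x \<otimes>\<^bsub>A\<^esub> mu y) [^]\<^bsub>A\<^esub> M =
        finprod A (\<lambda>t. mu (T.\<pi> (g \<otimes> h) t)) T.T \<otimes>\<^bsub>A\<^esub> finprod A (\<lambda>t. mu x \<otimes>\<^bsub>A\<^esub> mu y) T.T"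
        by (simp only: f_def M_def A.finprod_const[OF xy(1)])
      also have "\<dots> = finprod A (\<lambda>t. mu (T.\<pi> (g \<otimes> h) t) \<otimes>\<^bsub>A\<^esub> (mu x \<otimes>\<^bsub>A\<^esub> mu y)) T.T"
        using xy by (intro A.finprod_multf[symmetric] m1) auto
      also have "\<dots> = finprod A (\<lambda>t. mu (T.\<pi> g (\<tau> (h \<otimes> t))) \<otimes>\<^bsub>A\<^esub> mu (T.\<pi> h t) \<otimes>\<^bsub>A\<^esub> mu (x \<otimes> y)) T.T"
      proof (rule A.finprod_cong'[OF refl])
        show "(\<lambda>t. mu (T.\<pi> g (\<tau> (h \<otimes> t))) \<otimes>\<^bsub>A\<^esub> mu (T.\<pi> h t) \<otimes>\<^bsub>A\<^esub> mu (x \<otimes> y)) \<in> T.T \<rightarrow> carrier A"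
          using m2 xy(2) by auto
        fix t assume t: "t \<in> T.T"
        show "mu (T.\<pi> (g \<otimes> h) t) \<otimes>\<^bsub>A\<^esub> (mu x \<otimes>\<^bsub>A\<^esub> mu y) =
          mu (T.\<pi> g (\<tau> (h \<otimes> t))) \<otimes>\<^bsub>A\<^esub> mu (T.\<pi> h t) \<otimes>\<^bsub>A\<^esub> mu (x \<otimes> y)"
          unfolding T.pi_mult[OF g t]
          by (rule mu_cocycle[OF x(1,2) T.pi_closed[OF g(1) tT[OF t]] T.pi_closed[OF g(2) t]
              pi_Q[OF g(1) x(1,3) tT[OF t]] pi_Q[OF g(2) x(2,4) t]])
      qed
      also have "\<dots> = finprod A (\<lambda>t. mu (T.\<pi> g (\<tau> (h \<otimes> t))) \<otimes>\<^bsub>A\<^esub> mu (T.\<pi> h t)) T.T \<otimes>\<^bsub>A\<^esub>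
          finprod A (\<lambda>t. mu (x \<otimes> y)) T.T"
        using xy by (intro A.finprod_multf m2) auto
      also have "\<dots> = f g \<otimes>\<^bsub>A\<^esub> f h \<otimes>\<^bsub>A\<^esub> mu (x \<otimes> y) [^]\<^bsub>A\<^esub> M"
        by (simp only: f_def M_def T.transfer_mult[OF A muP g] A.finprod_const[OF xy(2)])
      finally show ?thesis .
    qed
    have oneP: "\<one> \<in> P" using subgroup.one_closed[OF P(1)] .
    have ex_x: "\<exists>x\<in>P. g \<otimes> inv x \<in> R" if gc: "g \<in> carrier G" for g
    proof -
      obtain s x where "s \<in> R" "x \<in> P" "g = s \<otimes> x" using gc RP by (auto simp: set_mult_def)
      thus ?thesis using cR cP by (intro bexI[of _ x]) (auto simp: m_assoc)
    qed
    \<comment> \<open>The cocycle is trivial when one argument is represented by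
      \<open>\<one>\<close>. The other factor may be any element of \<open>G\<close>, which makes
      the kernel \<open>K\<close> normal in \<open>G\<close> and not just in
      \<open>R\<close>.\<close>
    have f_R: "f (g \<otimes> s) = f g \<otimes>\<^bsub>A\<^esub> f s" "f (s \<otimes> g) = f s \<otimes>\<^bsub>A\<^esub> f g" if g: "g \<in> carrier G" and s: "s \<in> R" for g s
    proof -
      obtain x where x: "x \<in> P" "g \<otimes> inv x \<in> R" using ex_x[OF g] by blast
      have s1: "s \<otimes> inv \<one> \<in> R" using s cR by simp
      have mx: "mu x [^]\<^bsub>A\<^esub> M \<in> carrier A" using muA x by simp
      have "f (g \<otimes> s) \<otimes>\<^bsub>A\<^esub> mu x [^]\<^bsub>A\<^esub> M = f g \<otimes>\<^bsub>A\<^esub> f s \<otimes>\<^bsub>A\<^esub> mu x [^]\<^bsub>A\<^esub> M"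
        using f_mult[OF g cR[OF s] x(1) oneP x(2) s1] mu_one muA[OF x(1)] cP[OF x(1)] by simp
      thus "f (g \<otimes> s) = f g \<otimes>\<^bsub>A\<^esub> f s" using A.right_cancel[OF mx] fA g cR[OF s] by simp
      have "f (s \<otimes> g) \<otimes>\<^bsub>A\<^esub> mu x [^]\<^bsub>A\<^esub> M = f s \<otimes>\<^bsub>A\<^esub> f g \<otimes>\<^bsub>A\<^esub> mu x [^]\<^bsub>A\<^esub> M"
        using f_mult[OF cR[OF s] g oneP x(1) s1 x(2)] mu_one muA[OF x(1)] cP[OF x(1)] by simp
      thus "f (s \<otimes> g) = f s \<otimes>\<^bsub>A\<^esub> f g" using A.right_cancel[OF mx] fA g cR[OF s] by simp
    qed
    have fhom: "f \<in> hom (G\<lparr>carrier := R\<rparr>) A" using f_R fA cR by (auto simp: hom_def)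
    interpret R: prime_group "G\<lparr>carrier := R\<rparr>" p by (rule restrict_group[OF sR])
    define K where "K = kernel (G\<lparr>carrier := R\<rparr>) A f"
    have K: "K = {s \<in> R. f s = \<one>\<^bsub>A\<^esub>}" by (auto simp: K_def kernel_def)
    \<comment> \<open>The index of \<open>K\<close> in \<open>R\<close> is the order of a subgroup
      of \<open>A\<close>, hence a power of \<open>p\<close>; minimality of \<open>R\<close> then
      forces \<open>K = R\<close>.\<close>
    have "K \<in> ?A"
    proof -
      have cc: "card (f ` R) * card K = card R"
        using R.hom_kernel_card(1)[OF gA fhom] by (simp add: K_def order_def)
      have "card (rcosets\<^bsub>A\<^esub> (f ` R)) * card (f ` R) = order A"
        using A.lagrange[OF R.hom_kernel_card(2)[OF gA fhom]] by simp
      hence "card (f ` R) dvd order A" by (metis dvd_triv_right)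
      moreover have "order A * card Q1 = card Q"
        using gQ.lagrange[OF normal_imp_subgroup[OF n1]] by (simp add: A_def FactGroup_def order_def)
      hence "order A dvd card Q" by (metis dvd_triv_left)
      moreover have "card Q dvd p ^ n" using subgroup_card_dvd[OF sQ(1) P(1) sQ(2)] P(2) by simp
      ultimately have "card (f ` R) dvd p ^ n" by (meson dvd_trans)
      then obtain i where "card (f ` R) = p ^ i" using prime_p divides_primepow_nat by blast
      hence "order G = p ^ (j + i) * card K" using Rn(3) cc by (simp add: power_add ac_simps)
      moreover have "K \<lhd> G"
      proof (rule normal_invI)
        have "group_hom (G\<lparr>carrier := R\<rparr>) A f"
          using fhom gA R.is_group by (simp add: group_hom_def group_hom_axioms_def)
        thus "subgroup K G" using incl_subgroup[OF sR group_hom.subgroup_kernel] K_def by blast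
        fix g s assume g: "g \<in> carrier G" and s: "s \<in> K"
        hence sR: "s \<in> R" "f s = \<one>\<^bsub>A\<^esub>" by (auto simp: K)
        let ?s = "g \<otimes> s \<otimes> inv g"
        have "f (?s \<otimes> g) = f (g \<otimes> s)" using g sR cR by (simp add: m_assoc)
        hence "f ?s \<otimes>\<^bsub>A\<^esub> f g = f g \<otimes>\<^bsub>A\<^esub> f s" using f_R nR g sR by simp
        hence "f ?s = \<one>\<^bsub>A\<^esub>" using sR(2) fA g cR[OF sR(1)] by simp
        thus "?s \<in> K" using nR g sR by (simp add: K)
      qed
      ultimately show ?thesis using Rn(2) K by blast
    qed
    hence "card R \<le> card K" by (rule R(2))
    hence "K = R" using card_seteq[OF subgroup_finite[OF sR], of K] K by blast
    hence f1: "f s = \<one>\<^bsub>A\<^esub>" if "s \<in> R" for s using that K by blast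

    define phi where "phi x = mu x [^]\<^bsub>A\<^esub> M \<otimes>\<^bsub>A\<^esub> inv\<^bsub>A\<^esub> (f x)" for x
    have phiA: "phi x \<in> carrier A" if "x \<in> P" for x using that muA fA cP by (simp add: phi_def)
    have phi_mult: "phi (x \<otimes> y) = phi x \<otimes>\<^bsub>A\<^esub> phi y" if x: "x \<in> P" "y \<in> P" for x y
    proof -
      have m: "x \<otimes> y \<in> P" using x subgroup.m_closed[OF P(1)] by blast
      have in1: "x \<otimes> inv x \<in> R" "y \<otimes> inv y \<in> R" using x cP subgroup.one_closed[OF sR] by auto
      have c: "mu x \<in> carrier A" "mu y \<in> carrier A" "mu (x \<otimes> y) \<in> carrier A"
        "f x \<in> carrier A" "f y \<in> carrier A" "f (x \<otimes> y) \<in> carrier A" using x m muA fA cP by auto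
      have e: "f (x \<otimes> y) \<otimes>\<^bsub>A\<^esub> (mu x \<otimes>\<^bsub>A\<^esub> mu y) [^]\<^bsub>A\<^esub> M = f x \<otimes>\<^bsub>A\<^esub> f y \<otimes>\<^bsub>A\<^esub> mu (x \<otimes> y) [^]\<^bsub>A\<^esub> M"
        using f_mult[OF cP[OF x(1)] cP[OF x(2)] x in1] .
      have canc: "u \<otimes>\<^bsub>A\<^esub> w \<otimes>\<^bsub>A\<^esub> inv\<^bsub>A\<^esub> u = w" if "u \<in> carrier A" "w \<in> carrier A" for u w
        using that A.m_comm[of u w] by (simp add: A.m_assoc)
      have "phi x \<otimes>\<^bsub>A\<^esub> phi y = (mu x \<otimes>\<^bsub>A\<^esub> mu y) [^]\<^bsub>A\<^esub> M \<otimes>\<^bsub>A\<^esub> inv\<^bsub>A\<^esub> (f x \<otimes>\<^bsub>A\<^esub> f y)"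
        using c by (simp add: phi_def A.nat_pow_distrib A.inv_mult A.m_ac)
      also have "\<dots> = (f (x \<otimes> y) \<otimes>\<^bsub>A\<^esub> (mu x \<otimes>\<^bsub>A\<^esub> mu y) [^]\<^bsub>A\<^esub> M) \<otimes>\<^bsub>A\<^esub> inv\<^bsub>A\<^esub> (f x \<otimes>\<^bsub>A\<^esub> f y) \<otimes>\<^bsub>A\<^esub> inv\<^bsub>A\<^esub> (f (x \<otimes> y))"
        using c by (simp add: A.m_ac)
      also have "\<dots> = mu (x \<otimes> y) [^]\<^bsub>A\<^esub> M \<otimes>\<^bsub>A\<^esub> inv\<^bsub>A\<^esub> (f (x \<otimes> y))"
        unfolding e using c canc[of "f x \<otimes>\<^bsub>A\<^esub> f y" "mu (x \<otimes> y) [^]\<^bsub>A\<^esub> M"] by simp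
      finally show ?thesis by (simp add: phi_def)
    qed
    have phi_Q: "phi q = lam q [^]\<^bsub>A\<^esub> M" if "q \<in> Q" for q
      using that f1 sQ mu_Q lamA by (auto simp: phi_def)
    have ppos: "p ^ n > 0" using p0 by simp
    \<comment> \<open>The inverse of \<open>M\<close> modulo \<open>p ^ n\<close> extracts
      \<open>M\<close>-th roots in \<open>Q\<close>, so every value of \<open>phi\<close> is
      attained on \<open>Q\<close>, and \<open>P\<close> is the product of the kernel
      \<open>L\<close> with \<open>Q\<close>.\<close>
    obtain s where s: "[M * s = 1] (mod p ^ n)"
      using cong_solve_coprime_nat[of M "p ^ n"] M by auto
    define L where "L = {x \<in> P. phi x = \<one>\<^bsub>A\<^esub>}"
    have phi_one: "phi \<one> = \<one>\<^bsub>A\<^esub>"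
      using phi_Q[OF subgroup.one_closed[OF sQ(1)]] lam_one by simp
    have sL: "subgroup L G"
      using phi_mult phi_one oneP subgroup.m_closed[OF P(1)] cP
      by (intro finite_submonoid_subgroup) (auto simp: L_def)
    have qpn: "q [^] (p ^ n) = \<one>" if "q \<in> Q" for q
      using pow_card_eq_one[OF P(1)] P(2) that sQ by auto
    have cancel: "q [^] (s * M) = q" if q: "q \<in> Q" for q
    proof -
      have red: "q [^] (a::nat) = q [^] (a mod p ^ n)" for a
      proof -
        have "q [^] a = q [^] (p ^ n * (a div p ^ n) + a mod p ^ n)" by simp
        also have "\<dots> = (q [^] (p ^ n)) [^] (a div p ^ n) \<otimes> q [^] (a mod p ^ n)"
          using cQ[OF q] by (simp add: nat_pow_mult nat_pow_pow del: mult_div_mod_eq)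
        finally show ?thesis using qpn[OF q] cQ[OF q] by simp
      qed
      have "(s * M) mod p ^ n = 1 mod p ^ n" using s by (simp add: cong_def mult.commute)
      hence "q [^] (s * M) = q [^] (1::nat)" using red[of "s * M"] red[of 1] by metis
      thus ?thesis using cQ[OF q] by simp
    qed
    have "P \<subseteq> L <#> Q"
    proof
      fix x assume x: "x \<in> P"
      obtain q0 where q0: "q0 \<in> Q" "phi x = lam q0" using phiA[OF x] carA by auto
      define q where "q = q0 [^] s"
      have q: "q \<in> Q" using subgroup_pow[OF sQ(1) q0(1)] by (simp add: q_def)
      have "phi q = lam (q0 [^] (s * M))"
        using phi_Q[OF q] lam_pow[OF q, of M] q0 cQ by (simp add: q_def nat_pow_pow)
      hence pq: "phi q = phi x" using cancel[OF q0(1)] q0 by simp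
      have iq: "inv q \<in> P" "q \<in> P" using q sQ subgroup.m_inv_closed[OF P(1)] by auto
      have "phi (x \<otimes> inv q) \<otimes>\<^bsub>A\<^esub> phi q = phi x"
        using phi_mult[of "x \<otimes> inv q" q] x iq subgroup.m_closed[OF P(1)] cP by (simp add: m_assoc)
      hence "phi (x \<otimes> inv q) = \<one>\<^bsub>A\<^esub>"
        using pq phiA x iq subgroup.m_closed[OF P(1)] by simp
      hence "x \<otimes> inv q \<in> L" using x iq subgroup.m_closed[OF P(1)] by (simp add: L_def)
      moreover have "x = x \<otimes> inv q \<otimes> q" using x iq cP by (simp add: m_assoc)
      ultimately show "x \<in> L <#> Q" using q by (auto simp: set_mult_def)
    qed
    moreover have "Q \<subseteq> Phi P" using int Rn(2) by (auto simp: Q_def)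
    \<comment> \<open>\<open>Q\<close> consists of nongenerators, so \<open>phi\<close> is trivial
      on \<open>P\<close>; but on \<open>Q\<close> it is the \<open>M\<close>-th power of
      \<open>lam\<close>, whose triviality puts \<open>Q\<close> into \<open>Q1\<close>.\<close>
    ultimately have LP: "L = P" by (intro Phi_nongenerator[OF P(1) sL]) (auto simp: L_def)
    have "q \<in> Q1" if q: "q \<in> Q" for q
    proof (rule pow_mem_coprime[OF Q1(1) cQ[OF q]])
      have "phi q = \<one>\<^bsub>A\<^esub>" using LP q sQ by (auto simp: L_def)
      hence "lam (q [^] M) = \<one>\<^bsub>A\<^esub>" using phi_Q lam_pow q by simp
      thus "q [^] M \<in> Q1" using lam_one_iff subgroup_pow[OF sQ(1) q] by blast
      show "q [^] (p ^ n) \<in> Q1" using qpn[OF q] subgroup.one_closed[OF Q1(1)] by simp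
      show "coprime M (p ^ n)" using M by simp
    qed
    thus False using Q1(2) by blast
  qed
  hence "card (R <#> P) * 1 = card R * p ^ n"
    using card_set_mult[OF sR P(1)] P(2) by (simp add: Q_def Int_commute)
  hence "p ^ n * m = p ^ n * card R" using RP P(3) by (simp only: order_def mult_1_right mult.commute)
  hence "card R = m" using p0 by simp
  thus ?thesis using that[OF Rn(1,2) _ RP] P(4) by simp
qed

lemma normal_Inter:
  assumes S: "\<And>N. N \<in> S \<Longrightarrow> N \<lhd> G" "S \<noteq> {}"
  shows "\<Inter>S \<lhd> G"
proof (rule normal_invI)
  show "subgroup (\<Inter>S) G" using S normal_imp_subgroup by (intro subgroups_Inter) auto
  fix x h assume "x \<in> carrier G" "h \<in> \<Inter>S"
  thus "x \<otimes> h \<otimes> inv x \<in> \<Inter>S" using normal.inv_op_closed2[OF S(1)] by blast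
qed

lemma core_normal:
  assumes K: "subgroup K G"
  shows "{x \<in> carrier G. \<forall>g\<in>carrier G. inv g \<otimes> x \<otimes> g \<in> K} \<lhd> G" (is "?D \<lhd> G")
proof (rule normal_invI)
  show "subgroup ?D G"
  proof (rule finite_submonoid_subgroup)
    show "\<one> \<in> ?D" using subgroup.one_closed[OF K] by simp
    fix x y assume x: "x \<in> ?D" and y: "y \<in> ?D"
    have "inv g \<otimes> (x \<otimes> y) \<otimes> g \<in> K" if g: "g \<in> carrier G" for g
    proof -
      have "inv g \<otimes> (x \<otimes> y) \<otimes> g = (inv g \<otimes> x \<otimes> g) \<otimes> (inv g \<otimes> y \<otimes> g)"
        using g x y by (simp add: m_assoc)
      thus ?thesis using x y g subgroup.m_closed[OF K] by simp
    qed
    thus "x \<otimes> y \<in> ?D" using x y by simp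
  qed auto
  fix h y assume h: "h \<in> carrier G" and y: "y \<in> ?D"
  have "inv g \<otimes> (h \<otimes> y \<otimes> inv h) \<otimes> g \<in> K" if g: "g \<in> carrier G" for g
  proof -
    have "inv g \<otimes> (h \<otimes> y \<otimes> inv h) \<otimes> g = inv (inv h \<otimes> g) \<otimes> y \<otimes> (inv h \<otimes> g)"
      using g h y by (simp add: m_assoc inv_mult_group)
    moreover have "inv h \<otimes> g \<in> carrier G" using g h by simp
    ultimately show ?thesis using y by simp
  qed
  thus "h \<otimes> y \<otimes> inv h \<in> ?D" using h y by simp
qed

lemma pow_index_mem:
  assumes J: "subgroup J G" and R: "R \<lhd> G\<lparr>carrier := J\<rparr>" and c: "card J = c * card R" and s: "s \<in> J"
  shows "s [^] c \<in> R"
proof -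
  let ?J = "G\<lparr>carrier := J\<rparr>"
  interpret J: prime_group ?J p by (rule restrict_group[OF J])
  have sR: "subgroup R ?J" using normal_imp_subgroup[OF R] .
  have sRG: "subgroup R G" using incl_subgroup[OF J sR] .
  interpret F: group "?J Mod R" by (rule normal.factorgroup_is_group[OF R])
  have "card (rcosets\<^bsub>?J\<^esub> R) * card R = c * card R"
    using J.lagrange[OF sR] c by (simp add: order_def)
  hence o: "order (?J Mod R) = c"
    using subgroup_card_pos[OF sRG] by (simp add: FactGroup_def order_def)
  have in_q: "R #> s \<in> carrier (?J Mod R)" using s by (auto simp: carrier_FactGroup)
  have "(R #>\<^bsub>?J\<^esub> s) [^]\<^bsub>?J Mod R\<^esub> c = R #>\<^bsub>?J\<^esub> (s [^]\<^bsub>?J\<^esub> c)"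
    using normal.FactGroup_pow[OF R] s by simp
  hence "R #> (s [^]\<^bsub>?J\<^esub> c) = R" using F.pow_order_eq_1[OF in_q] o by simp
  hence "R #> (s [^] c) = R" by (simp add: nat_pow_consistent[symmetric])
  thus ?thesis using coset_join1[OF _ _ sRG] s subgroup_carrier[OF J] by simp
qed

text \<open>A conjugate \<open>?s\<close> of an element of \<open>R\<close> stays in
  \<open>N\<close>, hence in \<open>J\<close>. Its \<open>p ^ a\<close>-th power lies in
  \<open>R\<close> because \<open>J/R\<close> has order \<open>p ^ a\<close>, and its power by the
  order of \<open>R\<close> is trivial; so it lies in \<open>R\<close>, even when \<open>J\<close>
  is not normal in \<open>G\<close>.\<close>

lemma p'_normal_lift:
  assumes N: "N \<lhd> G" and J: "subgroup J G" "N \<subseteq> J" and R: "R \<lhd> G\<lparr>carrier := J\<rparr>" "R \<subseteq> N"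
    and cop: "coprime (card R) p" and c: "card J = p ^ a * card R"
  shows "R \<lhd> G"
proof (rule normal_invI)
  show sR: "subgroup R G" using incl_subgroup[OF J(1) normal_imp_subgroup[OF R(1)]] .
  fix g r assume g: "g \<in> carrier G" and r: "r \<in> R"
  let ?s = "g \<otimes> r \<otimes> inv g"
  have rc: "r \<in> carrier G" using subgroup_carrier[OF sR r] .
  have sN: "?s \<in> J" using normal.inv_op_closed2[OF N g] r R(2) J(2) by blast
  have conj: "?s [^] (i::nat) = g \<otimes> r [^] i \<otimes> inv g" for i
    by (induction i) (use g rc in \<open>simp_all add: m_assoc\<close>)
  show "?s \<in> R"
  proof (rule pow_mem_coprime[OF sR])
    show "?s [^] card R \<in> R"
      using conj[of "card R"] pow_card_eq_one[OF sR r] g subgroup.one_closed[OF sR] by simp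
    show "?s [^] (p ^ a) \<in> R" by (rule pow_index_mem[OF J(1) R(1) c sN])
    show "coprime (card R) (p ^ a)" using cop by simp
  qed (use g rc in simp)
qed

end

section \<open>A Sylow subgroup in a group with trivial p'-core\<close>

locale core_free_sylow = prime_group G p for G (structure) and p +
  fixes P :: "'a set" and n m :: nat
  assumes sP: "subgroup P G" and cardP: "card P = p ^ n" and orderG: "order G = p ^ n * m"
    and copm: "coprime m p" and core: "p'_core G p = {\<one>}"
begin

lemmas cP = subgroup_carrier[OF sP]
lemmas P_mult = subgroup.m_closed[OF sP]
lemmas P_inv = subgroup.m_inv_closed[OF sP]

lemma pP: "p_subgroup P" using sP cardP p_subgroup_def by blast

lemma p1: "p > 1" using prime_p prime_gt_1_nat by blast

lemma p0: "p \<noteq> 0" using p1 by simp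

lemma core_trivial: "N \<lhd> G \<Longrightarrow> coprime (card N) p \<Longrightarrow> N = {\<one>}"
  using p'_core_greatest(3)[OF fin, of N p] core subgroup.one_closed[OF normal_imp_subgroup] by blast

lemma sPhi: "subgroup (Phi P) G" by (rule Phi_subgroup[OF sP])

lemma card_over_P:
  assumes J: "subgroup J G" "P \<subseteq> J"
  obtains m' where "card J = p ^ n * m'" "m' dvd m" "coprime m' p"
proof -
  obtain m' where m': "card J = p ^ n * m'" using subgroup_card_dvd[OF sP J] cardP by auto
  have "card J dvd order G"
    using subgroup_card_dvd[OF J(1) subgroup_self] subgroup.subset[OF J(1)] by (simp add: order_def)
  hence d: "m' dvd m" using m' orderG p0 by simp
  show ?thesis using that[OF m' d] copm d by (meson coprime_divisors dvd_refl)
qed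

text \<open>Tate's theorem inside \<open>J\<close> gives a normal p-complement \<open>R\<close> of
  \<open>J\<close>. As \<open>R\<close> lies in \<open>N\<close>, it is even normal in
  \<open>G\<close>, so it is trivial and \<open>J\<close> reduces to \<open>P\<close>. The relative
  form serves kernels of transfers, which are known to be normal only in \<open>J\<close>.\<close>

lemma tate_relative:
  assumes N: "N \<lhd> G" and J: "subgroup J G" "P \<subseteq> J" "N \<subseteq> J"
    and M: "M \<lhd> G\<lparr>carrier := J\<rparr>" "M \<subseteq> N" "J = P <#> M" "P \<inter> M \<subseteq> Phi P"
  shows "J = P"
proof -
  let ?J = "G\<lparr>carrier := J\<rparr>"
  interpret J: prime_group ?J p by (rule restrict_group[OF J(1)])
  obtain m' where m': "card J = p ^ n * m'" and cop: "coprime m' p" by (rule card_over_P[OF J(1,2)])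
  have a1: "subgroup P ?J" using subgroup_incl[OF sP J(1,2)] .
  have a2: "order ?J = p ^ n * m'" using m' by (simp add: order_def)
  have a3: "carrier ?J = P <#>\<^bsub>?J\<^esub> M" using M(3) by simp
  have a4: "P \<inter> M \<subseteq> frattini (?J\<lparr>carrier := P\<rparr>)" using M(4) by simp
  obtain R where R: "R \<lhd> ?J" "R \<subseteq> M" "coprime (card R) p" "carrier ?J = R <#>\<^bsub>?J\<^esub> P"
    using J.tate_normal_complement[OF a1 cardP a2 cop M(1) a3 a4] by blast
  have sR: "subgroup R G" using incl_subgroup[OF J(1) normal_imp_subgroup[OF R(1)]] .
  have I: "subgroup (R \<inter> P) G" using sR sP subgroups_Inter_pair by blast
  have "card (R \<inter> P) dvd card R" "card (R \<inter> P) dvd p ^ n"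
    using subgroup_card_dvd[OF I sR] subgroup_card_dvd[OF I sP] cardP by auto
  hence "card (R \<inter> P) = 1" using R(3) by (meson coprime_common_divisor_nat coprime_power_right_iff)
  hence cJ: "card J = p ^ n * card R"
    using card_set_mult[OF sR sP] R(4) cardP by (simp add: ac_simps)
  have "R \<lhd> G" using p'_normal_lift[OF N J(1,3) R(1) _ R(3) cJ] R(2) M(2) by blast
  hence "R = {\<one>}" using core_trivial R(3) by blast
  thus ?thesis using R(4) cP by (auto simp: set_mult_def)
qed

lemma tate_normal:
  assumes N: "N \<lhd> G" and I: "P \<inter> N \<subseteq> Phi P"
  shows "N \<subseteq> P"
proof -
  interpret S: second_isomorphism_grp N G P
    using N sP by (simp add: second_isomorphism_grp_def second_isomorphism_grp_axioms_def)
  let ?J = "N <#> P"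
  note J = S.normal_set_mult_subgroup
  have "P \<subseteq> ?J" "N \<subseteq> ?J" using S.S_contained_in_set_mult S.H_contained_in_set_mult .
  moreover have "N \<lhd> G\<lparr>carrier := ?J\<rparr>" using normal_restrict_supergroup[OF J N] calculation by blast
  moreover have "?J = P <#> N" using commut_normal[OF sP N] by simp
  ultimately have "?J = P" using tate_relative[OF N J] I by blast
  thus ?thesis using S.H_contained_in_set_mult by simp
qed

text \<open>
  No Sylow subgroup lies in a subgroup of index \<open>p\<close>. So each of these meets \<open>P\<close> in a maximal
  subgroup, and the Frattini subgroup of \<open>P\<close> lies in the intersection of all of them.
\<close>

lemma index_p_subgroup:
  assumes M: "subgroup M G" "order G = p * card M"
  shows "carrier G = P <#> M" "card P = p * card (P \<inter> M)" "Phi P \<subseteq> M"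
proof -
  have I: "subgroup (P \<inter> M) G" using sP M subgroups_Inter_pair by blast
  have pos: "card M > 0" "card (P \<inter> M) > 0" using subgroup_card_pos M I by auto
  have "\<not> P \<subseteq> M"
  proof
    assume "P \<subseteq> M"
    then obtain q where "card M = p ^ n * q" using subgroup_card_dvd[OF sP M(1)] cardP by auto
    hence "p ^ n * m = p ^ n * (p * q)" using M(2) orderG p0 by simp
    hence "m = p * q" using p0 by simp
    thus False using copm p1 by simp
  qed
  hence le: "p * card (P \<inter> M) dvd card P" using p_subgroup_card_less[OF pP I] by blast
  have cm: "card (P <#> M) * card (P \<inter> M) = card P * card M" by (rule card_set_mult[OF sP M(1)])
  have subc: "P <#> M \<subseteq> carrier G" using sP M(1) by (intro set_mult_closed subgroup.subset)
  have "card (P <#> M) \<le> p * card M"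
    using card_mono[OF fin subc] M(2) by (simp add: order_def)
  hence "card P * card M \<le> p * card (P \<inter> M) * card M" using cm by (metis mult.assoc mult.commute mult_le_mono1)
  hence "card P \<le> p * card (P \<inter> M)" using pos by simp
  moreover have "p * card (P \<inter> M) \<le> card P" using dvd_imp_le[OF le] subgroup_card_pos[OF sP] .
  ultimately show ci: "card P = p * card (P \<inter> M)" by simp
  have "card (P <#> M) * card (P \<inter> M) = (p * card M) * card (P \<inter> M)" using cm ci by (metis mult.assoc mult.commute)
  hence "card (P <#> M) = p * card M" using pos by simp
  hence "card (carrier G) \<le> card (P <#> M)" using M(2) by (simp add: order_def)
  thus "carrier G = P <#> M" using card_seteq[OF fin subc] by simp
  have "maximal_in (P \<inter> M) P" using index_p_maximal[OF pP I _ ci] by blast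
  thus "Phi P \<subseteq> M" using Phi_iff by blast
qed

text \<open>The intersection of all subgroups of index \<open>p\<close>, or \<open>G\<close> if
  there are none. The conjugates are built in so that normality follows from
  \<open>core_normal\<close>.\<close>

definition index_p_core where
  "index_p_core = {y \<in> carrier G. \<forall>M. subgroup M G \<and> order G = p * card M \<longrightarrow> (\<forall>g\<in>carrier G. inv g \<otimes> y \<otimes> g \<in> M)}"

lemma index_p_core_normal: "index_p_core \<lhd> G"
proof -
  let ?core = "\<lambda>M. {x \<in> carrier G. \<forall>g\<in>carrier G. inv g \<otimes> x \<otimes> g \<in> M}"
  have "index_p_core = \<Inter>(insert (carrier G) (?core ` {M. subgroup M G \<and> order G = p * card M}))"
    by (auto simp: index_p_core_def)
  also have "\<dots> \<lhd> G" using core_normal normal_self by (intro normal_Inter) auto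
  finally show ?thesis .
qed

lemma Phi_conj_P:
  assumes "x \<in> P" "y \<in> Phi P" shows "x \<otimes> y \<otimes> inv x \<in> Phi P" "inv x \<otimes> y \<otimes> x \<in> Phi P"
proof -
  have *: "x \<otimes> y \<otimes> inv x \<in> Phi P" if "x \<in> P" for x
    using that assms(2) cP P_mult P_inv by (intro Phi_conj[OF sP]) auto
  show "x \<otimes> y \<otimes> inv x \<in> Phi P" using *[OF assms(1)] .
  show "inv x \<otimes> y \<otimes> x \<in> Phi P" using *[OF P_inv[OF assms(1)]] assms(1) cP by simp
qed

text \<open>\<open>M\<close> supplements \<open>P\<close>, so \<open>g\<close> is a product of some
  \<open>x\<close> in \<open>P\<close> and \<open>z\<close> in \<open>M\<close>. Conjugation by
  \<open>x\<close> preserves \<open>Phi P\<close>, which lies in \<open>M\<close>, and conjugation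
  by \<open>z\<close> preserves \<open>M\<close>.\<close>

lemma Phi_in_index_p_core: "Phi P \<subseteq> index_p_core"
proof
  fix y assume y: "y \<in> Phi P"
  have yc: "y \<in> carrier G" using subgroup_carrier[OF sPhi y] .
  have "inv g \<otimes> y \<otimes> g \<in> M" if M: "subgroup M G" "order G = p * card M" and g: "g \<in> carrier G" for M g
  proof -
    obtain x z where x: "x \<in> P" "z \<in> M" "g = x \<otimes> z"
      using index_p_subgroup(1)[OF M] g by (auto simp: set_mult_def)
    have "inv x \<otimes> y \<otimes> x \<in> M" using Phi_conj_P(2)[OF x(1) y] index_p_subgroup(3)[OF M] by blast
    moreover have "inv g \<otimes> y \<otimes> g = inv z \<otimes> (inv x \<otimes> y \<otimes> x) \<otimes> z"
      using x yc cP subgroup_carrier[OF M(1)] by (simp add: inv_mult_group m_assoc)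
    ultimately show ?thesis
      using x(2) subgroup.m_closed[OF M(1)] subgroup.m_inv_closed[OF M(1)] by simp
  qed
  thus "y \<in> index_p_core" using yc by (auto simp: index_p_core_def)
qed

lemma index_p_core_subset: "subgroup M G \<Longrightarrow> order G = p * card M \<Longrightarrow> index_p_core \<subseteq> M"
  unfolding index_p_core_def by force

text \<open>For \<open>L\<close> above \<open>Phi P\<close> this is the preimage of the span of
  \<open>L/\<Phi>(P)\<close> and the image of \<open>w\<close>: such \<open>L\<close> are normal in
  \<open>P\<close> and the quotient has exponent \<open>p\<close>, so \<open>adjoin_power\<close>
  applies to every \<open>w\<close> in \<open>P\<close>.\<close>

definition adjoin :: "'a set \<Rightarrow> 'a \<Rightarrow> 'a set" where
  "adjoin L w = {l \<otimes> w [^] (i::nat) | l i. l \<in> L}"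

lemma adjoin_Phi:
  assumes L: "subgroup L G" "L \<subseteq> P" "Phi P \<subseteq> L" and w: "w \<in> P"
  shows "subgroup (adjoin L w) G" "adjoin L w \<subseteq> P" "L \<subseteq> adjoin L w" "w \<in> adjoin L w"
    "card (adjoin L w) \<le> p * card L"
proof -
  have nm: "\<forall>l\<in>L. w \<otimes> l \<otimes> inv w \<in> L"
  proof
    fix l assume l: "l \<in> L"
    have "w \<otimes> l \<otimes> inv w = (w \<otimes> l \<otimes> inv w \<otimes> inv l) \<otimes> l"
      using w l cP subgroup_carrier[OF L(1)] by (simp add: m_assoc)
    moreover have "w \<otimes> l \<otimes> inv w \<otimes> inv l \<in> L" using Phi_commutator[OF pP w] l L by blast
    ultimately show "w \<otimes> l \<otimes> inv w \<in> L" using subgroup.m_closed[OF L(1) _ l] by metis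
  qed
  have wp: "w [^] p \<in> L" using Phi_power[OF pP w] L(3) by blast
  note a = adjoin_power[OF L(1) cP[OF w] nm wp]
  show "adjoin L w \<subseteq> P" using L(2) subgroup_pow[OF sP w] P_mult by (auto simp: adjoin_def)
  show "subgroup (adjoin L w) G" "L \<subseteq> adjoin L w" "w \<in> adjoin L w" "card (adjoin L w) \<le> p * card L"
    unfolding adjoin_def by (fact a)+
qed

end

subsection \<open>Supplements and subgroups of index p\<close>

locale M_group = core_free_sylow G p P n m for G (structure) and p P n m +
  fixes k :: nat
  assumes k2: "k \<ge> 2" and kn: "k \<le> n" and Mcl: "M_class (p ^ k) G"
begin

text \<open>\<open>L <#> K\<close> cannot contain \<open>H\<close>, or it would be all of
  \<open>G\<close>. So it meets \<open>H\<close> exactly in the maximal subgroup \<open>L\<close>,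
  and the product formula gives the index. One \<open>K\<close> serves all \<open>L\<close> at once,
  which the affine geometry later depends on.\<close>

lemma supplement:
  assumes H: "subgroup H G" "card H = p ^ k" "H \<subseteq> P"
  obtains K where "subgroup K G" "carrier G = H <#> K"
    "\<And>L. maximal_in L H \<Longrightarrow> subgroup (L <#> K) G \<and> H \<inter> (L <#> K) = L \<and>
      order G = p * card (L <#> K)"
proof -
  obtain K where K: "subgroup K G" "carrier G = H <#> K"
    "\<And>L. maximal_in L H \<Longrightarrow> proper_subgroup (L <#> K) G"
    using Mcl H(1,2) unfolding M_class_def M_supplemented_def by blast
  have pH: "p_subgroup H" using H p_subgroup_def by blast
  have "subgroup (L <#> K) G \<and> H \<inter> (L <#> K) = L \<and> order G = p * card (L <#> K)"
    if L: "maximal_in L H" for L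
  proof -
    let ?M = "L <#> K"
    have M: "subgroup ?M G" "?M \<noteq> carrier G" using K(3)[OF L] by (auto simp: proper_subgroup_def)
    note L' = maximalD[OF H(1) L]
    have LM: "L \<subseteq> ?M"
      using subgroup_carrier[OF L'(1)] subgroup.one_closed[OF K(1)] by (force simp: set_mult_def)
    have KM: "K \<subseteq> ?M"
      using subgroup_carrier[OF K(1)] subgroup.one_closed[OF L'(1)] by (force simp: set_mult_def)
    have I: "subgroup (H \<inter> ?M) G" using subgroups_Inter_pair H M by blast
    have HM: "H <#> ?M = carrier G"
    proof
      show "H <#> ?M \<subseteq> carrier G" using H M by (intro set_mult_closed subgroup.subset)
      show "carrier G \<subseteq> H <#> ?M" unfolding K(2) using mono_set_mult[OF order_refl KM] .
    qed
    have "\<not> H \<subseteq> ?M"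
    proof
      assume "H \<subseteq> ?M"
      hence "H <#> ?M \<subseteq> ?M" using subgroup.m_closed[OF M(1)] by (auto simp: set_mult_def[of G H])
      thus False using HM M subgroup.subset[OF M(1)] by blast
    qed
    hence e: "H \<inter> ?M = L" using L'(4)[OF I] LM L'(3) by blast
    have "order G * card L = card H * card ?M"
      using card_set_mult[OF H(1) M(1)] HM e by (simp add: order_def)
    hence "order G * card L = (p * card ?M) * card L"
      using maximal_card[OF pH L] by (metis mult.assoc mult.commute)
    thus ?thesis using M e subgroup_card_pos[OF L'(1)] by simp
  qed
  thus ?thesis using that[OF K(1,2)] by blast
qed

lemma hyperplane:
  assumes H: "subgroup H G" "card H = p ^ k" "H \<subseteq> P" and L: "maximal_in L H"
  obtains M where "subgroup M G" "order G = p * card M" "H \<inter> M = L"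
proof -
  obtain K where K: "subgroup K G" "carrier G = H <#> K"
    "\<And>L. maximal_in L H \<Longrightarrow> subgroup (L <#> K) G \<and> H \<inter> (L <#> K) = L \<and>
      order G = p * card (L <#> K)"
    using supplement[OF H] by blast
  thus ?thesis using that[of "L <#> K"] L by blast
qed

lemma Phi_Int_subset:
  assumes H: "subgroup H G" "card H = p ^ k" "H \<subseteq> P"
  shows "H \<inter> Phi P \<subseteq> Phi H"
proof
  fix y assume y: "y \<in> H \<inter> Phi P"
  have "y \<in> L" if L: "maximal_in L H" for L
  proof -
    obtain M where M: "subgroup M G" "order G = p * card M" "H \<inter> M = L"
      using hyperplane[OF H L] by blast
    thus ?thesis using index_p_subgroup(3)[OF M(1,2)] y by blast
  qed
  thus "y \<in> Phi H" using y Phi_iff by blast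
qed

text \<open>A larger Frattini subgroup would contain some \<open>H\<close> of order
  \<open>p ^ k\<close>; then \<open>H\<close> would lie in its own Frattini subgroup, which is
  impossible for a nontrivial group.\<close>

lemma card_Phi: "card (Phi P) \<le> p ^ (k - 1)"
proof (rule ccontr)
  assume n: "\<not> card (Phi P) \<le> p ^ (k - 1)"
  have pPhi: "p_subgroup (Phi P)" using p_subgroup_subset[OF pP sPhi Phi_subset] .
  then obtain f where f: "card (Phi P) = p ^ f" using p_subgroup_def by blast
  have "k - 1 < f" using n f p1 by (metis linorder_not_le nat_less_le power_increasing_iff)
  hence "p ^ k \<le> card (Phi P)" using f p1 k2 by simp
  moreover have "card {\<one>} \<le> p ^ k" using p1 by simp
  moreover have "{\<one>} \<subseteq> Phi P" using subgroup.one_closed[OF sPhi] by simp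
  ultimately obtain H where H: "subgroup H G" "H \<subseteq> Phi P" "card H = p ^ k"
    using p_subgroup_between[OF pPhi triv_subgroup] by blast
  hence "H \<subseteq> Phi H" using Phi_Int_subset[of H] Phi_subset by blast
  moreover have "{\<one>} \<subset> H"
  proof -
    have "card H \<noteq> 1" using H(3) p1 k2 by simp
    thus ?thesis using subgroup.one_closed[OF H(1)] by (auto simp: card_1_singleton_iff)
  qed
  then obtain L where L: "maximal_in L H"
    using exists_maximal[OF H(1) triv_subgroup] by blast
  ultimately show False using Phi_iff maximalD(2)[OF H(1) L] by blast
qed

text \<open>Otherwise \<open>L\<close> extends inside \<open>L <#> Phi P\<close> to an
  \<open>H\<close> of order \<open>p ^ k\<close>. By Dedekind's law \<open>H\<close> is the product
  of \<open>L\<close> with \<open>H \<inter> Phi P\<close>, which consists of nongenerators of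
  \<open>H\<close>; hence \<open>L = H\<close>.\<close>

lemma Phi_in_small:
  assumes L: "subgroup L G" "L \<subseteq> P" "card L = p ^ (k - 1)"
  shows "Phi P \<subseteq> L"
proof (rule ccontr)
  assume n: "\<not> Phi P \<subseteq> L"
  let ?J = "L <#> Phi P"
  have nor: "Phi P \<lhd> G\<lparr>carrier := P\<rparr>"
  proof (rule group.normal_invI[OF subgroup_imp_group[OF sP]])
    show "subgroup (Phi P) (G\<lparr>carrier := P\<rparr>)" using subgroup_incl[OF sPhi sP Phi_subset] .
  qed (use Phi_conj_P sP in auto)
  have LP: "subgroup L (G\<lparr>carrier := P\<rparr>)" using subgroup_incl[OF L(1) sP L(2)] .
  interpret S: second_isomorphism_grp "Phi P" "G\<lparr>carrier := P\<rparr>" L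
    using nor LP by (simp add: second_isomorphism_grp_def second_isomorphism_grp_axioms_def)
  have J: "subgroup ?J G"
    using incl_subgroup[OF sP S.normal_set_mult_subgroup] commut_normal_subgroup[OF sP nor LP] by simp
  have LJ: "L \<subseteq> ?J" "Phi P \<subseteq> ?J"
    using subgroup_carrier[OF L(1)] subgroup_carrier[OF sPhi] subgroup.one_closed[OF sPhi]
      subgroup.one_closed[OF L(1)] by (force simp: set_mult_def)+
  have JP: "?J \<subseteq> P" using L(2) Phi_subset P_mult by (force simp: set_mult_def)
  have "L \<subset> ?J" using LJ n by blast
  then obtain H w where H: "subgroup H G" "L \<subset> H" "H \<subseteq> ?J" "card H = p * card L"
    by (rule p_subgroup_extend[OF p_subgroup_subset[OF pP J JP] L(1)])
  have cH: "card H = p ^ k" using H(4) L(3) k2 by (simp add: power_eq_if)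
  have HP: "H \<subseteq> P" using H(3) JP by blast
  have "H \<subseteq> L <#> (H \<inter> Phi P)"
  proof
    fix h assume h: "h \<in> H"
    then obtain l f where lf: "l \<in> L" "f \<in> Phi P" "h = l \<otimes> f" using H(3) by (auto simp: set_mult_def)
    have "f = inv l \<otimes> h" using lf subgroup_carrier[OF L(1)] subgroup_carrier[OF sPhi] by simp
    hence "f \<in> H" using lf(1) H(2) h subgroup.m_closed[OF H(1)] subgroup.m_inv_closed[OF H(1)] by blast
    thus "h \<in> L <#> (H \<inter> Phi P)" using lf by (auto simp: set_mult_def)
  qed
  hence "L = H" using Phi_nongenerator[OF H(1) L(1)] H(2) Phi_Int_subset[OF H(1) cH HP] by blast
  thus False using H(2) by blast
qed

lemma Phi_in_H:
  assumes H: "subgroup H G" "card H = p ^ k" "H \<subseteq> P"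
  shows "Phi P \<subseteq> H" "Phi H = Phi P"
proof -
  have pH: "p_subgroup H" using H p_subgroup_def by blast
  have "card {\<one>} \<le> p ^ (k - 1)" "p ^ (k - 1) \<le> card H" using p1 H(2) by auto
  then obtain L where "subgroup L G" "L \<subseteq> H" "card L = p ^ (k - 1)"
    using p_subgroup_between[OF pH triv_subgroup] subgroup.one_closed[OF H(1)] by blast
  thus "Phi P \<subseteq> H" using Phi_in_small H(3) by blast
  thus "Phi H = Phi P" using Phi_Int_subset[OF H] Phi_mono[OF pP H(1,3)] by blast
qed

lemma exists_H:
  assumes L: "subgroup L G" "L \<subseteq> P" "card L \<le> p ^ k"
  obtains H where "subgroup H G" "card H = p ^ k" "H \<subseteq> P" "L \<subseteq> H"
proof -
  have "p ^ k \<le> card P" using cardP kn p1 by simp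
  thus ?thesis using p_subgroup_between[OF pP L] that by blast
qed

text \<open>By \<open>card_Phi\<close> the line through \<open>y\<close> has a preimage of order at
  most \<open>p ^ k\<close>, so it fits into some \<open>H\<close>. As \<open>Phi H = Phi P\<close>
  misses \<open>y\<close>, so does a maximal subgroup of \<open>H\<close>, and with it a subgroup of
  index \<open>p\<close> of \<open>G\<close>.\<close>

lemma separate:
  assumes y: "y \<in> P" "y \<notin> Phi P"
  obtains M where "subgroup M G" "order G = p * card M" "y \<notin> M"
proof -
  note L = adjoin_Phi[OF sPhi Phi_subset order_refl y(1)]
  let ?L = "adjoin (Phi P) y"
  have "p * card (Phi P) \<le> p * p ^ (k - 1)" using card_Phi by simp
  also have "\<dots> = p ^ k" using k2 by (simp add: power_eq_if)
  finally have "card ?L \<le> p ^ k" using L(5) by simp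
  then obtain H where H: "subgroup H G" "card H = p ^ k" "H \<subseteq> P" "?L \<subseteq> H"
    using exists_H[OF L(1,2)] by blast
  have "y \<notin> Phi H" using y Phi_in_H[OF H(1-3)] by simp
  hence "\<exists>L'. maximal_in L' H \<and> y \<notin> L'"
    using Phi_iff[of y H] L(4) H(4) by auto
  then obtain L' where L': "maximal_in L' H" "y \<notin> L'" by auto
  obtain M where M: "subgroup M G" "order G = p * card M" "H \<inter> M = L'"
    by (rule hyperplane[OF H(1-3) L'(1)])
  have "y \<notin> M" using M(3) L'(2) L(4) H(4) by blast
  thus ?thesis using that[OF M(1,2)] by blast
qed

lemma index_p_core_eq: "index_p_core = Phi P"
proof -
  have "P \<inter> index_p_core \<subseteq> Phi P"
  proof (rule subsetI, rule ccontr)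
    fix y assume y: "y \<in> P \<inter> index_p_core" "y \<notin> Phi P"
    then obtain M where M: "subgroup M G" "order G = p * card M" "y \<notin> M"
      using separate[of y] by (metis IntD1)
    thus False using index_p_core_subset[OF M(1,2)] y by blast
  qed
  thus ?thesis using tate_normal[OF index_p_core_normal] Phi_in_index_p_core by blast
qed

lemma Phi_normal: "Phi P \<lhd> G" using index_p_core_normal index_p_core_eq by simp

end

section \<open>Elements of order prime to p, transfer into P, and the Frattini quotient of P\<close>

context core_free_sylow
begin

lemma p'_element_in_P:
  assumes "y \<in> P" "coprime q p" "y [^] (q::nat) = \<one>" shows "y = \<one>"
proof -
  have "y [^] (p ^ n) \<in> {\<one>}" using pow_card_eq_one[OF sP assms(1)] cardP by simp
  hence "y \<in> {\<one>}"
    using pow_mem_coprime[OF triv_subgroup cP[OF assms(1)], of q "p ^ n"] assms(2,3) by simp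
  thus ?thesis by simp
qed

text \<open>A prime divisor of the index of \<open>P\<close> in \<open>Y\<close> would give a
  nontrivial p'-element by Sylow's theorem. So equality with \<open>P\<close> can be tested on
  elements.\<close>

lemma no_p'_elements:
  assumes Y: "subgroup Y G" "P \<subseteq> Y"
    and el: "\<And>y q. y \<in> Y \<Longrightarrow> coprime q p \<Longrightarrow> y [^] (q::nat) = \<one> \<Longrightarrow> y = \<one>"
  shows "Y = P"
proof -
  obtain m' where m': "card Y = p ^ n * m'" and cm': "coprime m' p" by (rule card_over_P[OF Y])
  have "m' = 1"
  proof (rule ccontr)
    assume "m' \<noteq> 1"
    then obtain q where q: "Factorial_Ring.prime q" "q dvd m'" using prime_factor_nat by blast
    have "coprime q p" using q(2) cm' by (meson coprime_divisors dvd_refl)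
    obtain r where r: "card Y = q ^ 1 * r" using q(2) m' by (metis dvd_def dvd_mult power_one_right)
    have "finite (carrier (G\<lparr>carrier := Y\<rparr>))" using subgroup_finite[OF Y(1)] by simp
    then obtain S where S: "subgroup S (G\<lparr>carrier := Y\<rparr>)" "card S = q ^ 1"
      using sylow_thm[OF q(1) subgroup_imp_group[OF Y(1)], of 1 r] r by (auto simp: order_def)
    have sS: "subgroup S G" "S \<subseteq> Y"
      using incl_subgroup[OF Y(1) S(1)] subgroup.subset[OF S(1)] by auto
    have "card S \<noteq> 1" using S(2) prime_gt_1_nat[OF q(1)] by simp
    hence "S \<noteq> {\<one>}" by auto
    then obtain y where "y \<in> S" "y \<noteq> \<one>" using subgroup.one_closed[OF sS(1)] by blast
    thus False using el[of y q] pow_card_eq_one[OF sS(1), of y] sS(2) S(2) \<open>coprime q p\<close> by auto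
  qed
  hence "card P = card Y" using m' cardP by simp
  thus ?thesis using card_seteq[OF subgroup_finite[OF Y(1)] Y(2)] by simp
qed

lemma Phi_mod_comm:
  assumes "x \<in> P" "y \<in> P" shows "\<exists>f\<in>Phi P. x \<otimes> y = f \<otimes> (y \<otimes> x)"
  using Phi_commutator[OF pP assms] assms cP
  by (intro bexI[of _ "x \<otimes> y \<otimes> inv x \<otimes> inv y"]) (simp add: m_assoc)

text \<open>Hides the transversal; \<open>M\<close> is the index of \<open>P\<close> in
  \<open>C\<close>. The condition on \<open>z\<close> says that \<open>C\<close> fixes
  \<open>z\<close> as far as \<open>\<mu>\<close> can see. It is used with the identity map on a
  cyclic \<open>P\<close> and with the projection to \<open>P/\<Phi>(P)\<close>.\<close>

lemma transfer_to_sylow: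
  assumes C: "subgroup C G" "P \<subseteq> C" and A: "comm_group A" and \<mu>: "\<mu> \<in> hom (G\<lparr>carrier := P\<rparr>) A"
  shows "\<exists>f M. f \<in> hom (G\<lparr>carrier := C\<rparr>) A \<and> coprime M p \<and> (\<forall>z\<in>P.
    (\<forall>t\<in>C. t \<otimes> z \<otimes> inv t \<in> P \<and> \<mu> (t \<otimes> z \<otimes> inv t) = \<mu> z) \<longrightarrow> f z = \<mu> z [^]\<^bsub>A\<^esub> (M::nat))"
proof -
  let ?C = "G\<lparr>carrier := C\<rparr>"
  interpret C: prime_group ?C p by (rule restrict_group[OF C(1)])
  have sPC: "subgroup P ?C" using subgroup_incl[OF sP C] .
  have cov: "\<exists>s\<in>carrier ?C. inv\<^bsub>?C\<^esub> s \<otimes>\<^bsub>?C\<^esub> g \<in> P" if "g \<in> carrier ?C" for g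
    using that C.l_inv[OF that] subgroup.one_closed[OF sP] by (intro bexI[of _ g]) auto
  obtain \<tau> where \<tau>: "\<forall>g\<in>carrier ?C. \<tau> g \<in> carrier ?C \<and> inv\<^bsub>?C\<^esub> (\<tau> g) \<otimes>\<^bsub>?C\<^esub> g \<in> P \<and>
      (\<forall>x\<in>P. \<tau> (g \<otimes>\<^bsub>?C\<^esub> x) = \<tau> g)"
    using C.exists_transversal[OF sPC subset_refl cov] by blast
  interpret T: transversal ?C p P \<tau>
    by (intro transversal.intro transversal_axioms.intro C.prime_group_axioms) (use sPC \<tau> in auto)
  obtain m' where m': "card C = p ^ n * m'" and cm': "coprime m' p" by (rule card_over_P[OF C])
  have "card T.T * p ^ n = m' * p ^ n" using T.card_T cardP m' by (simp add: order_def ac_simps)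
  hence "coprime (card T.T) p" using p0 cm' by simp
  moreover have mh: "\<mu> \<in> hom (?C\<lparr>carrier := P\<rparr>) A" using \<mu> by simp
  moreover have "finprod A (\<lambda>t. \<mu> (T.\<pi> z t)) T.T = \<mu> z [^]\<^bsub>A\<^esub> card T.T"
    if z: "z \<in> P" and inv: "\<forall>t\<in>C. t \<otimes> z \<otimes> inv t \<in> P \<and> \<mu> (t \<otimes> z \<otimes> inv t) = \<mu> z" for z
  proof (rule T.transfer_eval[OF A mh z])
    fix t assume t: "t \<in> carrier ?C"
    have tc: "inv t \<in> C" "inv (inv t) = t"
      using t subgroup.m_inv_closed[OF C(1)] subgroup_carrier[OF C(1)] by auto
    have e: "inv\<^bsub>?C\<^esub> t \<otimes>\<^bsub>?C\<^esub> z \<otimes>\<^bsub>?C\<^esub> t = inv t \<otimes> z \<otimes> inv (inv t)"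
      using t tc m_inv_consistent[OF C(1)] by simp
    show "inv\<^bsub>?C\<^esub> t \<otimes>\<^bsub>?C\<^esub> z \<otimes>\<^bsub>?C\<^esub> t \<in> P" "\<mu> (inv\<^bsub>?C\<^esub> t \<otimes>\<^bsub>?C\<^esub> z \<otimes>\<^bsub>?C\<^esub> t) = \<mu> z"
      unfolding e using inv tc(1) by blast+
  qed
  ultimately show ?thesis using T.transfer_hom[OF A mh] by blast
qed

text \<open>The quotient stays multiplicative: scalar multiples are powers in \<open>V\<close>, and
  linear independence becomes comparison of exponents modulo \<open>p\<close>.\<close>

definition V where "V = G\<lparr>carrier := P\<rparr> Mod Phi P"

definition v where "v x = Phi P #> x"

lemma Phi_normal_P: "Phi P \<lhd> G\<lparr>carrier := P\<rparr>"
proof (rule group.normal_invI[OF subgroup_imp_group[OF sP]])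
  show "subgroup (Phi P) (G\<lparr>carrier := P\<rparr>)" using subgroup_incl[OF sPhi sP Phi_subset] .
qed (use Phi_conj_P sP in auto)

lemma v_mult: "x \<in> P \<Longrightarrow> y \<in> P \<Longrightarrow> v (x \<otimes> y) = v x \<otimes>\<^bsub>V\<^esub> v y"
  using normal.rcos_sum[OF Phi_normal_P, of x y] by (simp add: V_def v_def)

lemma carrier_V: "carrier V = v ` P"
  by (auto simp: V_def v_def carrier_FactGroup)

lemma v_in_V: "x \<in> P \<Longrightarrow> v x \<in> carrier V"
  by (simp add: carrier_V)

lemma v_eq_iff: "x \<in> P \<Longrightarrow> y \<in> P \<Longrightarrow> v x = v y \<longleftrightarrow> x \<otimes> inv y \<in> Phi P"
proof
  assume xy: "x \<in> P" "y \<in> P"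
  note c = cP[OF xy(1)] cP[OF xy(2)]
  show "x \<otimes> inv y \<in> Phi P" if "v x = v y"
    using rcos_self[OF c(1) sPhi] that subgroup.rcos_module_imp[OF sPhi is_group c(2)] by (simp add: v_def)
  show "v x = v y" if "x \<otimes> inv y \<in> Phi P"
    using repr_independence[OF subgroup.rcos_module_rev[OF sPhi is_group c(2,1) that] c(2) sPhi]
    by (simp add: v_def)
qed

lemma v_one: "v \<one> = \<one>\<^bsub>V\<^esub>"
  using subgroup.subset[OF sPhi] by (simp add: V_def v_def)

lemma v_one_iff: "x \<in> P \<Longrightarrow> v x = \<one>\<^bsub>V\<^esub> \<longleftrightarrow> x \<in> Phi P"
  using v_eq_iff[of x \<one>] v_one subgroup.one_closed[OF sP] cP by simp

lemma V_comm_group: "comm_group V"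
proof -
  have "group V" unfolding V_def by (rule normal.factorgroup_is_group[OF Phi_normal_P])
  thus ?thesis
  proof (rule group.group_comm_groupI)
    fix a b assume "a \<in> carrier V" "b \<in> carrier V"
    then obtain x y where xy: "x \<in> P" "y \<in> P" "a = v x" "b = v y" by (auto simp: carrier_V)
    obtain f where f: "f \<in> Phi P" "x \<otimes> y = f \<otimes> (y \<otimes> x)" using Phi_mod_comm[OF xy(1,2)] by blast
    have yx: "y \<otimes> x \<in> P" "x \<otimes> y \<in> P" using xy P_mult by auto
    have "x \<otimes> y \<otimes> inv (y \<otimes> x) = f" unfolding f(2) using yx f cP subgroup_carrier[OF sPhi] by (simp add: m_assoc)
    hence "v (x \<otimes> y) = v (y \<otimes> x)" using v_eq_iff yx f(1) by simp
    thus "a \<otimes>\<^bsub>V\<^esub> b = b \<otimes>\<^bsub>V\<^esub> a" using xy v_mult by simp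
  qed
qed

lemma v_hom: "v \<in> hom (G\<lparr>carrier := P\<rparr>) V"
  using v_mult v_in_V by (auto simp: hom_def)

lemma v_pow: "x \<in> P \<Longrightarrow> v (x [^] (i::nat)) = v x [^]\<^bsub>V\<^esub> i"
  by (induction i) (use v_mult subgroup_pow[OF sP] v_one in auto)

lemma Phi_subset_P: "f \<in> Phi P \<Longrightarrow> f \<in> P" using Phi_subset by blast

lemma pow_in_Phi:
  assumes w: "w \<in> P" and wi: "w [^] (i::nat) \<in> Phi P" and nd: "\<not> p dvd i"
  shows "w \<in> Phi P"
proof (rule pow_mem_coprime[OF sPhi cP[OF w] wi Phi_power[OF pP w]])
  show "coprime i p" using nd prime_p by (metis coprime_commute prime_imp_coprime)
qed

end

section \<open>Lines and hyperplanes of the Frattini quotient\<close>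

context M_group
begin

text \<open>The preimage of the line spanned by the image of its argument; it collapses to
  \<open>Phi P\<close> when the argument lies there.\<close>

abbreviation "B \<equiv> adjoin (Phi P)"

lemmas B = adjoin_Phi[OF sPhi Phi_subset order_refl]

lemma adjoin_sub:
  assumes "subgroup H G" "L \<subseteq> H" "w \<in> H" shows "adjoin L w \<subseteq> H"
  unfolding adjoin_def using assms subgroup_pow[OF assms(1)] subgroup.m_closed[OF assms(1)] by blast

text \<open>Steinitz exchange: the exponent of \<open>y\<close> in \<open>a\<close> is not divisible
  by \<open>p\<close>, so \<open>y\<close> is recovered from that power and from
  \<open>y [^] p\<close>.\<close>

lemma adjoin_exchange:
  assumes L: "subgroup L G" "L \<subseteq> P" "Phi P \<subseteq> L" and y: "y \<in> P" and a: "a \<in> adjoin L y" "a \<notin> L"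
  shows "y \<in> adjoin L a"
proof -
  obtain l i where li: "l \<in> L" "a = l \<otimes> y [^] (i::nat)" using a(1) by (auto simp: adjoin_def)
  have aP: "a \<in> P" using adjoin_Phi(2)[OF L y] a(1) by blast
  note A = adjoin_Phi[OF L aP]
  have "y [^] i = inv l \<otimes> a" using li y cP subgroup_carrier[OF L(1)] by simp
  moreover have "inv l \<otimes> a \<in> adjoin L a"
    using li(1) A(3,4) subgroup.m_closed[OF A(1)] subgroup.m_inv_closed[OF A(1)] by blast
  ultimately have yi: "y [^] i \<in> adjoin L a" by simp
  have yp: "y [^] p \<in> L" using Phi_power[OF pP y] L(3) by blast
  have "\<not> p dvd i"
  proof
    assume "p dvd i"
    then obtain j where "i = p * j" by auto
    hence "y [^] i = (y [^] p) [^] j" using y cP by (simp add: nat_pow_pow)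
    hence "y [^] i \<in> L" using subgroup_pow[OF L(1) yp] by simp
    thus False using li a subgroup.m_closed[OF L(1)] by blast
  qed
  hence "coprime i p" using prime_p by (metis coprime_commute prime_imp_coprime)
  thus ?thesis using pow_mem_coprime[OF A(1) cP[OF y] yi] yp A(3) by blast
qed

text \<open>A subgroup \<open>M\<close> that is maximal subject to missing \<open>a\<close> is
  already a hyperplane: for \<open>y\<close> in \<open>H\<close> outside \<open>M\<close>, the span
  of \<open>M\<close> and \<open>y\<close> contains \<open>a\<close>, so by exchange
  \<open>y\<close> lies in the span of \<open>M\<close> and \<open>a\<close>.\<close>

lemma avoid_hyperplane:
  assumes H: "subgroup H G" "H \<subseteq> P" and L: "subgroup L G" "L \<subseteq> H" "Phi P \<subseteq> L" and a: "a \<in> H" "a \<notin> L"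
  shows "\<exists>M. maximal_in M H \<and> L \<subseteq> M \<and> a \<notin> M"
proof -
  let ?A = "{M. subgroup M G \<and> M \<subseteq> H \<and> a \<notin> M}"
  have "finite ?A" using subgroup_finite[OF H(1)] by (auto intro: finite_subset[of _ "Pow H"])
  moreover have "L \<in> ?A" using L a by blast
  ultimately obtain M where M: "M \<in> ?A" "L \<subseteq> M" "\<And>N. N \<in> ?A \<Longrightarrow> M \<subseteq> N \<Longrightarrow> M = N"
    using finite_has_maximal2[of ?A L] by (metis (no_types, lifting))
  have M': "subgroup M G" "M \<subseteq> P" "Phi P \<subseteq> M" "a \<notin> M" "M \<subseteq> H" using M(1,2) L H(2) by auto
  have "maximal_in M H"
  proof (rule maximalI[OF H(1) M'(1)])
    show "M \<subset> H" using M' a by blast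
    fix N assume N: "subgroup N G" "M \<subseteq> N" "N \<subseteq> H"
    show "N = M \<or> N = H"
    proof (cases "a \<in> N")
      case False thus ?thesis using M(3)[of N] N by blast
    next
      case True
      have "H \<subseteq> N"
      proof
        fix y assume y: "y \<in> H"
        show "y \<in> N"
        proof (cases "y \<in> M")
          case False
          have yP: "y \<in> P" using y H by blast
          note Y = adjoin_Phi[OF M'(1,2,3) yP]
          have "a \<in> adjoin M y"
          proof (rule ccontr)
            assume "a \<notin> adjoin M y"
            hence "adjoin M y \<in> ?A" using Y(1) adjoin_sub[OF H(1) M'(5) y] by blast
            hence "M = adjoin M y" using M(3) Y(3) by blast
            thus False using Y(4) False by blast
          qed
          hence "y \<in> adjoin M a" using adjoin_exchange[OF M'(1,2,3) yP] M'(4) by blast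
          thus ?thesis using adjoin_sub[OF N(1,2) True] by blast
        qed (use N in blast)
      qed
      thus ?thesis using N by blast
    qed
  qed
  thus ?thesis using M(2) M'(4) by blast
qed

lemma exists_not_Phi: "\<exists>a\<in>P. a \<notin> Phi P"
proof -
  have "p ^ (k - 1) < p ^ k" "p ^ k \<le> p ^ n" using p1 k2 kn by simp_all
  hence "card (Phi P) < card P" using card_Phi cardP by linarith
  thus ?thesis using Phi_subset by (metis card_mono subgroup_finite[OF sPhi] linorder_not_less subsetI)
qed

lemma B_trivial_Int:
  assumes "u \<in> P" "h \<in> P" "u \<notin> B h" "x \<in> B h" "x \<in> B u" shows "x \<in> Phi P"
proof (rule ccontr)
  assume "x \<notin> Phi P"
  hence "u \<in> B x" using adjoin_exchange[OF sPhi Phi_subset order_refl assms(1,5)] by blast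
  moreover have "B x \<subseteq> B h" using adjoin_sub[OF B(1,3)[OF assms(2)] assms(4)] .
  ultimately show False using assms(3) by blast
qed

lemma two_group:
  assumes p2: "p = 2" shows "carrier G = P"
proof (rule no_p'_elements[OF subgroup_self subgroup.subset[OF sP]])
  fix y and q :: nat assume y: "y \<in> carrier G" and q: "coprime q p" "y [^] q = \<one>"
  have sq: "z \<in> M" if z: "z \<in> carrier G" "z [^] q = \<one>" and M: "subgroup M G" "order G = p * card M" for z M
  proof -
    have "card (rcosets M) * card M = 2 * card M" using lagrange[OF M(1)] M(2) p2 by simp
    hence c2: "card (rcosets M) = 2" using subgroup_card_pos[OF M(1)] by simp
    \<comment> \<open>There are only two cosets of \<open>M\<close>, whereas those of
      \<open>\<one>\<close>, \<open>z\<close> and \<open>z \<otimes> z\<close> would all differ.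
      Together with an odd power in \<open>M\<close> this gives \<open>z\<close> itself.\<close>
    have "z [^] (2::nat) \<in> M"
    proof (rule ccontr)
      assume n: "z [^] (2::nat) \<notin> M"
      hence zn: "z \<notin> M" using subgroup_pow[OF M(1)] by blast
      have z2: "z [^] (2::nat) = z \<otimes> z" using z by (simp add: numeral_2_eq_2)
      let ?S = "{M #> \<one>, M #> z, M #> (z \<otimes> z)}"
      have S: "?S \<subseteq> rcosets M" using rcosetsI[OF subgroup.subset[OF M(1)]] z by auto
      have eqD: "b \<otimes> inv a \<in> M" if "M #> a = M #> b" "a \<in> carrier G" "b \<in> carrier G" for a b
        using subgroup.rcos_module_imp[OF M(1) is_group that(2)] rcos_self[OF that(3) M(1)] that(1) by simp
      have "M #> \<one> \<noteq> M #> z" using eqD[of \<one> z] z zn by auto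
      moreover have "M #> \<one> \<noteq> M #> (z \<otimes> z)" using eqD[of \<one> "z \<otimes> z"] z n z2 by auto
      moreover have "M #> z \<noteq> M #> (z \<otimes> z)" using eqD[of z "z \<otimes> z"] z zn by (auto simp: m_assoc)
      ultimately have "card ?S = 3" by simp
      moreover have "finite (rcosets M)" using c2 by (metis card.infinite zero_neq_numeral)
      ultimately show False using card_mono[OF _ S] c2 by simp
    qed
    moreover have "z [^] q \<in> M" using z subgroup.one_closed[OF M(1)] by simp
    ultimately show ?thesis using pow_mem_coprime[OF M(1) z(1)] q(1) p2 by blast
  qed
  have "y \<in> index_p_core"
    unfolding index_p_core_def
  proof (intro CollectI conjI allI impI ballI y)
    fix M g assume M: "subgroup M G \<and> order G = p * card M" and g: "g \<in> carrier G"
    have pw: "(inv g \<otimes> y \<otimes> g) [^] (i::nat) = inv g \<otimes> y [^] i \<otimes> g" for i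
      by (induction i) (use g y in \<open>simp_all add: m_assoc\<close>)
    show "inv g \<otimes> y \<otimes> g \<in> M" using sq[of "inv g \<otimes> y \<otimes> g" M] pw[of q] q(2) g y M by simp
  qed
  hence "y \<in> P" using index_p_core_eq Phi_subset by blast
  thus "y = \<one>" using p'_element_in_P q by blast
qed

end

context prime_group
begin

subsection \<open>Frattini subgroup of order p^(k-1)\<close>

text \<open>Collection in class two: one \<open>f\<close> appears each time a \<open>c\<close>
  passes a later \<open>b\<close>. The sum in the exponent is the binomial coefficient of
  \<open>i\<close> over 2.\<close>

lemma central_commutator_power:
  assumes c: "b \<in> carrier G" "c \<in> carrier G" "f \<in> carrier G"
    and comm: "c \<otimes> b = f \<otimes> (b \<otimes> c)" and fb: "f \<otimes> b = b \<otimes> f" and fc: "f \<otimes> c = c \<otimes> f"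
  shows "c [^] (i::nat) \<otimes> b = f [^] i \<otimes> (b \<otimes> c [^] i)"
    and "(b \<otimes> c) [^] (i::nat) = f [^] (\<Sum>j<i. j) \<otimes> (b [^] i \<otimes> c [^] i)"
proof -
  have fbi: "f [^] (j::nat) \<otimes> b [^] (i::nat) = b [^] i \<otimes> f [^] j" for i j
  proof -
    have "f \<otimes> b [^] i = b [^] i \<otimes> f" using group_commutes_pow[OF fb[symmetric] c(1,3), of i] by simp
    thus ?thesis using group_commutes_pow[of f "b [^] i" j] c by simp
  qed
  have fci: "f [^] (j::nat) \<otimes> c = c \<otimes> f [^] j" for j
    using group_commutes_pow[OF fc c(3,2), of j] by simp
  show A: "c [^] (i::nat) \<otimes> b = f [^] i \<otimes> (b \<otimes> c [^] i)" for i
  proof (induction i)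
    case (Suc i)
    have "c [^] Suc i \<otimes> b = c [^] i \<otimes> (c \<otimes> b)" using c by (simp add: m_assoc)
    also have "\<dots> = c [^] i \<otimes> f \<otimes> (b \<otimes> c)" using c comm by (simp add: m_assoc)
    also have "c [^] i \<otimes> f = f \<otimes> c [^] i" using group_commutes_pow[OF fc[symmetric] c(2,3), of i] by simp
    also have "f \<otimes> c [^] i \<otimes> (b \<otimes> c) = f \<otimes> (c [^] i \<otimes> b) \<otimes> c" using c by (simp add: m_assoc)
    also have "\<dots> = f \<otimes> f [^] i \<otimes> (b \<otimes> (c [^] i \<otimes> c))" unfolding Suc using c by (simp add: m_assoc)
    also have "f \<otimes> f [^] i = f [^] Suc i" using nat_pow_Suc2[OF c(3), of i] by simp
    finally show ?case by simp
  qed (use c in simp)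
  show "(b \<otimes> c) [^] (i::nat) = f [^] (\<Sum>j<i. j) \<otimes> (b [^] i \<otimes> c [^] i)"
  proof (induction i)
    case (Suc i)
    let ?s = "\<Sum>j<i. j"
    have "(b \<otimes> c) [^] Suc i = f [^] ?s \<otimes> (b [^] i \<otimes> (c [^] i \<otimes> b) \<otimes> c)"
      using Suc c by (simp add: m_assoc)
    also have "\<dots> = f [^] ?s \<otimes> ((b [^] i \<otimes> f [^] i) \<otimes> (b \<otimes> (c [^] i \<otimes> c)))"
      unfolding A using c by (simp add: m_assoc)
    also have "b [^] i \<otimes> f [^] i = f [^] i \<otimes> b [^] i" using fbi by simp
    also have "f [^] ?s \<otimes> (f [^] i \<otimes> b [^] i \<otimes> (b \<otimes> (c [^] i \<otimes> c))) =
        (f [^] ?s \<otimes> f [^] i) \<otimes> (b [^] Suc i \<otimes> c [^] Suc i)"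
      using c by (simp add: m_assoc)
    also have "f [^] ?s \<otimes> f [^] i = f [^] (\<Sum>j<Suc i. j)" using c by (simp add: nat_pow_mult)
    finally show ?case .
  qed (use c in simp)
qed

end

context M_group
begin

text \<open>\<open>B w\<close> has order \<open>p ^ k\<close>, so its Frattini subgroup is
  \<open>Phi P\<close>, and together with the powers of \<open>w\<close> it fills
  \<open>B w\<close>. Dropping nongenerators, \<open>B w\<close> is cyclic, and \<open>Phi P\<close>
  is generated by \<open>w [^] p\<close>.\<close>

lemma rank_one_facts:
  assumes cP1: "card (Phi P) = p ^ (k - 1)" and w: "w \<in> P" "w \<notin> Phi P"
  shows "card (B w) = p ^ k" "x \<in> B w \<Longrightarrow> \<exists>i::nat. x = w [^] i"
    "f \<in> Phi P \<Longrightarrow> \<exists>j::nat. f = (w [^] p) [^] j" "w [^] p \<noteq> \<one>"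
proof -
  have pk: "p * p ^ (k - 1) = p ^ k" using k2 by (simp add: power_eq_if)
  note Bw = B[OF w(1)]
  have wc: "w \<in> carrier G" using cP w by blast
  have "p * card (Phi P) dvd card (B w)"
    using p_subgroup_card_less[OF p_subgroup_subset[OF pP Bw(1,2)] sPhi] Bw(3,4) w(2) by blast
  hence "p * card (Phi P) \<le> card (B w)" using dvd_imp_le subgroup_card_pos[OF Bw(1)] by blast
  thus cB: "card (B w) = p ^ k" using Bw(5) cP1 pk by simp
  have PhB: "Phi (B w) = Phi P" using Phi_in_H(2)[OF Bw(1) cB Bw(2)] .
  define C where "C = {w [^] (i::nat) | i. True}"
  have sC: "subgroup C G"
  proof (rule finite_submonoid_subgroup)
    show "C \<subseteq> carrier G" using wc by (auto simp: C_def)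
    show "\<one> \<in> C" unfolding C_def by (intro CollectI exI[of _ "0::nat"]) simp
    fix x y assume "x \<in> C" "y \<in> C"
    thus "x \<otimes> y \<in> C" using wc by (auto simp: C_def nat_pow_mult)
  qed
  have CB: "C \<subseteq> B w" using subgroup_pow[OF Bw(1,4)] by (auto simp: C_def)
  have "B w \<subseteq> C <#> Phi P"
  proof
    fix x assume "x \<in> B w"
    then obtain f i where fi: "f \<in> Phi P" "x = f \<otimes> w [^] (i::nat)" by (auto simp: adjoin_def)
    have wi: "w [^] i \<in> P" using subgroup_pow[OF sP w(1)] .
    have "x = w [^] i \<otimes> (inv (w [^] i) \<otimes> f \<otimes> w [^] i)"
      using fi wi wc subgroup_carrier[OF sPhi] by (simp add: m_assoc)
    moreover have "inv (w [^] i) \<otimes> f \<otimes> w [^] i \<in> Phi P" using Phi_conj_P(2)[OF wi fi(1)] .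
    moreover have "w [^] i \<in> C" by (auto simp: C_def)
    ultimately show "x \<in> C <#> Phi P" by (auto simp: set_mult_def)
  qed
  hence CBe: "C = B w" using Phi_nongenerator[OF Bw(1) sC CB] PhB by blast
  show gen: "\<exists>i::nat. x = w [^] i" if "x \<in> B w" for x using that CBe by (auto simp: C_def)
  show gp: "\<exists>j::nat. f = (w [^] p) [^] j" if f: "f \<in> Phi P" for f
  proof -
    obtain i where i: "f = w [^] (i::nat)" using gen f Bw(3) by blast
    have "p dvd i" using pow_in_Phi[OF w(1), of i] f i w(2) by blast
    then obtain j where "i = p * j" by auto
    thus ?thesis using i wc by (auto simp: nat_pow_pow)
  qed
  \<comment> \<open>Here \<open>k \<ge> 2\<close> enters: \<open>w [^] p\<close> generates a group
    of order \<open>p ^ (k - 1)\<close>, which is at least \<open>p\<close>.\<close>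
  show "w [^] p \<noteq> \<one>"
  proof
    assume e: "w [^] p = \<one>"
    have "Phi P \<subseteq> {\<one>}" using gp e by force
    hence "card (Phi P) \<le> 1" using card_mono[of "{\<one>}" "Phi P"] by simp
    moreover have "p ^ 1 \<le> p ^ (k - 1)" using k2 p1 by (intro power_increasing) auto
    ultimately show False using cP1 p1 by simp
  qed
qed

text \<open>Two independent elements have p-th powers in the same cyclic group \<open>Phi P\<close>,
  yet every element outside \<open>Phi P\<close> has a nontrivial p-th power. A suitable product of
  the two violates this.\<close>

lemma rank_one_cyclic:
  assumes cP1: "card (Phi P) = p ^ (k - 1)" and odd: "p \<noteq> 2" and a: "a \<in> P" "a \<notin> Phi P"
  shows "P = B a"
proof (rule ccontr)
  assume "P \<noteq> B a"
  then obtain b where b: "b \<in> P" "b \<notin> B a" using B(2)[OF a(1)] by blast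
  note Ba = B[OF a(1)] and ra = rank_one_facts[OF cP1 a]
  have bn: "b \<notin> Phi P" using b Ba(3) by blast
  note rb = rank_one_facts[OF cP1 b(1) bn]
  have ac: "a \<in> carrier G" "b \<in> carrier G" using a b cP by auto
  obtain j where j: "b [^] p = (a [^] p) [^] (j::nat)" using ra(3) Phi_power[OF pP b(1)] by blast
  \<comment> \<open>\<open>b c\<close> has order \<open>p\<close> although it lies outside of the Frattini subgroup; this needs \<open>p\<close> odd.\<close>
  define c where "c = inv (a [^] j)"
  have aj: "a [^] j \<in> P" "a [^] j \<in> B a" using subgroup_pow[OF sP a(1)] subgroup_pow[OF Ba(1,4)] by auto
  have cPp: "c \<in> P" "c \<in> carrier G" using aj(1) P_inv ac by (auto simp: c_def)
  obtain f where f: "f \<in> Phi P" "c \<otimes> b = f \<otimes> (b \<otimes> c)" using Phi_mod_comm[OF cPp(1) b(1)] by blast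
  have fcar: "f \<in> carrier G" using subgroup_carrier[OF sPhi f(1)] .
  \<comment> \<open>\<open>f\<close> is a power of \<open>a [^] p\<close> and also of
    \<open>b [^] p\<close>, so it commutes with \<open>a\<close> and \<open>b\<close>, hence with
    \<open>c\<close>.\<close>
  obtain i where i: "f = (a [^] p) [^] (i::nat)" using ra(3)[OF f(1)] by blast
  obtain l where l: "f = (b [^] p) [^] (l::nat)" using rb(3)[OF f(1)] by blast
  have fb: "f \<otimes> b = b \<otimes> f"
    using group_commutes_pow[of b b "p * l"] ac unfolding l by (simp add: nat_pow_pow)
  have fa: "f \<otimes> a [^] j = a [^] j \<otimes> f"
    unfolding i using ac by (simp add: nat_pow_pow pow_pow_commute)
  have fc: "f \<otimes> c = c \<otimes> f"
  proof -
    have "f \<otimes> c = c \<otimes> (a [^] j \<otimes> f) \<otimes> c" using ac fcar by (simp add: c_def m_assoc[symmetric])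
    also have "\<dots> = c \<otimes> f" unfolding fa[symmetric] using ac fcar by (simp add: c_def m_assoc)
    finally show ?thesis .
  qed
  note cc = central_commutator_power[OF ac(2) cPp(2) fcar f(2) fb fc]
  have cp: "c [^] p = inv (b [^] p)"
    using ac j by (simp add: c_def nat_pow_inv nat_pow_pow mult.commute)
  \<comment> \<open>\<open>c [^] p\<close> is the inverse of a power of \<open>b\<close>; its
    commutator with \<open>b\<close> is \<open>f [^] p\<close>, which therefore vanishes.\<close>
  have "c [^] p \<otimes> b = b \<otimes> c [^] p"
  proof -
    have bb: "b [^] p \<otimes> b = b \<otimes> b [^] p" using group_commutes_pow[of b b p] ac by simp
    have "c [^] p \<otimes> b = inv (b [^] p) \<otimes> (b \<otimes> b [^] p) \<otimes> inv (b [^] p)" unfolding cp using ac by (simp add: m_assoc)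
    also have "\<dots> = b \<otimes> c [^] p" unfolding bb[symmetric] cp using ac by (simp add: m_assoc)
    finally show ?thesis .
  qed
  hence "b \<otimes> c [^] p = f [^] p \<otimes> (b \<otimes> c [^] p)" using cc(1)[of p] by simp
  hence fp: "f [^] p = \<one>" using fcar ac cPp by simp
  \<comment> \<open>For odd \<open>p\<close> the exponent \<open>p (p - 1) / 2\<close> from the
    collection formula is a multiple of \<open>p\<close>, so the power of \<open>f\<close>
    disappears.\<close>
  have "even (p - 1)" using odd prime_p prime_odd_nat[OF prime_p] p1 prime_ge_2_nat[OF prime_p] by auto
  then obtain e where e: "p - 1 = 2 * e" by (rule evenE)
  have "(\<Sum>j<p. j) = p * (p - 1) div 2" using Sum_Ico_nat[of 0 p] by (simp add: atLeast0LessThan)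
  hence "(\<Sum>j<p. j) = p * e" using e by simp
  hence "f [^] (\<Sum>j<p. j) = (f [^] p) [^] e" using fcar by (simp add: nat_pow_pow)
  hence "(b \<otimes> c) [^] p = \<one>" using cc(2)[of p] fp cp ac by simp
  moreover have "b \<otimes> c \<notin> Phi P"
  proof
    assume "b \<otimes> c \<in> Phi P"
    hence "b \<otimes> c \<otimes> a [^] j \<in> B a" using Ba(3) aj(2) subgroup.m_closed[OF Ba(1)] by blast
    moreover have "b \<otimes> c \<otimes> a [^] j = b" using ac by (simp add: c_def m_assoc)
    ultimately show False using b by simp
  qed
  ultimately show False using rank_one_facts(4)[OF cP1, of "b \<otimes> c"] P_mult[OF b(1) cPp(1)] by blast
qed

text \<open>\<open>P\<close> is abelian, so its identity map can be transferred to the centralizer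
  \<open>C\<close> of \<open>Phi P\<close>. The result is known only on \<open>Phi P\<close>, as an
  \<open>M\<close>-th power. That suffices: a nontrivial element of \<open>P\<close> outside
  \<open>Phi P\<close> has a nontrivial p-th power inside, so the kernel \<open>R\<close> misses
  \<open>P\<close>. Then \<open>R\<close> is a normal p'-subgroup, hence trivial, and
  \<open>C\<close> is a p-group.\<close>

lemma rank_one_normal:
  assumes cP1: "card (Phi P) = p ^ (k - 1)" and odd: "p \<noteq> 2"
  shows "P \<lhd> G"
proof -
  obtain a where a: "a \<in> P" "a \<notin> Phi P" using exists_not_Phi by blast
  have ac: "a \<in> carrier G" using a cP by blast
  have gen: "\<exists>i::nat. x = a [^] i" if "x \<in> P" for x
    using rank_one_facts(2)[OF cP1 a] rank_one_cyclic[OF cP1 odd a] that by blast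
  have ab: "x \<otimes> y = y \<otimes> x" if "x \<in> P" "y \<in> P" for x y
    using gen[OF that(1)] gen[OF that(2)] pow_pow_commute[OF ac] by auto
  define C where "C = {g \<in> carrier G. \<forall>z\<in>Phi P. g \<otimes> z \<otimes> inv g = z}"
  note cPhi = subgroup_carrier[OF sPhi]
  have nPhi: "g \<otimes> z \<otimes> inv g \<in> Phi P" "inv g \<otimes> z \<otimes> g \<in> Phi P" if "g \<in> carrier G" "z \<in> Phi P" for g z
    using normal.inv_op_closed2[OF Phi_normal that] normal.inv_op_closed1[OF Phi_normal that] by auto
  have sC: "subgroup C G"
  proof (rule finite_submonoid_subgroup)
    show "C \<subseteq> carrier G" by (auto simp: C_def)
    show "\<one> \<in> C" using cPhi by (auto simp: C_def)
    fix x y assume xy: "x \<in> C" "y \<in> C"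
    have "x \<otimes> y \<otimes> z \<otimes> inv (x \<otimes> y) = z" if z: "z \<in> Phi P" for z
    proof -
      have "x \<otimes> y \<otimes> z \<otimes> inv (x \<otimes> y) = x \<otimes> (y \<otimes> z \<otimes> inv y) \<otimes> inv x"
        using xy cPhi[OF z] by (simp add: C_def inv_mult_group m_assoc)
      thus ?thesis using xy z by (simp add: C_def)
    qed
    thus "x \<otimes> y \<in> C" using xy by (auto simp: C_def)
  qed
  have nC: "C \<lhd> G"
  proof (rule normal_invI[OF sC])
    fix x h assume x: "x \<in> carrier G" and h: "h \<in> C"
    have hc: "h \<in> carrier G" using h by (simp add: C_def)
    have "x \<otimes> h \<otimes> inv x \<otimes> z \<otimes> inv (x \<otimes> h \<otimes> inv x) = z" if z: "z \<in> Phi P" for z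
    proof -
      have "x \<otimes> h \<otimes> inv x \<otimes> z \<otimes> inv (x \<otimes> h \<otimes> inv x) = x \<otimes> (h \<otimes> (inv x \<otimes> z \<otimes> x) \<otimes> inv h) \<otimes> inv x"
        using x hc cPhi[OF z] by (simp add: inv_mult_group m_assoc)
      also have "\<dots> = x \<otimes> (inv x \<otimes> z \<otimes> x) \<otimes> inv x" using h nPhi(2)[OF x z] by (simp add: C_def)
      also have "\<dots> = z" using x cPhi[OF z] by (simp add: m_assoc)
      finally show ?thesis .
    qed
    thus "x \<otimes> h \<otimes> inv x \<in> C" using x hc by (simp add: C_def)
  qed
  have PC: "P \<subseteq> C"
  proof
    fix x assume x: "x \<in> P"
    have "x \<otimes> z \<otimes> inv x = z" if "z \<in> Phi P" for z
      using ab[OF x Phi_subset_P[OF that]] cP[OF x] cPhi[OF that] by (simp add: m_assoc)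
    thus "x \<in> C" using cP x by (simp add: C_def)
  qed
  let ?C = "G\<lparr>carrier := C\<rparr>" and ?P = "G\<lparr>carrier := P\<rparr>"
  interpret C: prime_group ?C p by (rule restrict_group[OF sC])
  have sPC: "subgroup P ?C" using subgroup_incl[OF sP sC PC] .
  have A: "comm_group ?P"
    by (rule group.group_comm_groupI[OF subgroup_imp_group[OF sP]]) (use ab in simp)
  have idh: "(\<lambda>x. x) \<in> hom ?P ?P" by (simp add: hom_def)
  obtain f M where fh: "f \<in> hom ?C ?P" and Mp: "coprime M p"
    and ev: "\<forall>z\<in>P. (\<forall>t\<in>C. t \<otimes> z \<otimes> inv t \<in> P \<and> t \<otimes> z \<otimes> inv t = z) \<longrightarrow> f z = z [^]\<^bsub>?P\<^esub> (M::nat)"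
    using transfer_to_sylow[OF sC PC A idh] by blast
  have f_eval: "f z = z [^] M" if z: "z \<in> Phi P" for z
  proof -
    have "\<forall>t\<in>C. t \<otimes> z \<otimes> inv t = z" using z by (simp add: C_def)
    hence "f z = z [^]\<^bsub>?P\<^esub> M" using ev Phi_subset_P[OF z] by simp
    thus ?thesis by (simp add: nat_pow_consistent[symmetric])
  qed
  define R where "R = kernel ?C ?P f"
  have gP: "group ?P" using subgroup_imp_group[OF sP] .
  have hom: "group_hom ?C ?P f" using fh gP C.is_group by (simp add: group_hom_def group_hom_axioms_def)
  have nR: "R \<lhd> ?C" unfolding R_def by (rule group_hom.normal_kernel[OF hom])
  have sR: "subgroup R G" using incl_subgroup[OF sC normal_imp_subgroup[OF nR]] .
  have Rmem: "x \<in> R \<longleftrightarrow> x \<in> C \<and> f x = \<one>" for x by (auto simp: R_def kernel_def)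
  have RPhi: "z = \<one>" if "z \<in> Phi P" "z \<in> R" for z
  proof -
    have "z [^] M = \<one>" using f_eval that Rmem by simp
    thus ?thesis using p'_element_in_P[OF Phi_subset_P[OF that(1)], of M] Mp by simp
  qed
  have RP: "R \<inter> P = {\<one>}"
  proof -
    have "x = \<one>" if x: "x \<in> R" "x \<in> P" for x
    proof (cases "x \<in> Phi P")
      case True thus ?thesis using RPhi x by blast
    next
      case False
      have "x [^] p = \<one>" using RPhi[OF Phi_power[OF pP x(2)] subgroup_pow[OF sR x(1)]] .
      thus ?thesis using rank_one_facts(4)[OF cP1 x(2) False] by blast
    qed
    thus ?thesis using subgroup.one_closed[OF sR] subgroup.one_closed[OF sP] by blast
  qed
  have RC: "R \<subseteq> C" using Rmem by blast
  interpret S: second_isomorphism_grp R ?C P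
    using nR sPC by (simp add: second_isomorphism_grp_def second_isomorphism_grp_axioms_def)
  have sRP: "subgroup (R <#> P) G" using incl_subgroup[OF sC] S.normal_set_mult_subgroup by simp
  have "R <#> P \<subseteq> C" using subgroup.subset[OF S.normal_set_mult_subgroup] by simp
  hence "card (R <#> P) dvd card C" using subgroup_card_dvd[OF sRP sC] by blast
  moreover have "card (R <#> P) = card R * p ^ n" using card_set_mult[OF sR sP] RP cardP by simp
  moreover obtain m' where m': "card C = p ^ n * m'" and cm': "coprime m' p" by (rule card_over_P[OF sC PC])
  ultimately have "card R * p ^ n dvd m' * p ^ n" by (simp add: mult.commute)
  hence "card R dvd m'" using p0 by simp
  hence copR: "coprime (card R) p" using cm' by (meson coprime_divisors dvd_refl)
  have cc: "card (f ` C) * card R = card C"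
    using C.hom_kernel_card(1)[OF gP fh] by (simp add: R_def order_def)
  have "subgroup (f ` C) ?P" using C.hom_kernel_card(2)[OF gP fh] by simp
  hence "subgroup (f ` C) G" "f ` C \<subseteq> P" using incl_subgroup[OF sP] subgroup.subset by fastforce+
  then obtain i where i: "card (f ` C) = p ^ i" using p_subgroup_subset[OF pP] p_subgroup_def by blast
  have "R \<lhd> G" using p'_normal_lift[OF nC sC subset_refl nR RC copR cc[symmetric, unfolded i]] .
  hence "R = {\<one>}" using core_trivial copR by blast
  hence cardC: "card C = p ^ i" using cc i by simp
  have "C = P"
  proof (rule no_p'_elements[OF sC PC])
    fix y and q :: nat assume y: "y \<in> C" "coprime q p" "y [^] q = \<one>"
    have "y [^] (p ^ i) = \<one>" using pow_card_eq_one[OF sC y(1)] cardC by simp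
    hence "y \<in> {\<one>}"
      using pow_mem_coprime[OF triv_subgroup subgroup_carrier[OF sC y(1)], of q "p ^ i"] y(2,3) by simp
    thus "y = \<one>" by simp
  qed
  thus ?thesis using nC by simp
qed

subsection \<open>Frattini subgroup of order at most p^(k-2)\<close>

text \<open>
  The cosets of \<open>K\<close> form an affine space over \<open>H/\<Phi>\<close> of dimension at least two. Since every
  hyperplane of \<open>H\<close> gives a subgroup containing \<open>K\<close>, the group \<open>G\<close> permutes the lines in each
  direction, so it acts by dilatations. In a group of dilatations the translations form a normal
  subgroup; below \<open>D\<close> is the kernel of the action, \<open>W\<close> the preimage of the translations and
  \<open>\<alpha> \<kappa>\<close> the action of \<open>\<kappa> \<in> K\<close>, which fixes the origin.
\<close>

lemma higher_rank_kernel: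
  assumes small: "p * p * card (Phi P) \<le> p ^ k" and H: "subgroup H G" "card H = p ^ k" "H \<subseteq> P"
  shows "\<exists>D W. D \<lhd> G \<and> W \<lhd> G \<and> P \<subseteq> W \<and> D \<inter> H \<subseteq> Phi P \<and>
    (\<forall>y\<in>W. \<forall>q. coprime q p \<longrightarrow> y [^] (q::nat) = \<one> \<longrightarrow> y \<in> D)"
proof -
  obtain K0 where K0: "subgroup K0 G" "carrier G = H <#> K0"
    "\<And>L. maximal_in L H \<Longrightarrow> subgroup (L <#> K0) G \<and> H \<inter> (L <#> K0) = L \<and>
      order G = p * card (L <#> K0)"
    using supplement[OF H] by blast
  note cH = subgroup_carrier[OF H(1)] and H_mult = subgroup.m_closed[OF H(1)] and H_inv = subgroup.m_inv_closed[OF H(1)]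
  note PhiH = Phi_in_H[OF H]
  \<comment> \<open>Enlarging \<open>K0\<close> to the intersection of all \<open>L <#> K0\<close>
    makes the stabilizer of the origin meet \<open>H\<close> exactly in \<open>Phi P\<close>, so its
    cosets correspond to \<open>H/\<Phi>(P)\<close>.\<close>
  define K where "K = {x \<in> carrier G. \<forall>L. maximal_in L H \<longrightarrow> x \<in> L <#> K0}"
  have sK: "subgroup K G"
  proof (rule finite_submonoid_subgroup)
    show "K \<subseteq> carrier G" by (auto simp: K_def)
    show "\<one> \<in> K" unfolding K_def using K0(3) subgroup.one_closed by blast
    fix x y assume "x \<in> K" "y \<in> K"
    thus "x \<otimes> y \<in> K" unfolding K_def using K0(3) subgroup.m_closed by (smt (verit) m_closed mem_Collect_eq)
  qed
  note cK = subgroup_carrier[OF sK] and K_mult = subgroup.m_closed[OF sK] and K_inv = subgroup.m_inv_closed[OF sK]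
  have "K0 \<subseteq> K"
  proof
    fix x assume x: "x \<in> K0"
    have xc: "x \<in> carrier G" using subgroup_carrier[OF K0(1) x] .
    have "x \<in> L <#> K0" if "maximal_in L H" for L
    proof -
      have "\<one> \<otimes> x \<in> L <#> K0"
        using x subgroup.one_closed[OF maximalD(1)[OF H(1) that]] unfolding set_mult_def by blast
      thus ?thesis using xc by simp
    qed
    thus "x \<in> K" using xc by (simp add: K_def)
  qed
  hence HK: "\<exists>h\<in>H. \<exists>\<kappa>\<in>K. g = h \<otimes> \<kappa>" if "g \<in> carrier G" for g
    using that K0(2) unfolding set_mult_def by blast
  have HIK: "x \<in> Phi P" if "x \<in> H" "x \<in> K" for x
  proof -
    have "x \<in> L" if "maximal_in L H" for L
      using that \<open>x \<in> H\<close> \<open>x \<in> K\<close> K0(3) K_def by blast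
    thus ?thesis using Phi_iff[of x H] \<open>x \<in> H\<close> PhiH(2) by simp
  qed
  have PhiK: "Phi P \<subseteq> K"
  proof
    fix f assume f: "f \<in> Phi P"
    have "f \<in> L <#> K0" if "maximal_in L H" for L
      using index_p_subgroup(3) K0(3)[OF that] f by blast
    thus "f \<in> K" using subgroup_carrier[OF sPhi f] by (simp add: K_def)
  qed
  have HP: "x \<in> P" if "x \<in> H" for x using H(3) that by blast
  have BH: "B h \<subseteq> H" if "h \<in> H" for h using adjoin_sub[OF H(1) PhiH(1) that] .
  \<comment> \<open>\<open>K\<close> preserves each line through the origin: were \<open>a\<close>
    off the line, a hyperplane \<open>L\<close> through \<open>h\<close> missing \<open>a\<close>
    would give a subgroup \<open>L <#> K0\<close> containing \<open>\<kappa>\<close>,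
    \<open>h\<close> and \<open>\<kappa>'\<close>, hence \<open>a\<close>.\<close>
  have line: "\<exists>a\<in>B h. \<exists>\<kappa>'\<in>K. \<kappa> \<otimes> h = a \<otimes> \<kappa>'" if \<kappa>: "\<kappa> \<in> K" and h: "h \<in> H" for \<kappa> h
  proof -
    have c: "\<kappa> \<otimes> h \<in> carrier G" using \<kappa> h cK cH by simp
    obtain a \<kappa>' where a: "a \<in> H" "\<kappa>' \<in> K" "\<kappa> \<otimes> h = a \<otimes> \<kappa>'" using HK[OF c] by blast
    have ae: "a = \<kappa> \<otimes> h \<otimes> inv \<kappa>'" using a cH cK by (simp add: m_assoc)
    have "a \<in> B h"
    proof (rule ccontr)
      assume n: "a \<notin> B h"
      note Bh = B[OF HP[OF h]]
      obtain L where L: "maximal_in L H" "B h \<subseteq> L" "a \<notin> L"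
        using avoid_hyperplane[OF H(1,3) Bh(1) BH[OF h] Bh(3) a(1) n] by blast
      let ?M = "L <#> K0"
      have M: "subgroup ?M G" "H \<inter> ?M = L" using K0(3)[OF L(1)] by auto
      have "\<kappa> \<in> ?M" "\<kappa>' \<in> ?M" "h \<in> ?M" using \<kappa> a(2) L(1,2) Bh(4) M(2) by (auto simp: K_def)
      hence "a \<in> ?M" unfolding ae using subgroup.m_closed[OF M(1)] subgroup.m_inv_closed[OF M(1)] by blast
      thus False using M(2) a(1) L(3) by blast
    qed
    thus ?thesis using a by blast
  qed
  interpret V: comm_group V by (rule V_comm_group)
  have vV: "v x \<in> carrier V" if "x \<in> H" for x using v_in_V HP that by blast
  have uniq: "v a = v b" if "a \<in> H" "b \<in> H" "\<kappa>1 \<in> K" "\<kappa>2 \<in> K" "a \<otimes> \<kappa>1 = b \<otimes> \<kappa>2" for a b \<kappa>1 \<kappa>2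
  proof -
    have c: "a \<in> carrier G" "b \<in> carrier G" "\<kappa>1 \<in> carrier G" "\<kappa>2 \<in> carrier G" using that cH cK by auto
    have "inv b \<otimes> a \<otimes> \<kappa>1 = \<kappa>2" using that(5) c by (simp add: m_assoc)
    hence "inv b \<otimes> a = \<kappa>2 \<otimes> inv \<kappa>1" using c by (simp add: inv_solve_right)
    hence "inv b \<otimes> a \<in> Phi P" using HIK that H_mult H_inv K_mult K_inv by metis
    hence "b \<otimes> (inv b \<otimes> a) \<otimes> inv b \<in> Phi P" using Phi_conj_P(1)[OF HP[OF that(2)]] by blast
    thus ?thesis using v_eq_iff HP that c by simp
  qed
  define \<alpha> where "\<alpha> \<kappa> h = v (SOME a. a \<in> B h \<and> (\<exists>\<kappa>'\<in>K. \<kappa> \<otimes> h = a \<otimes> \<kappa>'))" for \<kappa> h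
  have \<alpha>: "\<alpha> \<kappa> h = v a" if hyp: "\<kappa> \<in> K" "h \<in> H" "a \<in> H" "\<kappa>' \<in> K" "\<kappa> \<otimes> h = a \<otimes> \<kappa>'" for \<kappa> h a \<kappa>'
  proof -
    define b where "b = (SOME a. a \<in> B h \<and> (\<exists>\<kappa>'\<in>K. \<kappa> \<otimes> h = a \<otimes> \<kappa>'))"
    have "b \<in> B h \<and> (\<exists>\<kappa>'\<in>K. \<kappa> \<otimes> h = b \<otimes> \<kappa>')"
      unfolding b_def by (rule someI_ex) (use line[OF that(1,2)] in blast)
    then obtain \<kappa>2 where "b \<in> H" "\<kappa>2 \<in> K" "\<kappa> \<otimes> h = b \<otimes> \<kappa>2" using BH[OF hyp(2)] by blast
    hence "v b = v a" using uniq[of b a \<kappa>2 \<kappa>'] hyp by metis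
    thus ?thesis by (simp add: \<alpha>_def b_def)
  qed
  have \<alpha>V: "\<alpha> \<kappa> h \<in> carrier V" if hyp: "\<kappa> \<in> K" "h \<in> H" for \<kappa> h
  proof -
    obtain a \<kappa>' where "a \<in> B h" "\<kappa>' \<in> K" "\<kappa> \<otimes> h = a \<otimes> \<kappa>'" using line[OF hyp] by blast
    thus ?thesis using \<alpha>[OF hyp] BH[OF hyp(2)] vV by (metis subsetD)
  qed
  \<comment> \<open>As \<open>h\<close> and \<open>u\<close> commute modulo \<open>Phi P\<close>,
    the image of \<open>h \<otimes> u\<close> under \<open>\<kappa>\<close> can be computed in two
    orders. Comparison equates an element of the line of \<open>h\<close> with one of the line of
    \<open>u\<close>, and these lines meet only in zero.\<close>
  have indep: "\<alpha> \<kappa>' u = \<alpha> \<kappa> u \<and> \<alpha> \<kappa> (h \<otimes> u) = \<alpha> \<kappa> h \<otimes>\<^bsub>V\<^esub> \<alpha> \<kappa> u"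
    if \<kappa>: "\<kappa> \<in> K" and h: "h \<in> H" and u: "u \<in> H" "u \<notin> B h"
      and a: "a \<in> B h" "\<kappa>' \<in> K" "\<kappa> \<otimes> h = a \<otimes> \<kappa>'" for \<kappa> h u a \<kappa>'
  proof -
    note Bh = B[OF HP[OF h]] and Bu = B[OF HP[OF u(1)]]
    obtain b \<kappa>2 where b: "b \<in> B u" "\<kappa>2 \<in> K" "\<kappa> \<otimes> u = b \<otimes> \<kappa>2" using line[OF \<kappa> u(1)] by blast
    obtain b' \<kappa>3 where b': "b' \<in> B u" "\<kappa>3 \<in> K" "\<kappa>' \<otimes> u = b' \<otimes> \<kappa>3" using line[OF a(2) u(1)] by blast
    obtain a' \<kappa>4 where a': "a' \<in> B h" "\<kappa>4 \<in> K" "\<kappa>2 \<otimes> h = a' \<otimes> \<kappa>4" using line[OF b(2) h] by blast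
    have inH: "a \<in> H" "a' \<in> H" "b \<in> H" "b' \<in> H" using a a' b b' BH[OF h] BH[OF u(1)] by auto
    note c = cK[OF \<kappa>] cH[OF h] cH[OF u(1)] inH[THEN cH] cK[OF a(2)] cK[OF b(2)] cK[OF b'(2)] cK[OF a'(2)]
    have hu: "h \<otimes> u \<in> H" "u \<otimes> h \<in> H" using h u H_mult by auto
    have e1: "\<kappa> \<otimes> (h \<otimes> u) = (a \<otimes> b') \<otimes> \<kappa>3"
    proof -
      have "\<kappa> \<otimes> (h \<otimes> u) = (\<kappa> \<otimes> h) \<otimes> u" using c by (simp add: m_assoc)
      also have "\<dots> = a \<otimes> (\<kappa>' \<otimes> u)" unfolding a(3) using c by (simp add: m_assoc)
      finally show ?thesis unfolding b'(3) using c by (simp add: m_assoc)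
    qed
    have e2: "\<kappa> \<otimes> (u \<otimes> h) = (b \<otimes> a') \<otimes> \<kappa>4"
    proof -
      have "\<kappa> \<otimes> (u \<otimes> h) = (\<kappa> \<otimes> u) \<otimes> h" using c by (simp add: m_assoc)
      also have "\<dots> = b \<otimes> (\<kappa>2 \<otimes> h)" unfolding b(3) using c by (simp add: m_assoc)
      finally show ?thesis unfolding a'(3) using c by (simp add: m_assoc)
    qed
    define \<phi> where "\<phi> = inv (h \<otimes> u) \<otimes> (u \<otimes> h)"
    have "v (u \<otimes> h) = v (h \<otimes> u)" using v_mult V.m_comm vV HP h u by simp
    hence "u \<otimes> h \<otimes> inv (h \<otimes> u) \<in> Phi P" using v_eq_iff HP hu by simp
    hence "inv (h \<otimes> u) \<otimes> (u \<otimes> h \<otimes> inv (h \<otimes> u)) \<otimes> (h \<otimes> u) \<in> Phi P"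
      using Phi_conj_P(2)[OF HP[OF hu(1)]] by blast
    hence \<phi>: "\<phi> \<in> K" using PhiK c by (auto simp: \<phi>_def m_assoc)
    have "\<kappa> \<otimes> (u \<otimes> h) = \<kappa> \<otimes> (h \<otimes> u) \<otimes> \<phi>" using c by (simp add: \<phi>_def m_assoc inv_mult_group)
    hence "(b \<otimes> a') \<otimes> \<kappa>4 = (a \<otimes> b') \<otimes> (\<kappa>3 \<otimes> \<phi>)" unfolding e1 e2 using c cK[OF \<phi>] by (simp add: m_assoc)
    hence "v (b \<otimes> a') = v (a \<otimes> b')"
      using uniq inH H_mult a'(2) b'(2) \<phi> K_mult by (metis (no_types, lifting))
    hence ve: "v b \<otimes>\<^bsub>V\<^esub> v a' = v a \<otimes>\<^bsub>V\<^esub> v b'" using v_mult HP inH by simp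
    let ?x = "inv a \<otimes> a'" and ?y = "b' \<otimes> inv b"
    have xB: "?x \<in> B h" using a a' subgroup.m_closed[OF Bh(1)] subgroup.m_inv_closed[OF Bh(1)] by blast
    have yB: "?y \<in> B u" using b b' subgroup.m_closed[OF Bu(1)] subgroup.m_inv_closed[OF Bu(1)] by blast
    have xy: "?x \<in> P" "?y \<in> P" using xB yB Bh(2) Bu(2) by auto
    have va: "v a \<otimes>\<^bsub>V\<^esub> v ?x = v a'" using v_mult[of a ?x] HP inH xy c by simp
    have vb: "v ?y \<otimes>\<^bsub>V\<^esub> v b = v b'" using v_mult[of ?y b] HP inH xy c by (simp add: m_assoc)
    have mem: "v a \<in> carrier V" "v b \<in> carrier V" "v ?x \<in> carrier V" "v ?y \<in> carrier V"
      using vV inH v_in_V xy by auto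
    have "(v a \<otimes>\<^bsub>V\<^esub> v b) \<otimes>\<^bsub>V\<^esub> v ?x = (v a \<otimes>\<^bsub>V\<^esub> v b) \<otimes>\<^bsub>V\<^esub> v ?y"
      using ve mem unfolding va[symmetric] vb[symmetric] by (simp add: V.m_ac)
    hence vxy: "v ?x = v ?y" using mem by simp
    hence "?x \<otimes> inv ?y \<in> Phi P" using v_eq_iff xy by simp
    hence "inv (?x \<otimes> inv ?y) \<otimes> ?x \<in> B h"
      using xB Bh(3) subgroup.m_closed[OF Bh(1)] subgroup.m_inv_closed[OF Bh(1)] by blast
    hence "?y \<in> B h" using cP[OF xy(1)] cP[OF xy(2)] by (simp add: inv_mult_group m_assoc)
    hence "?y \<in> Phi P" using B_trivial_Int[OF HP[OF u(1)] HP[OF h] u(2) _ yB] by blast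
    hence vbb: "v b' = v b" using v_eq_iff HP inH by simp
    have "\<alpha> \<kappa>' u = v b'" using \<alpha>[OF a(2) u(1) inH(4) b'(2,3)] .
    moreover have "\<alpha> \<kappa> u = v b" using \<alpha>[OF \<kappa> u(1) inH(3) b(2,3)] .
    moreover have "\<alpha> \<kappa> h = v a" using \<alpha>[OF \<kappa> h inH(1) a(2,3)] .
    moreover have "\<alpha> \<kappa> (h \<otimes> u) = v (a \<otimes> b')" using \<alpha>[OF \<kappa> hu(1) H_mult[OF inH(1,4)] b'(2) e1] .
    ultimately show ?thesis using vbb v_mult HP inH by simp
  qed
  \<comment> \<open>This uses dimension at least two: one line does not exhaust
    \<open>H\<close>.\<close>
  have outside: "\<exists>w\<in>H. w \<notin> B h" if h: "h \<in> H" for h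
  proof -
    have pc: "card (Phi P) > 0" using subgroup_card_pos[OF sPhi] .
    have "p * card (Phi P) < p * p * card (Phi P)" using pc p1 by simp
    hence "card (B h) < card H" using B(5)[OF HP[OF h]] small H(2) by linarith
    thus ?thesis using BH[OF h] by (metis less_irrefl subsetI subset_antisym)
  qed
  have \<alpha>Phi: "\<alpha> \<kappa> u = \<one>\<^bsub>V\<^esub>" if \<kappa>: "\<kappa> \<in> K" and u: "u \<in> Phi P" for \<kappa> u
  proof -
    have uc: "u \<in> carrier G" "\<kappa> \<in> carrier G" using subgroup_carrier[OF sPhi u] cK[OF \<kappa>] .
    have m: "\<kappa> \<otimes> u \<otimes> inv \<kappa> \<in> Phi P" using normal.inv_op_closed2[OF Phi_normal uc(2) u] .
    have "\<kappa> \<otimes> u = (\<kappa> \<otimes> u \<otimes> inv \<kappa>) \<otimes> \<kappa>" using uc by (simp add: m_assoc)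
    hence "\<alpha> \<kappa> u = v (\<kappa> \<otimes> u \<otimes> inv \<kappa>)" using \<alpha>[OF \<kappa> _ _ \<kappa>] u m PhiH(1) by blast
    thus ?thesis using m v_one_iff Phi_subset_P by simp
  qed
  \<comment> \<open>For \<open>u\<close> on the line of \<open>h\<close>, an auxiliary
    \<open>w\<close> off the line helps: \<open>indep\<close> covers both \<open>w\<close> and
    \<open>u \<otimes> w\<close>, and additivity then gives \<open>u\<close>.\<close>
  have all: "\<alpha> \<kappa>' u = \<alpha> \<kappa> u"
    if \<kappa>: "\<kappa> \<in> K" and h: "h \<in> H" and a: "a \<in> B h" "\<kappa>' \<in> K" "\<kappa> \<otimes> h = a \<otimes> \<kappa>'" and u: "u \<in> H" for \<kappa> h a \<kappa>' u
  proof (cases "u \<in> B h")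
    case False thus ?thesis using indep[OF \<kappa> h u _ a] by blast
  next
    case True
    note Bh = B[OF HP[OF h]]
    obtain w where w: "w \<in> H" "w \<notin> B h" using outside[OF h] by blast
    show ?thesis
    proof (cases "u \<in> Phi P")
      case True thus ?thesis using \<alpha>Phi \<kappa> a(2) by simp
    next
      case False
      have uw: "u \<otimes> w \<in> H" "u \<otimes> w \<notin> B h"
      proof -
        show "u \<otimes> w \<in> H" using u w H_mult by blast
        show "u \<otimes> w \<notin> B h"
        proof
          assume "u \<otimes> w \<in> B h"
          hence "inv u \<otimes> (u \<otimes> w) \<in> B h"
            using True subgroup.m_closed[OF Bh(1)] subgroup.m_inv_closed[OF Bh(1)] by blast
          thus False using w cH u by simp
        qed
      qed
      have wB: "w \<notin> B u" using w adjoin_sub[OF Bh(1,3) True] by blast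
      obtain a1 k1 where k1: "a1 \<in> B u" "k1 \<in> K" "\<kappa> \<otimes> u = a1 \<otimes> k1" using line[OF \<kappa> u] by blast
      obtain a2 k2 where k2: "a2 \<in> B u" "k2 \<in> K" "\<kappa>' \<otimes> u = a2 \<otimes> k2" using line[OF a(2) u] by blast
      have "\<alpha> \<kappa> (u \<otimes> w) = \<alpha> \<kappa> u \<otimes>\<^bsub>V\<^esub> \<alpha> \<kappa> w" using indep[OF \<kappa> u w(1) wB k1] by blast
      moreover have "\<alpha> \<kappa>' (u \<otimes> w) = \<alpha> \<kappa>' u \<otimes>\<^bsub>V\<^esub> \<alpha> \<kappa>' w" using indep[OF a(2) u w(1) wB k2] by blast
      moreover have "\<alpha> \<kappa>' w = \<alpha> \<kappa> w" "\<alpha> \<kappa>' (u \<otimes> w) = \<alpha> \<kappa> (u \<otimes> w)"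
        using indep[OF \<kappa> h w a] indep[OF \<kappa> h uw a] by blast+
      ultimately show ?thesis using \<alpha>V \<kappa> a(2) u w(1) by simp
    qed
  qed

  define D where "D = {x \<in> carrier G. \<forall>g\<in>carrier G. inv g \<otimes> x \<otimes> g \<in> K}"
  have nD: "D \<lhd> G" unfolding D_def by (rule core_normal[OF sK])
  note sD = normal_imp_subgroup[OF nD]
  note cD = subgroup_carrier[OF sD]
  have DK: "D \<subseteq> K"
  proof
    fix x assume x: "x \<in> D"
    hence "inv \<one> \<otimes> x \<otimes> \<one> \<in> K" unfolding D_def by blast
    thus "x \<in> K" using cD[OF x] by simp
  qed
  have inD: "\<kappa> \<in> D" if \<kappa>: "\<kappa> \<in> K" and tr: "\<And>u. u \<in> H \<Longrightarrow> \<alpha> \<kappa> u = v u" for \<kappa>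
  proof -
    have "inv g \<otimes> \<kappa> \<otimes> g \<in> K" if g: "g \<in> carrier G" for g
    proof -
      obtain u \<kappa>1 where u: "u \<in> H" "\<kappa>1 \<in> K" "g = u \<otimes> \<kappa>1" using HK[OF g] by blast
      obtain a \<kappa>2 where a: "a \<in> B u" "\<kappa>2 \<in> K" "\<kappa> \<otimes> u = a \<otimes> \<kappa>2" using line[OF \<kappa> u(1)] by blast
      have aH: "a \<in> H" using a(1) BH[OF u(1)] by blast
      have "v a = v u" using \<alpha>[OF \<kappa> u(1) aH a(2,3)] tr[OF u(1)] by simp
      hence "a \<otimes> inv u \<in> Phi P" using v_eq_iff HP aH u(1) by simp
      hence "inv u \<otimes> (a \<otimes> inv u) \<otimes> u \<in> Phi P" using Phi_conj_P(2)[OF HP[OF u(1)]] by blast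
      moreover have c: "a \<in> carrier G" "u \<in> carrier G" "\<kappa> \<in> carrier G" "\<kappa>1 \<in> carrier G" "\<kappa>2 \<in> carrier G"
        using cH cK aH u a \<kappa> by auto
      ultimately have 1: "inv u \<otimes> a \<in> K" using PhiK by (auto simp: m_assoc)
      have "inv g \<otimes> \<kappa> \<otimes> g = inv \<kappa>1 \<otimes> (inv u \<otimes> (\<kappa> \<otimes> u)) \<otimes> \<kappa>1"
        using u c by (simp add: inv_mult_group m_assoc)
      also have "\<dots> = inv \<kappa>1 \<otimes> ((inv u \<otimes> a) \<otimes> \<kappa>2) \<otimes> \<kappa>1" unfolding a(3) using c by (simp add: m_assoc)
      finally show ?thesis using K_mult[OF K_mult[OF K_inv[OF u(2)] K_mult[OF 1 a(2)]] u(2)] by simp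
    qed
    thus ?thesis using cK[OF \<kappa>] by (simp add: D_def)
  qed
  define W where "W = D <#> H"
  interpret S: second_isomorphism_grp D G H
    using nD H(1) by (simp add: second_isomorphism_grp_def second_isomorphism_grp_axioms_def)
  have sW: "subgroup W G" unfolding W_def by (rule S.normal_set_mult_subgroup)
  have DW: "D \<subseteq> W" "H \<subseteq> W" unfolding W_def by (rule S.H_contained_in_set_mult S.S_contained_in_set_mult)+
  note W_mult = subgroup.m_closed[OF sW] and W_inv = subgroup.m_inv_closed[OF sW]
  have conjH: "\<kappa> \<otimes> h \<otimes> inv \<kappa> \<in> W" if \<kappa>: "\<kappa> \<in> K" and h: "h \<in> H" for \<kappa> h
  proof -
    obtain a \<kappa>' where a: "a \<in> B h" "\<kappa>' \<in> K" "\<kappa> \<otimes> h = a \<otimes> \<kappa>'" using line[OF \<kappa> h] by blast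
    have aH: "a \<in> H" using a(1) BH[OF h] by blast
    have c: "\<kappa> \<in> carrier G" "\<kappa>' \<in> carrier G" "a \<in> carrier G" using \<kappa> a aH cK cH by auto
    \<comment> \<open>By \<open>all\<close>, the factor \<open>\<kappa>'\<close> left after moving
      \<open>h\<close> acts as \<open>\<kappa>\<close> does. So conjugating the translation
      \<open>h\<close> by \<open>\<kappa>\<close> gives the translation \<open>a\<close> up to an
      element of \<open>D\<close>.\<close>
    have "\<kappa>' \<otimes> inv \<kappa> \<in> D"
    proof (rule inD)
      show m: "\<kappa>' \<otimes> inv \<kappa> \<in> K" using K_mult[OF a(2) K_inv[OF \<kappa>]] .
      fix u assume u: "u \<in> H"
      obtain b \<kappa>2 where b: "b \<in> B u" "\<kappa>2 \<in> K" "inv \<kappa> \<otimes> u = b \<otimes> \<kappa>2" using line[OF K_inv[OF \<kappa>] u] by blast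
      have bH: "b \<in> H" using b(1) BH[OF u] by blast
      have c2: "b \<in> carrier G" "\<kappa>2 \<in> carrier G" "u \<in> carrier G" using bH b cH cK u by auto
      have "\<kappa> \<otimes> b = \<kappa> \<otimes> (b \<otimes> \<kappa>2) \<otimes> inv \<kappa>2" using c c2 by (simp add: m_assoc)
      also have "\<dots> = u \<otimes> inv \<kappa>2" unfolding b(3)[symmetric] using c c2 by (simp add: m_assoc)
      finally have "\<alpha> \<kappa> b = v u" using \<alpha>[OF \<kappa> bH u K_inv[OF b(2)]] by blast
      moreover have "\<alpha> \<kappa>' b = \<alpha> \<kappa> b" using all[OF \<kappa> h a bH] .
      moreover obtain d \<kappa>5 where d: "d \<in> B b" "\<kappa>5 \<in> K" "\<kappa>' \<otimes> b = d \<otimes> \<kappa>5" using line[OF a(2) bH] by blast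
      moreover have dH: "d \<in> H" using d(1) BH[OF bH] by blast
      ultimately have vd: "v d = v u" using \<alpha>[OF a(2) bH dH d(2,3)] by simp
      have "\<kappa>' \<otimes> inv \<kappa> \<otimes> u = \<kappa>' \<otimes> b \<otimes> \<kappa>2" using b(3) c c2 by (simp add: m_assoc)
      also have "\<dots> = d \<otimes> (\<kappa>5 \<otimes> \<kappa>2)" unfolding d(3) using cH[OF dH] cK[OF d(2)] c2 by (simp add: m_assoc)
      finally show "\<alpha> (\<kappa>' \<otimes> inv \<kappa>) u = v u" using \<alpha>[OF m u dH K_mult[OF d(2) b(2)]] vd by simp
    qed
    moreover have "\<kappa> \<otimes> h \<otimes> inv \<kappa> = a \<otimes> (\<kappa>' \<otimes> inv \<kappa>)" unfolding a(3) using c by (simp add: m_assoc)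
    ultimately show ?thesis using W_mult aH DW by auto
  qed
  have nW: "W \<lhd> G"
  proof (rule normal_invI[OF sW])
    fix g y assume g: "g \<in> carrier G" and y: "y \<in> W"
    obtain h \<kappa> where hk: "h \<in> H" "\<kappa> \<in> K" "g = h \<otimes> \<kappa>" using HK[OF g] by blast
    obtain d h1 where dh: "d \<in> D" "h1 \<in> H" "y = d \<otimes> h1" using y by (auto simp: W_def set_mult_def)
    have c: "h \<in> carrier G" "\<kappa> \<in> carrier G" "d \<in> carrier G" "h1 \<in> carrier G" using hk dh cH cK cD by auto
    have "g \<otimes> y \<otimes> inv g = (g \<otimes> d \<otimes> inv g) \<otimes> (h \<otimes> (\<kappa> \<otimes> h1 \<otimes> inv \<kappa>) \<otimes> inv h)"
      using c hk dh by (simp add: inv_mult_group m_assoc)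
    moreover have "g \<otimes> d \<otimes> inv g \<in> W" using normal.inv_op_closed2[OF nD g dh(1)] DW by blast
    moreover have "h \<otimes> (\<kappa> \<otimes> h1 \<otimes> inv \<kappa>) \<otimes> inv h \<in> W"
      using W_mult[OF W_mult[OF _ conjH[OF hk(2) dh(2)]] W_inv] hk(1) DW(2) by blast
    ultimately show "g \<otimes> y \<otimes> inv g \<in> W" using W_mult by simp
  qed
  have PW: "P \<subseteq> W"
  proof
    fix y assume y: "y \<in> P"
    obtain h \<kappa> where hk: "h \<in> H" "\<kappa> \<in> K" "y = h \<otimes> \<kappa>" using HK[OF cP[OF y]] by blast
    have c: "h \<in> carrier G" "\<kappa> \<in> carrier G" using hk cH cK by auto
    have "\<kappa> = inv h \<otimes> y" using hk c by simp
    hence \<kappa>P: "\<kappa> \<in> P" using P_mult P_inv HP hk(1) y by blast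
    have "\<kappa> \<in> D"
    proof (rule inD[OF hk(2)])
      fix u assume u: "u \<in> H"
      obtain f where f: "f \<in> Phi P" "\<kappa> \<otimes> u = f \<otimes> (u \<otimes> \<kappa>)" using Phi_mod_comm[OF \<kappa>P HP[OF u]] by blast
      have fH: "f \<in> H" "f \<in> P" using f(1) PhiH(1) HP by auto
      have "\<kappa> \<otimes> u = (f \<otimes> u) \<otimes> \<kappa>" using f(2) cH[OF fH(1)] cH[OF u] c by (simp add: m_assoc)
      hence "\<alpha> \<kappa> u = v (f \<otimes> u)" using \<alpha>[OF hk(2) u H_mult[OF fH(1) u] hk(2)] by blast
      also have "\<dots> = v u" using v_mult[OF fH(2) HP[OF u]] v_one_iff[OF fH(2)] f(1) vV[OF u] by simp
      finally show "\<alpha> \<kappa> u = v u" .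
    qed
    thus "y \<in> W" unfolding hk(3) using W_mult hk(1) DW by blast
  qed
  have "D \<inter> H \<subseteq> Phi P" using HIK DK by blast
  \<comment> \<open>\<open>W/D\<close> is a p-group, being a quotient of \<open>H\<close>, so
    p'-elements of \<open>W\<close> lie in \<open>D\<close>.\<close>
  moreover have "y \<in> D" if y: "y \<in> W" "coprime q p" "y [^] (q::nat) = \<one>" for y q
  proof -
    have I: "subgroup (D \<inter> H) G" using sD H(1) subgroups_Inter_pair by blast
    obtain i j where ij: "card (D \<inter> H) = p ^ i" "p ^ k = p ^ i * j"
      using p_subgroup_subset[OF pP I] H(3) subgroup_card_dvd[OF I H(1)] H(2) unfolding p_subgroup_def
      by (metis dvdE inf.coboundedI2 inf_le2)
    have "j dvd p ^ k" using ij(2) by simp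
    then obtain l where l: "j = p ^ l" using prime_p divides_primepow_nat by blast
    have "card W * p ^ i = p ^ l * card D * p ^ i"
      using card_set_mult[OF sD H(1)] ij l H(2) by (simp add: W_def ac_simps)
    hence cW: "card W = p ^ l * card D" using p0 by simp
    have "D \<lhd> G\<lparr>carrier := W\<rparr>" using normal_restrict_supergroup[OF sW nD DW(1)] .
    hence "y [^] (p ^ l) \<in> D" using pow_index_mem[OF sW _ cW y(1)] by blast
    thus ?thesis
      using pow_mem_coprime[OF sD subgroup_carrier[OF sW y(1)], of q "p ^ l"] y(2,3) subgroup.one_closed[OF sD]
      by simp
  qed
  ultimately show ?thesis using nD nW PW by blast
qed

text \<open>\<open>D\<close> and \<open>W\<close> depend on \<open>H\<close>, and \<open>D\<close>
  is controlled only on that \<open>H\<close>. The intersections \<open>Y\<close> and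
  \<open>N\<close> remove this dependence: \<open>Y\<close> lies in every \<open>W\<close>, so
  \<open>N\<close> lies in every \<open>D\<close>, and varying \<open>H\<close> gives
  \<open>P \<inter> N \<subseteq> Phi P\<close>. Tate's theorem puts \<open>N\<close>, which holds
  all p'-elements of \<open>Y\<close>, into \<open>P\<close>; so these are trivial.\<close>

lemma higher_rank_normal:
  assumes small: "p * p * card (Phi P) \<le> p ^ k"
  shows "P \<lhd> G"
proof -
  define Y where "Y = \<Inter>{W. W \<lhd> G \<and> P \<subseteq> W}"
  define N where "N = \<Inter>{D. D \<lhd> G \<and> (\<forall>y\<in>Y. \<forall>q. coprime q p \<longrightarrow> y [^] (q::nat) = \<one> \<longrightarrow> y \<in> D)}"
  have car: "carrier G \<lhd> G" by (rule normal_self)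
  have nY: "Y \<lhd> G" unfolding Y_def using car subgroup.subset[OF sP] by (intro normal_Inter) auto
  have PY: "P \<subseteq> Y" by (auto simp: Y_def)
  note sY = normal_imp_subgroup[OF nY]
  have nN: "N \<lhd> G" unfolding N_def using car subgroup_carrier[OF sY] by (intro normal_Inter) auto
  have "P \<inter> N \<subseteq> Phi P"
  proof (rule subsetI, rule ccontr)
    fix y assume y: "y \<in> P \<inter> N" "y \<notin> Phi P"
    have yP: "y \<in> P" using y by blast
    note By = B[OF yP]
    have "card (Phi P) \<le> p * card (Phi P)" using p1 by simp
    hence "card (B y) \<le> p ^ k" using By(5) small p1 by (meson le_trans mult_le_mono1 nat_less_le le_square)
    then obtain H where H: "subgroup H G" "card H = p ^ k" "H \<subseteq> P" "B y \<subseteq> H" using exists_H[OF By(1,2)] by blast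
    obtain D W where D: "D \<lhd> G" "W \<lhd> G" "P \<subseteq> W" "D \<inter> H \<subseteq> Phi P"
      "\<forall>y\<in>W. \<forall>q. coprime q p \<longrightarrow> y [^] (q::nat) = \<one> \<longrightarrow> y \<in> D"
      using higher_rank_kernel[OF small H(1-3)] by auto
    have "Y \<subseteq> W" using D(2,3) by (auto simp: Y_def)
    hence "N \<subseteq> D" unfolding N_def using D(1,5) by blast
    thus False using y D(4) H(4) By(4) by blast
  qed
  hence NP: "N \<subseteq> P" using tate_normal[OF nN] by blast
  have "Y = P"
  proof (rule no_p'_elements[OF sY PY])
    fix y and q :: nat assume y: "y \<in> Y" "coprime q p" "y [^] q = \<one>"
    hence "y \<in> N" unfolding N_def by blast
    thus "y = \<one>" using p'_element_in_P NP y by blast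
  qed
  thus ?thesis using nY by simp
qed

text \<open>Otherwise the plane spanned by \<open>w\<close> and its conjugate has a preimage that
  fits into some \<open>H\<close>, and a subgroup \<open>M\<close> of index \<open>p\<close>
  contains \<open>w\<close> but not the conjugate. Yet \<open>g\<close> is a product of some
  \<open>x\<close> in \<open>P\<close> and \<open>y\<close> in \<open>M\<close>: conjugation by
  \<open>y\<close> preserves \<open>M\<close>, and conjugation by \<open>x\<close> changes elements
  of \<open>P\<close> only by factors in \<open>Phi P\<close>, which lies in
  \<open>M\<close>.\<close>

lemma higher_rank_lines:
  assumes small: "p * p * card (Phi P) \<le> p ^ k" and nP: "P \<lhd> G" and w: "w \<in> P" and g: "g \<in> carrier G"
  shows "g \<otimes> w \<otimes> inv g \<in> B w"
proof (rule ccontr)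
  let ?z = "g \<otimes> w \<otimes> inv g"
  assume n: "?z \<notin> B w"
  note Bw = B[OF w]
  have z: "?z \<in> P" using normal.inv_op_closed2[OF nP g w] .
  note Bz = adjoin_Phi[OF Bw(1-3) z]
  have "card (adjoin (B w) ?z) \<le> p * (p * card (Phi P))" using Bz(5) Bw(5) by (meson le_trans mult_le_mono2)
  hence "card (adjoin (B w) ?z) \<le> p ^ k" using small by (simp add: mult.assoc)
  then obtain H where H: "subgroup H G" "card H = p ^ k" "H \<subseteq> P" "adjoin (B w) ?z \<subseteq> H"
    using exists_H[OF Bz(1,2)] by blast
  obtain L where L: "maximal_in L H" "B w \<subseteq> L" "?z \<notin> L"
    using avoid_hyperplane[OF H(1,3) Bw(1) _ Bw(3) _ n] Bz(3,4) H(4) by blast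
  obtain M where M: "subgroup M G" "order G = p * card M" "H \<inter> M = L"
    by (rule hyperplane[OF H(1-3) L(1)])
  have wM: "w \<in> M" using L(2) Bw(4) M(3) by blast
  obtain x y where xy: "x \<in> P" "y \<in> M" "g = x \<otimes> y"
    using g index_p_subgroup(1)[OF M(1,2)] by (auto simp: set_mult_def)
  have c: "x \<in> carrier G" "y \<in> carrier G" "w \<in> carrier G" using xy w cP subgroup_carrier[OF M(1)] by auto
  let ?w = "y \<otimes> w \<otimes> inv y"
  have w1: "?w \<in> P" "?w \<in> M"
    using normal.inv_op_closed2[OF nP c(2) w] xy(2) wM subgroup.m_closed[OF M(1)] subgroup.m_inv_closed[OF M(1)]
    by auto
  have "?z = (x \<otimes> ?w \<otimes> inv x \<otimes> inv ?w) \<otimes> ?w" using xy c by (simp add: inv_mult_group m_assoc)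
  moreover have "x \<otimes> ?w \<otimes> inv x \<otimes> inv ?w \<in> M"
    using Phi_commutator[OF pP xy(1) w1(1)] index_p_subgroup(3)[OF M(1,2)] by blast
  ultimately have "?z \<in> M" using subgroup.m_closed[OF M(1) _ w1(2)] by metis
  thus False using L(3) M(3) Bz(4) H(4) by blast
qed

text \<open>The common outcome of the three cases. Invariance of lines is a form of the scalar
  action that holds trivially when \<open>P\<close> is cyclic: the line of any \<open>w\<close>
  outside \<open>Phi P\<close> is then \<open>P\<close>.\<close>

lemma normal_and_lines: "P \<lhd> G" "w \<in> P \<Longrightarrow> g \<in> carrier G \<Longrightarrow> g \<otimes> w \<otimes> inv g \<in> B w"
proof -
  have triv: "g \<otimes> w \<otimes> inv g \<in> B w" if "w \<in> Phi P" "g \<in> carrier G" for w g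
    using normal.inv_op_closed2[OF Phi_normal that(2,1)] B(3)[OF Phi_subset_P[OF that(1)]] by blast
  obtain f where f: "card (Phi P) = p ^ f" using p_subgroup_subset[OF pP sPhi Phi_subset] p_subgroup_def by blast
  have fk: "f \<le> k - 1" using card_Phi f p1 by simp
  consider "p = 2" | "p \<noteq> 2" "f = k - 1" | "f < k - 1" using fk by linarith
  hence "P \<lhd> G \<and> (\<forall>w\<in>P. \<forall>g\<in>carrier G. g \<otimes> w \<otimes> inv g \<in> B w)"
  proof cases
    case 1
    have cG: "carrier G = P" by (rule two_group[OF 1])
    have "g \<otimes> w \<otimes> inv g \<in> B w" if w: "w \<in> P" and g: "g \<in> carrier G" for w g
    proof -
      have "g \<otimes> w \<otimes> inv g = (g \<otimes> w \<otimes> inv g \<otimes> inv w) \<otimes> w" using g w cP by (simp add: m_assoc)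
      moreover have "g \<otimes> w \<otimes> inv g \<otimes> inv w \<in> B w" using Phi_commutator[OF pP _ w] g cG B(3)[OF w] by blast
      ultimately show ?thesis using subgroup.m_closed[OF B(1)[OF w] _ B(4)[OF w]] by metis
    qed
    thus ?thesis using normal_self cG by simp
  next
    case 2
    have cP1: "card (Phi P) = p ^ (k - 1)" using f 2 by simp
    have nP: "P \<lhd> G" by (rule rank_one_normal[OF cP1 2(1)])
    have "g \<otimes> w \<otimes> inv g \<in> B w" if w: "w \<in> P" and g: "g \<in> carrier G" for w g
    proof (cases "w \<in> Phi P")
      case False
      thus ?thesis using rank_one_cyclic[OF cP1 2(1) w False] normal.inv_op_closed2[OF nP g w] by blast
    qed (use triv g in blast)
    thus ?thesis using nP by blast
  next
    case 3
    have "p * p * card (Phi P) = p ^ (f + 2)" using f by (simp add: power_add power2_eq_square)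
    also have "\<dots> \<le> p ^ k" using 3 p1 by (intro power_increasing) auto
    finally have s: "p * p * card (Phi P) \<le> p ^ k" .
    show ?thesis using higher_rank_normal[OF s] higher_rank_lines[OF s] by blast
  qed
  thus "P \<lhd> G" "w \<in> P \<Longrightarrow> g \<in> carrier G \<Longrightarrow> g \<otimes> w \<otimes> inv g \<in> B w" by blast+
qed

end

context core_free_sylow
begin

subsection \<open>The action on the Frattini quotient\<close>

lemma normal_pow_mem:
  assumes nP: "P \<lhd> G" and g: "g \<in> carrier G" shows "g [^] m \<in> P"
proof -
  have "order G = m * card P" using orderG cardP by simp
  thus ?thesis using pow_index_mem[OF subgroup_self, of P m g] nP g by (simp add: order_def)
qed

lemma p_subgroup_in_P:
  assumes nP: "P \<lhd> G" and H: "subgroup H G" "card H = p ^ j" shows "H \<subseteq> P"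
proof
  fix x assume x: "x \<in> H"
  have xc: "x \<in> carrier G" using subgroup_carrier[OF H(1) x] .
  have "x [^] (p ^ j) \<in> P" using pow_card_eq_one[OF H(1) x] H(2) subgroup.one_closed[OF sP] by simp
  moreover have "coprime m (p ^ j)" using copm by simp
  ultimately show "x \<in> P" using pow_mem_coprime[OF sP xc normal_pow_mem[OF nP xc]] by blast
qed

lemma conj_pow: "g \<in> carrier G \<Longrightarrow> x \<in> carrier G \<Longrightarrow> (g \<otimes> x \<otimes> inv g) [^] (i::nat) = g \<otimes> x [^] i \<otimes> inv g"
  by (induction i) (simp_all add: m_assoc)

lemma frattini_space_carrier: "carrier (frattini_space G P) = carrier V"
  by (simp add: frattini_space_def frattini_quotient_def V_def Let_def)

lemma frattini_space_smult: "c \<odot>\<^bsub>frattini_space G P\<^esub> a = a [^]\<^bsub>V\<^esub> c"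
  by (simp add: frattini_space_def frattini_quotient_def V_def Let_def)

lemma conj_action_v:
  assumes nPhi: "Phi P \<lhd> G" and w: "w \<in> P" and g: "g \<in> carrier G"
  shows "conj_action G P g (v w) = v (g \<otimes> w \<otimes> inv g)"
proof -
  note cPhi = subgroup_carrier[OF sPhi]
  have wc: "w \<in> carrier G" using cP[OF w] .
  have "g <# (Phi P #> w) #> inv g = Phi P #> (g \<otimes> w \<otimes> inv g)"
  proof (intro equalityI subsetI)
    fix y assume "y \<in> g <# (Phi P #> w) #> inv g"
    then obtain f where f: "f \<in> Phi P" "y = g \<otimes> (f \<otimes> w) \<otimes> inv g" by (auto simp: r_coset_def l_coset_def)
    hence "y = (g \<otimes> f \<otimes> inv g) \<otimes> (g \<otimes> w \<otimes> inv g)" using g wc cPhi by (simp add: m_assoc)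
    thus "y \<in> Phi P #> (g \<otimes> w \<otimes> inv g)"
      using normal.inv_op_closed2[OF nPhi g f(1)] by (auto simp: r_coset_def)
  next
    fix y assume "y \<in> Phi P #> (g \<otimes> w \<otimes> inv g)"
    then obtain f where f: "f \<in> Phi P" "y = f \<otimes> (g \<otimes> w \<otimes> inv g)" by (auto simp: r_coset_def)
    hence "y = g \<otimes> ((inv g \<otimes> f \<otimes> g) \<otimes> w) \<otimes> inv g" using g wc cPhi by (simp add: m_assoc)
    thus "y \<in> g <# (Phi P #> w) #> inv g"
      using normal.inv_op_closed1[OF nPhi g f(1)] by (auto simp: r_coset_def l_coset_def)
  qed
  thus ?thesis using w by (simp add: conj_action_def frattini_space_carrier carrier_V v_def)
qed

lemma conj_action_group_action:
  assumes nPhi: "Phi P \<lhd> G" and nP: "P \<lhd> G" and S: "subgroup S G"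
  shows "group_action (G\<lparr>carrier := S\<rparr>) (carrier (frattini_space G P)) (conj_action G P)"
proof (intro group_action.intro group_hom.intro group_hom_axioms.intro homI)
  let ?E = "carrier (frattini_space G P)" and ?S = "G\<lparr>carrier := S\<rparr>"
  have E: "?E = v ` P" by (simp add: frattini_space_carrier carrier_V)
  note cS = subgroup_carrier[OF S]
  have cl: "g \<otimes> w \<otimes> inv g \<in> P" if "g \<in> carrier G" "w \<in> P" for g w
    using normal.inv_op_closed2[OF nP that] .
  have comp: "conj_action G P (g \<otimes> h) a = conj_action G P g (conj_action G P h a)"
    if "g \<in> carrier G" "h \<in> carrier G" "a \<in> ?E" for g h a
  proof -
    obtain w where w: "w \<in> P" "a = v w" using \<open>a \<in> ?E\<close> E by blast
    have "g \<otimes> h \<otimes> w \<otimes> inv (g \<otimes> h) = g \<otimes> (h \<otimes> w \<otimes> inv h) \<otimes> inv g"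
      using that w cP by (simp add: inv_mult_group m_assoc)
    thus ?thesis using w that conj_action_v[OF nPhi] cl by simp
  qed
  have mem: "conj_action G P g a \<in> ?E" if "g \<in> carrier G" "a \<in> ?E" for g a
    using that E conj_action_v[OF nPhi] cl by auto
  have one: "conj_action G P \<one> a = a" if "a \<in> ?E" for a
    using that E conj_action_v[OF nPhi] cP by auto
  show "group ?S" using subgroup_imp_group[OF S] .
  show "group (BijGroup ?E)" by (rule group_BijGroup)
  show BG: "conj_action G P g \<in> carrier (BijGroup ?E)" if "g \<in> carrier ?S" for g
  proof -
    have gc: "g \<in> carrier G" "inv g \<in> carrier G" using that cS by auto
    have "bij_betw (conj_action G P g) ?E ?E"
    proof (rule bij_betw_byWitness[where f' = "conj_action G P (inv g)"])
      show "\<forall>a\<in>?E. conj_action G P (inv g) (conj_action G P g a) = a"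
        using comp[OF gc(2,1)] one gc by simp
      show "\<forall>a\<in>?E. conj_action G P g (conj_action G P (inv g) a) = a"
        using comp[OF gc] one gc by simp
    qed (use mem gc in auto)
    thus ?thesis by (simp add: BijGroup_def Bij_def conj_action_def)
  qed
  fix g h assume gh: "g \<in> carrier ?S" "h \<in> carrier ?S"
  have "conj_action G P g \<otimes>\<^bsub>BijGroup ?E\<^esub> conj_action G P h =
      compose ?E (conj_action G P g) (conj_action G P h)"
    using BG[OF gh(1)] BG[OF gh(2)] by (simp add: BijGroup_def)
  also have "\<dots> = conj_action G P (g \<otimes>\<^bsub>?S\<^esub> h)"
  proof (rule extensionalityI[of _ ?E])
    show "conj_action G P (g \<otimes>\<^bsub>?S\<^esub> h) \<in> extensional ?E" by (simp add: conj_action_def)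
    fix a assume "a \<in> ?E"
    thus "compose ?E (conj_action G P g) (conj_action G P h) a = conj_action G P (g \<otimes>\<^bsub>?S\<^esub> h) a"
      using comp[of g h a] gh cS by (simp add: compose_eq)
  qed (simp add: compose_def)
  finally show "conj_action G P (g \<otimes>\<^bsub>?S\<^esub> h) = conj_action G P g \<otimes>\<^bsub>BijGroup ?E\<^esub> conj_action G P h" by simp
qed

end

section \<open>The scalar character of G on the Frattini quotient\<close>

context M_group
begin

lemmas nP = normal_and_lines(1)
lemmas line = normal_and_lines(2)

lemma conj_P: "g \<in> carrier G \<Longrightarrow> w \<in> P \<Longrightarrow> g \<otimes> w \<otimes> inv g \<in> P"
  using normal.inv_op_closed2[OF nP] by blast

lemma group_V: "group V"
  using V_comm_group by (simp add: comm_group_def)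

lemma v_Phi: "f \<in> Phi P \<Longrightarrow> v f = \<one>\<^bsub>V\<^esub>"
  using v_one_iff Phi_subset_P by blast

lemma v_conj_mult:
  assumes "g \<in> carrier G" "x \<in> P" "y \<in> P"
  shows "v (g \<otimes> (x \<otimes> y) \<otimes> inv g) = v (g \<otimes> x \<otimes> inv g) \<otimes>\<^bsub>V\<^esub> v (g \<otimes> y \<otimes> inv g)"
proof -
  have "g \<otimes> (x \<otimes> y) \<otimes> inv g = (g \<otimes> x \<otimes> inv g) \<otimes> (g \<otimes> y \<otimes> inv g)"
    using assms cP by (simp add: m_assoc)
  thus ?thesis using v_mult conj_P assms by simp
qed

lemma v_conj_eq:
  assumes g: "g \<in> carrier G" and x: "x \<in> P" "y \<in> P" "v x = v y"
  shows "v (g \<otimes> x \<otimes> inv g) = v (g \<otimes> y \<otimes> inv g)"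
proof -
  interpret V: comm_group V by (rule V_comm_group)
  have f: "x \<otimes> inv y \<in> Phi P" using v_eq_iff x by simp
  have xP: "x \<otimes> inv y \<in> P" using Phi_subset_P[OF f] .
  have e: "x = (x \<otimes> inv y) \<otimes> y" using x cP by (simp add: m_assoc)
  have "v (g \<otimes> x \<otimes> inv g) = v (g \<otimes> ((x \<otimes> inv y) \<otimes> y) \<otimes> inv g)" using e by simp
  also have "\<dots> = v (g \<otimes> (x \<otimes> inv y) \<otimes> inv g) \<otimes>\<^bsub>V\<^esub> v (g \<otimes> y \<otimes> inv g)"
    by (rule v_conj_mult[OF g xP x(2)])
  also have "v (g \<otimes> (x \<otimes> inv y) \<otimes> inv g) = \<one>\<^bsub>V\<^esub>"
    using v_Phi normal.inv_op_closed2[OF Phi_normal g f] by blast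
  finally show ?thesis using v_in_V[OF conj_P[OF g x(2)]] by simp
qed

lemma v_B:
  assumes w: "w \<in> P" and x: "x \<in> B w" shows "\<exists>j::nat. v x = v w [^]\<^bsub>V\<^esub> j"
proof -
  interpret V: comm_group V by (rule V_comm_group)
  obtain f i where f: "f \<in> Phi P" "x = f \<otimes> w [^] (i::nat)" using x by (auto simp: adjoin_def)
  have "v x = v w [^]\<^bsub>V\<^esub> i"
    using f v_mult[OF Phi_subset_P[OF f(1)] subgroup_pow[OF sP w]] v_Phi[OF f(1)] v_pow[OF w]
      v_in_V[OF w] by simp
  thus ?thesis by blast
qed

lemma v_pow_eq_iff:
  assumes a: "a \<in> P" "a \<notin> Phi P"
  shows "v a [^]\<^bsub>V\<^esub> (i::nat) = v a [^]\<^bsub>V\<^esub> (j::nat) \<longleftrightarrow> [i = j] (mod p)"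
proof -
  interpret V: comm_group V by (rule V_comm_group)
  have c: "v a \<in> carrier V" using v_in_V a by blast
  have "v a [^]\<^bsub>V\<^esub> p = \<one>\<^bsub>V\<^esub>" using v_pow[OF a(1), of p] v_Phi[OF Phi_power[OF pP a(1)]] by simp
  hence "V.ord (v a) dvd p" using V.pow_eq_id[OF c] by blast
  moreover have "V.ord (v a) \<noteq> 1" using V.ord_eq_1[OF c] v_one_iff a by simp
  ultimately have o: "V.ord (v a) = p" using prime_p by (metis prime_nat_iff)
  have "v a [^]\<^bsub>V\<^esub> i = v a [^]\<^bsub>V\<^esub> j \<longleftrightarrow> int p dvd int j - int i"
    using V.int_pow_eq[OF c, of "int i" "int j"] o by (simp add: int_pow_int)
  also have "\<dots> \<longleftrightarrow> [int j = int i] (mod int p)" by (simp add: cong_iff_dvd_diff)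
  also have "\<dots> \<longleftrightarrow> [i = j] (mod p)" by (simp add: cong_int_iff cong_sym_eq)
  finally show ?thesis .
qed

lemma v_pow_cong:
  assumes "a \<in> P" "[i = j] (mod p)" shows "v a [^]\<^bsub>V\<^esub> (i::nat) = v a [^]\<^bsub>V\<^esub> (j::nat)"
proof (cases "a \<in> Phi P")
  case True
  interpret V: comm_group V by (rule V_comm_group)
  show ?thesis using v_Phi[OF True] by simp
qed (use v_pow_eq_iff assms in blast)

text \<open>The differences of the coordinates lie on the distinct lines of \<open>a\<close> and
  \<open>w\<close> and coincide in \<open>V\<close>, so both are zero.\<close>

lemma v_independent:
  assumes a: "a \<in> P" "a \<notin> Phi P" and w: "w \<in> P" "w \<notin> B a"
    and e: "v a [^]\<^bsub>V\<^esub> (i::nat) \<otimes>\<^bsub>V\<^esub> v w [^]\<^bsub>V\<^esub> (j::nat) = v a [^]\<^bsub>V\<^esub> (c::nat) \<otimes>\<^bsub>V\<^esub> v w [^]\<^bsub>V\<^esub> (d::nat)"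
  shows "v a [^]\<^bsub>V\<^esub> i = v a [^]\<^bsub>V\<^esub> c" "v w [^]\<^bsub>V\<^esub> j = v w [^]\<^bsub>V\<^esub> d"
proof -
  interpret V: comm_group V by (rule V_comm_group)
  note Ba = B[OF a(1)] and Bw = B[OF w(1)]
  let ?x = "a [^] i \<otimes> inv (a [^] c)" and ?y = "w [^] d \<otimes> inv (w [^] j)"
  have ac: "a [^] i \<in> P" "a [^] c \<in> P" "w [^] d \<in> P" "w [^] j \<in> P" using subgroup_pow[OF sP] a w by auto
  have xB: "?x \<in> B a"
    using subgroup.m_closed[OF Ba(1) subgroup_pow[OF Ba(1,4)] subgroup.m_inv_closed[OF Ba(1) subgroup_pow[OF Ba(1,4)]]] .
  have yB: "?y \<in> B w"
    using subgroup.m_closed[OF Bw(1) subgroup_pow[OF Bw(1,4)] subgroup.m_inv_closed[OF Bw(1) subgroup_pow[OF Bw(1,4)]]] .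
  have xy: "?x \<in> P" "?y \<in> P" using xB yB Ba(2) Bw(2) by auto
  have vc: "v a \<in> carrier V" "v w \<in> carrier V" "v ?x \<in> carrier V" "v ?y \<in> carrier V" using v_in_V a w xy by auto
  have 1: "v ?x \<otimes>\<^bsub>V\<^esub> v a [^]\<^bsub>V\<^esub> c = v a [^]\<^bsub>V\<^esub> i"
    using v_mult[OF xy(1) ac(2)] v_pow a ac cP by (simp add: m_assoc)
  have 2: "v ?y \<otimes>\<^bsub>V\<^esub> v w [^]\<^bsub>V\<^esub> j = v w [^]\<^bsub>V\<^esub> d"
    using v_mult[OF xy(2) ac(4)] v_pow w ac cP by (simp add: m_assoc)
  have "(v a [^]\<^bsub>V\<^esub> c \<otimes>\<^bsub>V\<^esub> v w [^]\<^bsub>V\<^esub> j) \<otimes>\<^bsub>V\<^esub> v ?x = (v a [^]\<^bsub>V\<^esub> c \<otimes>\<^bsub>V\<^esub> v w [^]\<^bsub>V\<^esub> j) \<otimes>\<^bsub>V\<^esub> v ?y"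
    using e unfolding 1[symmetric] 2[symmetric] using vc by (simp add: V.m_ac)
  hence vxy: "v ?x = v ?y" using vc by simp
  hence "?x \<otimes> inv ?y \<in> Phi P" using v_eq_iff xy by blast
  hence "(?x \<otimes> inv ?y) \<otimes> ?y \<in> B w" using Bw(3) yB subgroup.m_closed[OF Bw(1)] by blast
  moreover have "(?x \<otimes> inv ?y) \<otimes> ?y = ?x" using cP[OF xy(1)] cP[OF xy(2)] by (simp only: m_assoc inv_closed l_inv r_one)
  ultimately have "?x \<in> Phi P" using B_trivial_Int[OF w(1) a(1) w(2) xB] by simp
  hence "v ?x = \<one>\<^bsub>V\<^esub>" "v ?y = \<one>\<^bsub>V\<^esub>" using v_Phi vxy by auto
  thus "v a [^]\<^bsub>V\<^esub> i = v a [^]\<^bsub>V\<^esub> c" "v w [^]\<^bsub>V\<^esub> j = v w [^]\<^bsub>V\<^esub> d"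
    using 1 2 vc by auto
qed

text \<open>A linear map that preserves every line is scalar: the factors on \<open>a\<close>, on an
  independent \<open>w\<close> and on \<open>a \<otimes> w\<close> must agree. Reduction below
  \<open>p\<close> makes the factor an element of \<open>residue_ring\<close>.\<close>

lemma scalar_exists:
  assumes g: "g \<in> carrier G"
  shows "\<exists>c<p. \<forall>w\<in>P. v (g \<otimes> w \<otimes> inv g) = v w [^]\<^bsub>V\<^esub> (c::nat)"
proof -
  interpret V: comm_group V by (rule V_comm_group)
  obtain a where a: "a \<in> P" "a \<notin> Phi P" using exists_not_Phi by blast
  obtain c0 where c0: "v (g \<otimes> a \<otimes> inv g) = v a [^]\<^bsub>V\<^esub> (c0::nat)" using v_B[OF a(1) line[OF a(1) g]] by blast
  define c where "c = c0 mod p"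
  have c: "v (g \<otimes> a \<otimes> inv g) = v a [^]\<^bsub>V\<^esub> c" "c < p"
    using c0 v_pow_cong[OF a(1), of c0 c] p1 by (auto simp: c_def cong_def)
  have vV: "v x \<in> carrier V" if "x \<in> P" for x using v_in_V that .
  have "v (g \<otimes> w \<otimes> inv g) = v w [^]\<^bsub>V\<^esub> c" if w: "w \<in> P" for w
  proof (cases "w \<in> B a")
    case True
    then obtain i where i: "v w = v a [^]\<^bsub>V\<^esub> (i::nat)" using v_B[OF a(1)] by blast
    hence "v w = v (a [^] i)" using v_pow[OF a(1)] by simp
    hence "v (g \<otimes> w \<otimes> inv g) = v (g \<otimes> a [^] i \<otimes> inv g)"
      by (rule v_conj_eq[OF g w subgroup_pow[OF sP a(1)]])
    also have "\<dots> = v ((g \<otimes> a \<otimes> inv g) [^] i)" using conj_pow[OF g cP[OF a(1)]] by simp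
    also have "\<dots> = (v a [^]\<^bsub>V\<^esub> c) [^]\<^bsub>V\<^esub> i" using v_pow[OF conj_P[OF g a(1)]] c(1) by simp
    also have "\<dots> = v w [^]\<^bsub>V\<^esub> c" unfolding i using vV[OF a(1)] by (simp add: V.nat_pow_pow mult.commute)
    finally show ?thesis .
  next
    case False
    have aw: "a \<otimes> w \<in> P" using P_mult a w by blast
    obtain d where d: "v (g \<otimes> w \<otimes> inv g) = v w [^]\<^bsub>V\<^esub> (d::nat)" using v_B[OF w line[OF w g]] by blast
    obtain l where l: "v (g \<otimes> (a \<otimes> w) \<otimes> inv g) = v (a \<otimes> w) [^]\<^bsub>V\<^esub> (l::nat)" using v_B[OF aw line[OF aw g]] by blast
    have "v a [^]\<^bsub>V\<^esub> l \<otimes>\<^bsub>V\<^esub> v w [^]\<^bsub>V\<^esub> l = v a [^]\<^bsub>V\<^esub> c \<otimes>\<^bsub>V\<^esub> v w [^]\<^bsub>V\<^esub> d"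
      using l d c(1) v_conj_mult[OF g a(1) w] v_mult[OF a(1) w] vV a w by (simp add: V.nat_pow_distrib)
    note ind = v_independent[OF a w False this]
    have "[l = c] (mod p)" using ind(1) v_pow_eq_iff[OF a] by blast
    thus ?thesis using d ind(2) v_pow_cong[OF w] by simp
  qed
  thus ?thesis using c(2) by blast
qed

text \<open>The character of \<open>G\<close> with values in the nonzero residues modulo
  \<open>p\<close>, represented by least residues; hence it is multiplicative up to
  congruence.\<close>

definition chi :: "'a \<Rightarrow> nat" where
  "chi g = (SOME c. c < p \<and> (\<forall>w\<in>P. v (g \<otimes> w \<otimes> inv g) = v w [^]\<^bsub>V\<^esub> c))"

lemma chi:
  assumes "g \<in> carrier G"
  shows "chi g < p" "w \<in> P \<Longrightarrow> v (g \<otimes> w \<otimes> inv g) = v w [^]\<^bsub>V\<^esub> chi g"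
proof -
  have "chi g < p \<and> (\<forall>w\<in>P. v (g \<otimes> w \<otimes> inv g) = v w [^]\<^bsub>V\<^esub> chi g)"
    unfolding chi_def by (rule someI_ex) (use scalar_exists[OF assms] in blast)
  thus "chi g < p" "w \<in> P \<Longrightarrow> v (g \<otimes> w \<otimes> inv g) = v w [^]\<^bsub>V\<^esub> chi g" by blast+
qed

lemma chi_mult:
  assumes g: "g \<in> carrier G" "h \<in> carrier G" shows "[chi (g \<otimes> h) = chi g * chi h] (mod p)"
proof -
  interpret V: comm_group V by (rule V_comm_group)
  obtain a where a: "a \<in> P" "a \<notin> Phi P" using exists_not_Phi by blast
  have "v a [^]\<^bsub>V\<^esub> chi (g \<otimes> h) = v (g \<otimes> h \<otimes> a \<otimes> inv (g \<otimes> h))" using chi(2)[of "g \<otimes> h" a] g a by simp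
  also have "g \<otimes> h \<otimes> a \<otimes> inv (g \<otimes> h) = g \<otimes> (h \<otimes> a \<otimes> inv h) \<otimes> inv g"
    using g cP[OF a(1)] by (simp add: m_assoc inv_mult_group)
  also have "v \<dots> = (v a [^]\<^bsub>V\<^esub> chi h) [^]\<^bsub>V\<^esub> chi g" using chi(2)[OF g(1) conj_P[OF g(2) a(1)]] chi(2)[OF g(2) a(1)] by simp
  also have "\<dots> = v a [^]\<^bsub>V\<^esub> (chi g * chi h)" using v_in_V[OF a(1)] by (simp add: V.nat_pow_pow mult.commute)
  finally show ?thesis using v_pow_eq_iff[OF a] by blast
qed

lemma chi_one: "[chi \<one> = 1] (mod p)"
proof -
  interpret V: comm_group V by (rule V_comm_group)
  obtain a where a: "a \<in> P" "a \<notin> Phi P" using exists_not_Phi by blast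
  have "v a [^]\<^bsub>V\<^esub> chi \<one> = v a [^]\<^bsub>V\<^esub> (1::nat)" using chi(2)[OF one_closed a(1)] cP[OF a(1)] v_in_V[OF a(1)] by simp
  thus ?thesis using v_pow_eq_iff[OF a] by blast
qed

lemma chi_coprime:
  assumes g: "g \<in> carrier G" shows "coprime (chi g) p"
proof -
  have "[chi g * chi (inv g) = chi (g \<otimes> inv g)] (mod p)" using chi_mult[OF g, of "inv g"] g cong_sym by simp
  hence "[chi g * chi (inv g) = 1] (mod p)" using chi_one g cong_trans by simp
  thus ?thesis by (auto simp: coprime_iff_invertible_nat)
qed

text \<open>The kernel of \<open>chi\<close>, which is the centralizer of \<open>P/\<Phi>(P)\<close>
  in \<open>G\<close>.\<close>

definition centr where "centr = {g \<in> carrier G. [chi g = 1] (mod p)}"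

lemma centr_normal: "centr \<lhd> G"
proof (rule normal_invI)
  show "subgroup centr G"
  proof (rule finite_submonoid_subgroup)
    show "\<one> \<in> centr" using chi_one by (simp add: centr_def)
    fix x y assume "x \<in> centr" "y \<in> centr"
    thus "x \<otimes> y \<in> centr" unfolding centr_def using chi_mult[of x y] cong_mult[of "chi x" 1 p "chi y" 1] cong_trans by auto
  qed (auto simp: centr_def)
  fix g h assume g: "g \<in> carrier G" and h: "h \<in> centr"
  have hc: "h \<in> carrier G" "[chi h = 1] (mod p)" using h by (auto simp: centr_def)
  have "[chi (g \<otimes> h \<otimes> inv g) = chi g * chi h * chi (inv g)] (mod p)"
    using chi_mult[of "g \<otimes> h" "inv g"] chi_mult[OF g hc(1)] g hc(1) cong_mult[OF _ cong_refl] cong_trans by fastforce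
  also have "[chi g * chi h * chi (inv g) = chi g * 1 * chi (inv g)] (mod p)"
    using hc(2) by (intro cong_mult cong_refl)
  also have "[chi g * 1 * chi (inv g) = chi (g \<otimes> inv g)] (mod p)"
    using chi_mult[OF g, of "inv g"] g cong_sym by simp
  also have "[chi (g \<otimes> inv g) = 1] (mod p)" using chi_one g by simp
  finally show "g \<otimes> h \<otimes> inv g \<in> centr" using g hc(1) by (simp add: centr_def)
qed

lemma centr_conj: "g \<in> centr \<Longrightarrow> w \<in> P \<Longrightarrow> v (g \<otimes> w \<otimes> inv g) = v w"
proof -
  assume g: "g \<in> centr" and w: "w \<in> P"
  interpret V: comm_group V by (rule V_comm_group)
  have gc: "g \<in> carrier G" "[chi g = 1] (mod p)" using g by (auto simp: centr_def)
  have "v (g \<otimes> w \<otimes> inv g) = v w [^]\<^bsub>V\<^esub> (1::nat)"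
    using chi(2)[OF gc(1) w] v_pow_cong[OF w gc(2)] by (simp only:)
  thus ?thesis using v_in_V[OF w] by simp
qed

lemma in_centr:
  assumes g: "g \<in> carrier G" and t: "\<And>w. w \<in> P \<Longrightarrow> v (g \<otimes> w \<otimes> inv g) = v w"
  shows "g \<in> centr"
proof -
  interpret V: comm_group V by (rule V_comm_group)
  obtain a where a: "a \<in> P" "a \<notin> Phi P" using exists_not_Phi by blast
  have "v a [^]\<^bsub>V\<^esub> chi g = v a [^]\<^bsub>V\<^esub> (1::nat)" using chi(2)[OF g a(1)] t[OF a(1)] v_in_V[OF a(1)] by simp
  hence "[chi g = 1] (mod p)" using v_pow_eq_iff[OF a] by blast
  thus ?thesis using g by (simp add: centr_def)
qed

lemma P_in_centr: "P \<subseteq> centr"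
proof
  fix g assume g: "g \<in> P"
  show "g \<in> centr"
  proof (rule in_centr)
    fix w assume w: "w \<in> P"
    thus "v (g \<otimes> w \<otimes> inv g) = v w"
      using v_eq_iff[OF conj_P[OF cP[OF g] w] w] Phi_commutator[OF pP g w] by simp
  qed (use cP g in blast)
qed

text \<open>
  The kernel of the transfer into \<open>P/\<Phi>(P)\<close> meets \<open>P\<close> in \<open>\<Phi>(P)\<close>, so Tate's theorem applies; this
  takes the place of the usual argument by coprime action.
\<close>

lemma centr_eq: "centr = P"
proof -
  have sC: "subgroup centr G" using normal_imp_subgroup[OF centr_normal] .
  let ?C = "G\<lparr>carrier := centr\<rparr>"
  interpret C: prime_group ?C p by (rule restrict_group[OF sC])
  interpret V: comm_group V by (rule V_comm_group)
  obtain f M where fh: "f \<in> hom ?C V" and Mp: "coprime M p"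
    and ev: "\<forall>z\<in>P. (\<forall>t\<in>centr. t \<otimes> z \<otimes> inv t \<in> P \<and> v (t \<otimes> z \<otimes> inv t) = v z) \<longrightarrow> f z = v z [^]\<^bsub>V\<^esub> (M::nat)"
    using transfer_to_sylow[OF sC P_in_centr V_comm_group v_hom] by blast
  have f_eval: "f z = v z [^]\<^bsub>V\<^esub> M" if z: "z \<in> P" for z
    using ev z centr_conj conj_P subgroup_carrier[OF sC] by blast
  define N where "N = kernel ?C V f"
  have hom: "group_hom ?C V f" using fh group_V C.is_group by (simp add: group_hom_def group_hom_axioms_def)
  have nN: "N \<lhd> ?C" unfolding N_def by (rule group_hom.normal_kernel[OF hom])
  have Nmem: "x \<in> N \<longleftrightarrow> x \<in> centr \<and> f x = \<one>\<^bsub>V\<^esub>" for x by (auto simp: N_def kernel_def)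
  have PN: "P \<inter> N \<subseteq> Phi P"
  proof
    fix z assume z: "z \<in> P \<inter> N"
    hence zP: "z \<in> P" by blast
    have "v (z [^] M) = \<one>\<^bsub>V\<^esub>" using f_eval[OF zP] v_pow[OF zP] z Nmem by simp
    hence zM: "z [^] M \<in> Phi P" using v_one_iff subgroup_pow[OF sP zP] by blast
    show "z \<in> Phi P" using pow_mem_coprime[OF sPhi cP[OF zP] zM Phi_power[OF pP zP] Mp] .
  qed
  \<comment> \<open>\<open>f\<close> is an \<open>M\<close>-th power on \<open>P\<close>; inverting
    \<open>M\<close> modulo \<open>p\<close> shows that it maps \<open>P\<close> onto
    \<open>V\<close>, so \<open>centr\<close> is the product of \<open>P\<close> with the kernel
    \<open>N\<close>.\<close>
  obtain s where s: "[M * s = 1] (mod p)" using cong_solve_coprime_nat[OF Mp] by auto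
  have "centr = P <#> N"
  proof
    have "N \<subseteq> centr" using Nmem by blast
    thus "P <#> N \<subseteq> centr" using P_in_centr subgroup.m_closed[OF sC] by (auto simp: set_mult_def)
    show "centr \<subseteq> P <#> N"
    proof
      fix g assume g: "g \<in> centr"
      have "f g \<in> carrier V" using fh g by (auto simp: hom_def)
      then obtain x0 where x0: "x0 \<in> P" "f g = v x0" by (auto simp: carrier_V)
      define z where "z = x0 [^] s"
      have z: "z \<in> P" "inv z \<in> P" using subgroup_pow[OF sP x0(1)] P_inv by (auto simp: z_def)
      have "f z = v x0 [^]\<^bsub>V\<^esub> (M * s)"
        using f_eval[OF z(1)] v_pow[OF x0(1)] v_in_V[OF x0(1)] by (simp add: z_def V.nat_pow_pow mult.commute)
      also have "\<dots> = v x0 [^]\<^bsub>V\<^esub> (1::nat)" by (rule v_pow_cong[OF x0(1) s])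
      finally have fz: "f z = f g" using x0 v_in_V[OF x0(1)] by simp
      have zC: "z \<in> centr" "inv z \<in> centr" using z P_in_centr by auto
      have fm: "f (a \<otimes> b) = f a \<otimes>\<^bsub>V\<^esub> f b" if "a \<in> centr" "b \<in> centr" for a b using fh that by (simp add: hom_def)
      have izg: "inv z \<otimes> g \<in> centr" using subgroup.m_closed[OF sC zC(2) g] .
      have e: "g = z \<otimes> (inv z \<otimes> g)" using cP[OF z(1)] subgroup_carrier[OF sC g] by simp
      have "f z \<otimes>\<^bsub>V\<^esub> f (inv z \<otimes> g) = f z" using fm[OF zC(1) izg] e fz by simp
      moreover have "f z \<in> carrier V" "f (inv z \<otimes> g) \<in> carrier V" using fh zC izg by (auto simp: hom_def)
      ultimately have "inv z \<otimes> g \<in> N" using Nmem izg by simp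
      thus "g \<in> P <#> N" using z(1) e by (auto simp: set_mult_def)
    qed
  qed
  moreover have "N \<subseteq> centr" using Nmem by blast
  ultimately show ?thesis using tate_relative[OF centr_normal sC P_in_centr subset_refl nN _ _ PN] by blast
qed

lemma chi_pow:
  assumes "g \<in> carrier G" shows "[chi (g [^] (i::nat)) = chi g ^ i] (mod p)"
proof (induction i)
  case (Suc i)
  have "[chi (g [^] Suc i) = chi (g [^] i) * chi g] (mod p)" using chi_mult[of "g [^] i" g] assms by simp
  also have "[chi (g [^] i) * chi g = chi g ^ i * chi g] (mod p)" using Suc by (intro cong_mult cong_refl)
  finally show ?case by (simp add: mult.commute)
qed (use chi_one in simp)

text \<open>\<open>chi\<close> embeds \<open>G/P\<close> into the cyclic group of nonzero residues.
  With a primitive root \<open>r\<close>, the element \<open>y\<close> realizes the least positive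
  exponent, and by division with remainder every \<open>g\<close> differs from a power of
  \<open>y\<close> by an element of the kernel.\<close>

lemma quotient_cyclic:
  "\<exists>y\<in>carrier G. \<forall>g\<in>carrier G. \<exists>i::nat. g \<otimes> inv (y [^] i) \<in> P"
proof -
  obtain r where r: "r \<in> {1..p-1}" "{1..p-1} = {r ^ i mod p | i. i \<in> UNIV}"
    using residue_prime_mult_group_has_gen[OF prime_p] by blast
  have "\<not> p dvd r" using r(1) p1 by (auto dest: dvd_imp_le)
  hence cr: "coprime r p" using prime_p by (metis coprime_commute prime_imp_coprime)
  let ?E = "\<lambda>e. e > 0 \<and> (\<exists>g\<in>carrier G. [chi g = r ^ e] (mod p))"
  \<comment> \<open>By Fermat's theorem the identity realizes the positive exponent
    \<open>p - 1\<close>, so a least one exists.\<close>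
  have "[chi \<one> = r ^ (p - 1)] (mod p)"
    using fermat_theorem[OF prime_p \<open>\<not> p dvd r\<close>] chi_one cong_sym cong_trans by blast
  hence ex: "?E (p - 1)" using p1 by auto
  define d where "d = (LEAST e. ?E e)"
  have d: "?E d" unfolding d_def by (rule LeastI[of ?E]) (rule ex)
  then obtain y where y: "y \<in> carrier G" "[chi y = r ^ d] (mod p)" by blast
  have "\<exists>i::nat. g \<otimes> inv (y [^] i) \<in> P" if g: "g \<in> carrier G" for g
  proof -
    have "chi g \<noteq> 0" using chi_coprime[OF g] p1 by (metis coprime_0_left_iff less_irrefl nat_dvd_1_iff_1 is_unit_gcd gcd_0_left_nat)
    hence "chi g \<in> {1..p-1}" using chi(1)[OF g] by simp
    hence "chi g \<in> {r ^ i mod p | i. i \<in> UNIV}" by (simp only: r(2)[symmetric])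
    then obtain e where e: "chi g = r ^ e mod p" by blast
    define q s where "q = e div d" and "s = e mod d"
    have es: "e = d * q + s" "s < d" using d by (auto simp: q_def s_def)
    let ?z = "g \<otimes> inv (y [^] q)"
    have z: "?z \<in> carrier G" "?z \<otimes> y [^] q = g" using g y(1) by (auto simp: m_assoc)
    have yq: "[chi (y [^] q) = r ^ (d * q)] (mod p)"
      using cong_trans[OF chi_pow[OF y(1)] cong_pow[OF y(2)]] by (simp add: power_mult)
    have "[chi ?z * r ^ (d * q) = chi ?z * chi (y [^] q)] (mod p)" using yq cong_sym by (intro cong_mult cong_refl) blast
    also have "[chi ?z * chi (y [^] q) = chi g] (mod p)" using chi_mult[OF z(1), of "y [^] q"] z(2) y(1) cong_sym by simp
    also have "[chi g = r ^ e] (mod p)" using e by (simp add: cong_def)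
    also have "r ^ e = r ^ s * r ^ (d * q)" using es(1) by (simp add: power_add)
    finally have "[chi ?z = r ^ s] (mod p)" using cr by (subst (asm) cong_mult_rcancel_nat) auto
    moreover have "s = 0"
    proof (rule ccontr)
      assume "s \<noteq> 0"
      hence "?E s" using \<open>[chi ?z = r ^ s] (mod p)\<close> z(1) by blast
      hence "d \<le> s" unfolding d_def by (rule Least_le)
      thus False using es(2) by simp
    qed
    ultimately have "?z \<in> centr" using z(1) by (simp add: centr_def)
    thus ?thesis using centr_eq by blast
  qed
  thus ?thesis using y(1) by blast
qed

text \<open>\<open>Phi P\<close> is normal in \<open>G\<close> and consists of nongenerators of
  \<open>P\<close>, so it lies in every maximal subgroup of \<open>G\<close>. Conversely, a maximal
  subgroup \<open>M\<close> of \<open>P\<close> is normal in \<open>G\<close> by invariance of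
  lines, and \<open>M <#> S\<close> is maximal in \<open>G\<close> and meets \<open>P\<close> in
  \<open>M\<close>. It remains to see that \<open>frattini G\<close> lies in
  \<open>P\<close>.\<close>

lemma frattini_eq:
  assumes S: "subgroup S G" and dec: "carrier G = S <#> P" "S \<inter> P = {\<one>}"
  shows "frattini G = Phi P"
proof -
  have G: "G\<lparr>carrier := carrier G\<rparr> = G" by simp
  note sG = subgroup_self
  have fr: "frattini G = Phi (carrier G)" by simp
  have maxD: "subgroup M G" "M \<subset> carrier G" "\<And>L. subgroup L G \<Longrightarrow> M \<subseteq> L \<Longrightarrow> L \<subseteq> carrier G \<Longrightarrow> L = M \<or> L = carrier G"
    if "maximal_subgroup M G" for M using maximalD[OF sG, of M] that by (simp_all only: G)
  have FI: "x \<in> frattini G \<longleftrightarrow> x \<in> carrier G \<and> (\<forall>M. maximal_subgroup M G \<longrightarrow> x \<in> M)" for x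
    by (auto simp: frattini_def)
  have "Phi P \<subseteq> M" if M: "maximal_subgroup M G" for M
  proof (rule ccontr)
    assume n: "\<not> Phi P \<subseteq> M"
    note M' = maxD[OF M]
    interpret S2: second_isomorphism_grp "Phi P" G M
      using Phi_normal M'(1) by (simp add: second_isomorphism_grp_def second_isomorphism_grp_axioms_def)
    let ?J = "Phi P <#> M"
    have J: "subgroup ?J G" "M \<subseteq> ?J" "Phi P \<subseteq> ?J"
      using S2.normal_set_mult_subgroup S2.S_contained_in_set_mult S2.H_contained_in_set_mult .
    have "?J = carrier G" using M'(3)[OF J(1,2) subgroup.subset[OF J(1)]] J(3) n by blast
    hence JM: "M <#> Phi P = carrier G" using commut_normal[OF M'(1) Phi_normal] by simp
    have I: "subgroup (P \<inter> M) G" using sP M'(1) subgroups_Inter_pair by blast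
    have "P \<subseteq> (P \<inter> M) <#> Phi P"
    proof
      fix x assume x: "x \<in> P"
      have "x \<in> M <#> Phi P" using JM cP[OF x] by simp
      then obtain y f where yf: "y \<in> M" "f \<in> Phi P" "x = y \<otimes> f" by (auto simp: set_mult_def)
      have "y = x \<otimes> inv f" using yf subgroup_carrier[OF M'(1)] subgroup_carrier[OF sPhi] by (simp add: m_assoc)
      hence "y \<in> P" using x P_mult P_inv Phi_subset_P[OF yf(2)] by blast
      thus "x \<in> (P \<inter> M) <#> Phi P" using yf by (auto simp: set_mult_def)
    qed
    hence "P \<inter> M = P" using Phi_nongenerator[OF sP I] by blast
    thus False using n Phi_subset by blast
  qed
  hence sub1: "Phi P \<subseteq> frattini G" using FI subgroup_carrier[OF sPhi] by blast
  have cS: "s \<in> carrier G" if "s \<in> S" for s using subgroup_carrier[OF S that] .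
  have sub2: "frattini G \<inter> P \<subseteq> Phi P"
  proof
    fix z assume z: "z \<in> frattini G \<inter> P"
    have "z \<in> M" if M: "maximal_in M P" for M
    proof -
      note M' = maximalD[OF sP M]
      have PhM: "Phi P \<subseteq> M" using M Phi_iff by blast
      have nM: "M \<lhd> G"
      proof (rule normal_invI[OF M'(1)])
        fix g h assume g: "g \<in> carrier G" and h: "h \<in> M"
        have "B h \<subseteq> M" using adjoin_sub[OF M'(1) PhM h] .
        thus "g \<otimes> h \<otimes> inv g \<in> M" using line[OF _ g, of h] h M'(3) by blast
      qed
      interpret S2: second_isomorphism_grp M G S
        using nM S by (simp add: second_isomorphism_grp_def second_isomorphism_grp_axioms_def)
      let ?J = "M <#> S"
      have J: "subgroup ?J G" "S \<subseteq> ?J" "M \<subseteq> ?J"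
        using S2.normal_set_mult_subgroup S2.S_contained_in_set_mult S2.H_contained_in_set_mult .
      have JP: "x \<in> M" if x: "x \<in> ?J" "x \<in> P" for x
      proof -
        obtain y s where ys: "y \<in> M" "s \<in> S" "x = y \<otimes> s" using x(1) by (auto simp: set_mult_def)
        have "s = inv y \<otimes> x" using ys subgroup_carrier[OF M'(1)] cS by simp
        hence "s \<in> P" using ys(1) M'(3) x(2) P_mult P_inv by blast
        hence "s = \<one>" using ys(2) dec(2) by blast
        thus ?thesis using ys subgroup_carrier[OF M'(1)] by simp
      qed
      have "maximal_subgroup ?J (G\<lparr>carrier := carrier G\<rparr>)"
      proof (rule maximalI[OF sG J(1)])
        obtain u where "u \<in> P" "u \<notin> M" using M'(2) by blast
        thus "?J \<subset> carrier G" using JP cP subgroup.subset[OF J(1)] by blast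
        fix L assume L: "subgroup L G" "?J \<subseteq> L" "L \<subseteq> carrier G"
        have I: "subgroup (L \<inter> P) G" using sP L(1) subgroups_Inter_pair by blast
        have L2: "L = (L \<inter> P) <#> S"
        proof
          have "S \<subseteq> L" using L(2) J(2) by blast
          thus "(L \<inter> P) <#> S \<subseteq> L" using subgroup.m_closed[OF L(1)] by (auto simp: set_mult_def)
          show "L \<subseteq> (L \<inter> P) <#> S"
          proof
            fix l assume l: "l \<in> L"
            have "carrier G = P <#> S" using dec(1) commut_normal[OF S nP] by simp
            then obtain u s where us: "u \<in> P" "s \<in> S" "l = u \<otimes> s"
              using l L(3) by (auto simp: set_mult_def)
            have "u = l \<otimes> inv s" using us cP cS by (simp add: m_assoc)
            hence "u \<in> L" using l us(2) J(2) L(2) subgroup.m_closed[OF L(1)] subgroup.m_inv_closed[OF L(1)] by blast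
            thus "l \<in> (L \<inter> P) <#> S" using us by (auto simp: set_mult_def)
          qed
        qed
        have "M \<subseteq> L \<inter> P" using J(3) L(2) M'(3) by blast
        hence "L \<inter> P = M \<or> L \<inter> P = P" using M'(4)[OF I] by blast
        thus "L = ?J \<or> L = carrier G"
        proof
          assume "L \<inter> P = P"
          hence "L = P <#> S" using L2 by simp
          thus ?thesis using dec(1) commut_normal[OF S nP] by simp
        qed (use L2 in simp)
      qed
      hence "z \<in> ?J" using z FI by simp
      thus ?thesis using JP z by blast
    qed
    thus "z \<in> Phi P" using z Phi_iff by blast
  qed
  have "frattini G \<subseteq> P"
  proof
    fix g assume g: "g \<in> frattini G"
    have gc: "g \<in> carrier G" using g FI by blast
    have sF: "subgroup (frattini G) G" using Phi_subgroup[OF sG] by simp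
    have "g \<in> centr"
    proof (rule in_centr[OF gc])
      fix w assume w: "w \<in> P"
      \<comment> \<open>The commutator of \<open>g\<close> and \<open>w\<close> lies in the normal
        subgroups \<open>frattini G\<close> and \<open>P\<close>, hence in \<open>Phi P\<close>; so
        \<open>g\<close> centralizes \<open>P/\<Phi>(P)\<close>.\<close>
      have "w \<otimes> inv g \<otimes> inv w \<in> frattini G"
        using Phi_conj[OF sG cP[OF w], of "inv g"] subgroup.m_inv_closed[OF sF g] cP[OF w] by simp
      hence "g \<otimes> (w \<otimes> inv g \<otimes> inv w) \<in> frattini G" using subgroup.m_closed[OF sF g] by blast
      hence "g \<otimes> w \<otimes> inv g \<otimes> inv w \<in> frattini G" using gc cP[OF w] by (simp add: m_assoc)
      moreover have "g \<otimes> w \<otimes> inv g \<otimes> inv w \<in> P" using P_mult[OF conj_P[OF gc w] P_inv[OF w]] .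
      ultimately show "v (g \<otimes> w \<otimes> inv g) = v w" using sub2 v_eq_iff[OF conj_P[OF gc w] w] by blast
    qed
    thus "g \<in> P" using centr_eq by simp
  qed
  thus ?thesis using sub1 sub2 by blast
qed

theorem semidirect_structure:
  "\<exists>x. x \<in> carrier G \<and> semidirect_decomp G (generate G {x}) P \<and>
       (frattini G = Phi P \<and> (\<forall>H. subgroup H G \<and> card H = p ^ (k - 1) \<longrightarrow> frattini G \<subseteq> H)) \<and>
       (faithful_action (G\<lparr>carrier := generate G {x}\<rparr>)
          (carrier (frattini_space G P)) (conj_action G P) \<and>
        (\<exists>c \<in> carrier (residue_ring (int p)). \<forall>u \<in> carrier (frattini_space G P).
           conj_action G P x u = c \<odot>\<^bsub>frattini_space G P\<^esub> u))"
proof -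
  obtain y where y: "y \<in> carrier G" "\<And>g. g \<in> carrier G \<Longrightarrow> \<exists>i::nat. g \<otimes> inv (y [^] i) \<in> P"
    using quotient_cyclic by blast
  \<comment> \<open>\<open>y\<close> generates \<open>G\<close> modulo \<open>P\<close>. This power
    removes its p-part, as \<open>x [^] m = \<one>\<close>, and loses nothing: \<open>y\<close> is
    recovered from \<open>x\<close> and \<open>y [^] m\<close>, which lies in
    \<open>P\<close>.\<close>
  define x where "x = y [^] (p ^ n)"
  have xc: "x \<in> carrier G" using y(1) by (simp add: x_def)
  let ?S = "generate G {x}"
  have sS: "subgroup ?S G" using xc by (intro generate_is_subgroup) simp
  have S: "?S = {x [^] k | k. k \<in> (UNIV :: nat set)}" using generate_pow_on_finite_carrier[OF fin xc] .
  have xm: "x [^] m = \<one>" using pow_order_eq_1[OF y(1)] y(1) orderG by (simp add: x_def nat_pow_pow)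
  have int: "?S \<inter> P = {\<one>}"
  proof -
    have "z = \<one>" if z: "z \<in> ?S" "z \<in> P" for z
    proof -
      obtain i where i: "z = x [^] (i::nat)" using z(1) S by blast
      have "z [^] m = (x [^] m) [^] i" using i xc by (simp add: nat_pow_pow mult.commute)
      hence "z [^] m = \<one>" using xm by simp
      thus ?thesis using p'_element_in_P[OF z(2) copm] by blast
    qed
    thus ?thesis using subgroup.one_closed[OF sS] subgroup.one_closed[OF sP] by blast
  qed
  have dec: "carrier G = ?S <#> P"
  proof -
    interpret S2: second_isomorphism_grp P G ?S
      using nP sS by (simp add: second_isomorphism_grp_def second_isomorphism_grp_axioms_def)
    let ?J = "P <#> ?S"
    have J: "subgroup ?J G" "?S \<subseteq> ?J" "P \<subseteq> ?J"
      using S2.normal_set_mult_subgroup S2.S_contained_in_set_mult S2.H_contained_in_set_mult .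
    have "x \<in> ?S" by (simp add: generate.incl)
    hence "y [^] (p ^ n) \<in> ?J" using J(2) x_def by blast
    moreover have "y [^] m \<in> ?J" using normal_pow_mem[OF nP y(1)] J(3) by blast
    moreover have "coprime (p ^ n) m" using copm by (simp add: coprime_commute)
    ultimately have yJ: "y \<in> ?J" using pow_mem_coprime[OF J(1) y(1)] by blast
    have "carrier G \<subseteq> ?J"
    proof
      fix g assume g: "g \<in> carrier G"
      obtain i where "g \<otimes> inv (y [^] (i::nat)) \<in> P" using y(2)[OF g] by blast
      hence "g \<otimes> inv (y [^] i) \<otimes> y [^] i \<in> ?J" using J(3) subgroup.m_closed[OF J(1)] subgroup_pow[OF J(1) yJ] by blast
      thus "g \<in> ?J" using g y(1) by (simp add: m_assoc)
    qed
    hence "carrier G = ?J" using subgroup.subset[OF J(1)] by blast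
    thus ?thesis using commut_normal[OF sS nP] by simp
  qed
  have fr: "frattini G = Phi P" by (rule frattini_eq[OF sS dec int])
  have "frattini G \<subseteq> H" if "subgroup H G" "card H = p ^ (k - 1)" for H
    using fr Phi_in_small[OF that(1) p_subgroup_in_P[OF nP that] that(2)] by simp
  moreover have "faithful_action (G\<lparr>carrier := ?S\<rparr>) (carrier (frattini_space G P)) (conj_action G P)"
  proof (intro faithful_action.intro faithful_action_axioms.intro inj_onI)
    show "group_action (G\<lparr>carrier := ?S\<rparr>) (carrier (frattini_space G P)) (conj_action G P)"
      by (rule conj_action_group_action[OF Phi_normal nP sS])
    fix g h assume "g \<in> carrier (G\<lparr>carrier := ?S\<rparr>)" "h \<in> carrier (G\<lparr>carrier := ?S\<rparr>)"
      and e: "conj_action G P g = conj_action G P h"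
    hence gh: "g \<in> ?S" "h \<in> ?S" by auto
    have c: "g \<in> carrier G" "h \<in> carrier G" using gh subgroup_carrier[OF sS] by auto
    have "inv h \<otimes> g \<in> centr"
    proof (rule in_centr)
      fix w assume w: "w \<in> P"
      have "v (g \<otimes> w \<otimes> inv g) = v (h \<otimes> w \<otimes> inv h)"
        using conj_action_v[OF Phi_normal w c(1)] conj_action_v[OF Phi_normal w c(2)] e by simp
      hence "v (inv h \<otimes> (g \<otimes> w \<otimes> inv g) \<otimes> inv (inv h)) = v (inv h \<otimes> (h \<otimes> w \<otimes> inv h) \<otimes> inv (inv h))"
        using c w conj_P by (intro v_conj_eq) auto
      thus "v (inv h \<otimes> g \<otimes> w \<otimes> inv (inv h \<otimes> g)) = v w"
        using c cP[OF w] by (simp add: m_assoc inv_mult_group)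
    qed (use c in simp)
    moreover have "inv h \<otimes> g \<in> ?S" using gh subgroup.m_closed[OF sS] subgroup.m_inv_closed[OF sS] by blast
    ultimately have "inv h \<otimes> g = \<one>" using centr_eq int by blast
    thus "g = h" using c by (metis inv_mult_cancel(2) r_one)
  qed
  moreover have "\<exists>c \<in> carrier (residue_ring (int p)). \<forall>u \<in> carrier (frattini_space G P).
           conj_action G P x u = c \<odot>\<^bsub>frattini_space G P\<^esub> u"
  proof (intro bexI ballI)
    show "int (chi x) \<in> carrier (residue_ring (int p))" using chi(1)[OF xc] by (simp add: residue_ring_def)
    fix u assume "u \<in> carrier (frattini_space G P)"
    then obtain w where w: "w \<in> P" "u = v w" by (auto simp: frattini_space_carrier carrier_V)
    show "conj_action G P x u = int (chi x) \<odot>\<^bsub>frattini_space G P\<^esub> u"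
      using conj_action_v[OF Phi_normal w(1) xc] chi(2)[OF xc w(1)] w(2)
      by (simp add: frattini_space_smult int_pow_int)
  qed
  ultimately show ?thesis
    using xc fr dec int sS nP by (intro exI[of _ x]) (auto simp: semidirect_decomp_def)
qed

end

context core_free_sylow
begin

subsection \<open>Sufficiency\<close>

lemma Phi_normal_G:
  assumes nP: "P \<lhd> G" shows "Phi P \<lhd> G"
  using Phi_conj[OF sP] normal.inv_op_closed1[OF nP] normal.inv_op_closed2[OF nP] sPhi
  by (intro normal_invI) blast+

text \<open>No basis is chosen: the complement \<open>K0\<close> of \<open>H\<close> over
  \<open>Phi P\<close> is a subgroup maximal subject to meeting \<open>H\<close> inside
  \<open>Phi P\<close>. Maximal subgroups of \<open>H\<close> have order \<open>p ^ (k - 1)\<close>,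
  so \<open>small\<close> places them above \<open>Phi P\<close>, where every subgroup of
  \<open>P\<close> is normal in \<open>G\<close>.\<close>

lemma scalar_imp_M_class:
  assumes nP: "P \<lhd> G" and x: "x \<in> carrier G"
    and dec: "carrier G = generate G {x} <#> P" and int: "generate G {x} \<inter> P = {\<one>}"
    and k: "k \<ge> 1" and small: "\<And>H. subgroup H G \<Longrightarrow> card H = p ^ (k - 1) \<Longrightarrow> Phi P \<subseteq> H"
    and scalar: "\<And>w. w \<in> P \<Longrightarrow> v (x \<otimes> w \<otimes> inv x) = v w [^]\<^bsub>V\<^esub> (c::nat)"
  shows "M_class (p ^ k) G"
  unfolding M_class_def
proof (intro allI impI)
  fix H assume "subgroup H G \<and> card H = p ^ k"
  hence H: "subgroup H G" "card H = p ^ k" by auto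
  have HP: "H \<subseteq> P" by (rule p_subgroup_in_P[OF nP H])
  have pH: "p_subgroup H" using H p_subgroup_def by blast
  note cH = subgroup_carrier[OF H(1)] and cPhi = subgroup_carrier[OF sPhi]
  let ?S = "generate G {x}"
  have sS: "subgroup ?S G" using x by (intro generate_is_subgroup) simp
  have S: "?S = {x [^] k | k. k \<in> (UNIV :: nat set)}" using generate_pow_on_finite_carrier[OF fin x] .
  note cS = subgroup_carrier[OF sS]
  have conjP: "g \<otimes> w \<otimes> inv g \<in> P" if "g \<in> carrier G" "w \<in> P" for g w
    using normal.inv_op_closed2[OF nP that] .
  have between_normal: "U \<lhd> G" if U: "subgroup U G" "Phi P \<subseteq> U" "U \<subseteq> P" for U
  proof (rule normal_invI[OF U(1)])
    have xU: "\<forall>u\<in>U. x \<otimes> u \<otimes> inv x \<in> U"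
    proof
      fix u assume u: "u \<in> U"
      have uP: "u \<in> P" using u U(3) by blast
      have uc: "u [^] c \<in> P" "u [^] c \<in> U" using subgroup_pow sP U(1) uP u by auto
      have "v (x \<otimes> u \<otimes> inv x) = v (u [^] c)" using scalar[OF uP] v_pow[OF uP] by simp
      hence "x \<otimes> u \<otimes> inv x \<otimes> inv (u [^] c) \<in> U" using v_eq_iff[OF conjP[OF x uP] uc(1)] U(2) by blast
      hence "x \<otimes> u \<otimes> inv x \<otimes> inv (u [^] c) \<otimes> u [^] c \<in> U" using subgroup.m_closed[OF U(1)] uc(2) by blast
      thus "x \<otimes> u \<otimes> inv x \<in> U" using x cP[OF uP] by (simp add: m_assoc)
    qed
    fix g u assume g: "g \<in> carrier G" and u: "u \<in> U"
    obtain s y where sy: "s \<in> ?S" "y \<in> P" "g = s \<otimes> y" using g dec by (auto simp: set_mult_def)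
    obtain i where i: "s = x [^] (i::nat)" using sy(1) S by blast
    have c: "s \<in> carrier G" "y \<in> carrier G" "u \<in> carrier G" using cS cP sy u U(3) by auto
    have "y \<otimes> u \<otimes> inv y \<otimes> inv u \<in> U" using Phi_commutator[OF pP sy(2)] u U(2,3) by blast
    hence "y \<otimes> u \<otimes> inv y \<otimes> inv u \<otimes> u \<in> U" using subgroup.m_closed[OF U(1) _ u] by blast
    hence "y \<otimes> u \<otimes> inv y \<in> U" using c by (simp add: m_assoc)
    hence "s \<otimes> (y \<otimes> u \<otimes> inv y) \<otimes> inv s \<in> U" unfolding i by (rule conj_closed[OF U(1) x xU])
    thus "g \<otimes> u \<otimes> inv g \<in> U" using sy(3) c by (simp add: m_assoc inv_mult_group)
  qed
  have PhiL: "Phi P \<subseteq> L" if L: "maximal_in L H" for L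
  proof -
    have "p ^ k = p * p ^ (k - 1)" using k by (simp add: power_eq_if)
    hence "card L = p ^ (k - 1)" using maximal_card[OF pH L] H(2) p0 by simp
    thus ?thesis using small maximalD(1)[OF H(1) L] by blast
  qed
  have PhiH: "Phi P \<subseteq> H"
  proof -
    have "card {\<one>} \<le> p ^ (k - 1)" "p ^ (k - 1) \<le> card H" using p1 H(2) by auto
    then obtain L where "subgroup L G" "L \<subseteq> H" "card L = p ^ (k - 1)"
      using p_subgroup_between[OF pH triv_subgroup] subgroup.one_closed[OF H(1)] by blast
    thus ?thesis using small by blast
  qed
  let ?A = "{U. subgroup U G \<and> Phi P \<subseteq> U \<and> U \<subseteq> P \<and> U \<inter> H \<subseteq> Phi P}"
  have "finite ?A" using subgroup_finite[OF sP] by (auto intro: finite_subset[of _ "Pow P"])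
  moreover have "Phi P \<in> ?A" using sPhi Phi_subset by blast
  ultimately obtain K0 where K0: "K0 \<in> ?A" "\<And>U. U \<in> ?A \<Longrightarrow> K0 \<subseteq> U \<Longrightarrow> K0 = U"
    using finite_has_maximal2[of ?A "Phi P"] by (metis (no_types, lifting))
  have sK0: "subgroup K0 G" "Phi P \<subseteq> K0" "K0 \<subseteq> P" "K0 \<inter> H \<subseteq> Phi P" using K0(1) by auto
  note nK0 = between_normal[OF sK0(1-3)] and cK0 = subgroup_carrier[OF sK0(1)]
  interpret S1: second_isomorphism_grp K0 G H
    using nK0 H(1) by (simp add: second_isomorphism_grp_def second_isomorphism_grp_axioms_def)
  let ?J = "K0 <#> H"
  have J: "subgroup ?J G" "H \<subseteq> ?J" "K0 \<subseteq> ?J"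
    using S1.normal_set_mult_subgroup S1.S_contained_in_set_mult S1.H_contained_in_set_mult .
  have PJ: "P \<subseteq> ?J"
  proof (rule subsetI, rule ccontr)
    fix y assume y: "y \<in> P" "y \<notin> ?J"
    note U = adjoin_Phi[OF sK0(1,3,2) y(1)]
    \<comment> \<open>If \<open>p\<close> divides the exponent of \<open>y\<close> in
      \<open>h\<close>, then \<open>h\<close> already lies in \<open>K0\<close>; if not,
      \<open>y\<close> would lie in \<open>K0 <#> H\<close>. So adjoining \<open>y\<close>
      contradicts the maximality of \<open>K0\<close>.\<close>
    have "adjoin K0 y \<inter> H \<subseteq> Phi P"
    proof
      fix h assume h: "h \<in> adjoin K0 y \<inter> H"
      then obtain l i where li: "l \<in> K0" "h = l \<otimes> y [^] (i::nat)" by (auto simp: adjoin_def)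
      have yi: "y [^] i = inv l \<otimes> h" using li cK0 cP[OF y(1)] by simp
      show "h \<in> Phi P"
      proof (cases "p dvd i")
        case True
        then obtain j where "i = p * j" by auto
        hence "y [^] i = (y [^] p) [^] j" using cP[OF y(1)] by (simp add: nat_pow_pow)
        hence "y [^] i \<in> K0" using subgroup_pow[OF sPhi Phi_power[OF pP y(1)]] sK0(2) by auto
        hence "h \<in> K0" using li subgroup.m_closed[OF sK0(1)] by blast
        thus ?thesis using h sK0(4) by blast
      next
        case False
        hence "coprime i p" using prime_p by (metis coprime_commute prime_imp_coprime)
        moreover have "y [^] i \<in> ?J"
          unfolding yi using li(1) h J subgroup.m_closed[OF J(1)] subgroup.m_inv_closed[OF J(1)] by blast
        moreover have "y [^] p \<in> ?J" using Phi_power[OF pP y(1)] sK0(2) J(3) by blast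
        ultimately show ?thesis using pow_mem_coprime[OF J(1) cP[OF y(1)]] y(2) by blast
      qed
    qed
    hence "adjoin K0 y \<in> ?A" using U sK0(2) by blast
    hence "K0 = adjoin K0 y" using K0(2) U(3) by blast
    thus False using U(4) y(2) J(3) by blast
  qed
  interpret S2: second_isomorphism_grp K0 G ?S
    using nK0 sS by (simp add: second_isomorphism_grp_def second_isomorphism_grp_axioms_def)
  define K where "K = K0 <#> ?S"
  have sK: "subgroup K G" unfolding K_def by (rule S2.normal_set_mult_subgroup)
  have "carrier G \<subseteq> H <#> K"
  proof
    fix g assume g: "g \<in> carrier G"
    have "carrier G = P <#> ?S" using dec commut_normal[OF sS nP] by simp
    then obtain u s where us: "u \<in> P" "s \<in> ?S" "g = u \<otimes> s" using g by (auto simp: set_mult_def)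
    have "u \<in> H <#> K0" using us(1) PJ commut_normal[OF H(1) nK0] by blast
    then obtain h l where hl: "h \<in> H" "l \<in> K0" "u = h \<otimes> l" by (auto simp: set_mult_def)
    have "g = h \<otimes> (l \<otimes> s)" using us hl cH cK0 cS by (simp add: m_assoc)
    moreover have "l \<otimes> s \<in> K" using hl us by (auto simp: K_def set_mult_def)
    ultimately show "g \<in> H <#> K" using hl(1) by (auto simp: set_mult_def[of G H])
  qed
  moreover have "H <#> K \<subseteq> carrier G" using H sK by (intro set_mult_closed subgroup.subset)
  ultimately have HK: "carrier G = H <#> K" by blast
  have "proper_subgroup (L <#> K) G" if L: "maximal_in L H" for L
  proof -
    note L' = maximalD[OF H(1) L]
    have nL: "L \<lhd> G" using between_normal[OF L'(1) PhiL[OF L]] L'(3) HP by blast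
    interpret S3: second_isomorphism_grp L G K
      using nL sK by (simp add: second_isomorphism_grp_def second_isomorphism_grp_axioms_def)
    have "L <#> K \<noteq> carrier G"
    proof
      assume e: "L <#> K = carrier G"
      obtain h where h: "h \<in> H" "h \<notin> L" using L'(2) by blast
      have "h \<in> L <#> K" using e cH[OF h(1)] by simp
      then obtain l t where lt: "l \<in> L" "t \<in> K" "h = l \<otimes> t" by (auto simp: set_mult_def[of G L])
      then obtain z s where zs: "z \<in> K0" "s \<in> ?S" "t = z \<otimes> s" by (auto simp: K_def set_mult_def)
      have c: "l \<in> carrier G" "z \<in> carrier G" "s \<in> carrier G"
        using lt zs subgroup_carrier[OF L'(1)] cK0 cS by auto
      \<comment> \<open>\<open>s\<close> turns out to lie in \<open>P\<close>, so it is
        \<open>\<one>\<close>; then \<open>z\<close> lies in \<open>K0 \<inter> H\<close>, hence in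
        \<open>Phi P\<close> and in \<open>L\<close>, which puts \<open>h\<close> into
        \<open>L\<close>.\<close>
      have "s = inv (l \<otimes> z) \<otimes> h" using lt zs c by (simp add: inv_mult_group m_assoc)
      moreover have "l \<otimes> z \<in> P" "h \<in> P" using lt(1) zs(1) L'(3) HP sK0(3) P_mult h(1) by blast+
      ultimately have "s \<in> P" using P_mult P_inv by simp
      hence "s = \<one>" using zs(2) int by blast
      hence hz: "h = l \<otimes> z" using lt zs c by simp
      hence "z = inv l \<otimes> h" using c by simp
      hence "z \<in> H" using lt(1) L'(3) h(1) subgroup.m_closed[OF H(1)] subgroup.m_inv_closed[OF H(1)] by blast
      hence "z \<in> L" using zs(1) sK0(4) PhiL[OF L] by blast
      thus False using h(2) hz lt(1) subgroup.m_closed[OF L'(1)] by blast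
    qed
    thus ?thesis using S3.normal_set_mult_subgroup by (simp add: proper_subgroup_def)
  qed
  thus "M_supplemented H G" unfolding M_supplemented_def using sK HK by blast
qed

end

theorem theoremA:
  fixes G (structure) and p k :: nat
  assumes "group G" and "finite (carrier G)"
    and "Factorial_Ring.prime p" and "k \<ge> 2" and "p ^ k dvd order G"
    and "p'_core G p = {\<one>}"
  shows "M_class (p ^ k) G \<longleftrightarrow>
    (\<exists>P x. sylow_subgroup p P G \<and> x \<in> carrier G \<and>
       semidirect_decomp G (generate G {x}) P \<and>
       (frattini G = frattini (G\<lparr>carrier := P\<rparr>) \<and>
        (\<forall>H. subgroup H G \<and> card H = p ^ (k - 1) \<longrightarrow> frattini G \<subseteq> H)) \<and>
       (faithful_action (G\<lparr>carrier := generate G {x}\<rparr>)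
          (carrier (frattini_space G P)) (conj_action G P) \<and>
        (\<exists>c \<in> carrier (residue_ring (int p)). \<forall>v \<in> carrier (frattini_space G P).
           conj_action G P x v = c \<odot>\<^bsub>frattini_space G P\<^esub> v)))"
    (is "_ \<longleftrightarrow> (\<exists>P x. ?R P x)")
proof -
  interpret prime_group G p
    using assms(1-3) by (simp add: prime_group_def prime_group_axioms_def)
  define n where "n = multiplicity p (order G)"
  have o0: "order G \<noteq> 0" using fin order_gt_0_iff_finite by simp
  have nu: "\<not> is_unit p" using prime_p not_prime_unit by blast
  obtain m where m: "order G = p ^ n * m" "\<not> p dvd m"
    using multiplicity_decompose'[OF o0 nu] unfolding n_def by blast
  have cop: "coprime m p" using m(2) prime_p by (metis coprime_commute prime_imp_coprime)
  have kn: "k \<le> n" unfolding n_def using assms(5) o0 nu by (intro multiplicity_geI) auto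
  have core_free: "core_free_sylow G p P n m" if "subgroup P G" "card P = p ^ n" for P
    using that m(1) cop assms(6) prime_group_axioms
    by (simp add: core_free_sylow_def core_free_sylow_axioms_def)
  show ?thesis
  proof
    assume M: "M_class (p ^ k) G"
    obtain P where P: "subgroup P G" "card P = p ^ n"
      using sylow_thm[OF prime_p is_group m(1) fin] by blast
    interpret M_group G p P n m k
      using core_free[OF P] assms(4) kn M by (simp add: M_group_def M_group_axioms_def)
    have "sylow_subgroup p P G" using P by (simp add: sylow_subgroup_def n_def)
    thus "\<exists>P x. ?R P x" using semidirect_structure by blast
  next
    assume "\<exists>P x. ?R P x"
    then obtain P x c where sy: "sylow_subgroup p P G" and x: "x \<in> carrier G"
      and d: "semidirect_decomp G (generate G {x}) P" and fr: "frattini G = frattini (G\<lparr>carrier := P\<rparr>)"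
      and small: "\<forall>H. subgroup H G \<and> card H = p ^ (k - 1) \<longrightarrow> frattini G \<subseteq> H"
      and c: "c \<in> carrier (residue_ring (int p))"
        "\<forall>v \<in> carrier (frattini_space G P). conj_action G P x v = c \<odot>\<^bsub>frattini_space G P\<^esub> v" by blast
    interpret core_free_sylow G p P n m
      using core_free sy by (simp add: sylow_subgroup_def n_def)
    have nP: "P \<lhd> G" using d by (simp add: semidirect_decomp_def)
    \<comment> \<open>The carrier of \<open>residue_ring\<close> consists of the integers from 0 to
      \<open>p - 1\<close>, so the scalar can be read as a natural exponent.\<close>
    have c0: "c = int (nat c)" using c(1) by (simp add: residue_ring_def)
    show "M_class (p ^ k) G"
    proof (rule scalar_imp_M_class[OF nP x])
      fix w assume w: "w \<in> P"
      have "v (x \<otimes> w \<otimes> inv x) = v w [^]\<^bsub>V\<^esub> c"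
        using c(2) v_in_V[OF w] conj_action_v[OF Phi_normal_G[OF nP] w x]
        by (simp add: frattini_space_carrier frattini_space_smult)
      also have "\<dots> = v w [^]\<^bsub>V\<^esub> nat c" by (subst c0) (rule int_pow_int)
      finally show "v (x \<otimes> w \<otimes> inv x) = v w [^]\<^bsub>V\<^esub> nat c" .
    qed (use d small fr assms(4) in \<open>auto simp: semidirect_decomp_def\<close>)
  qed
qed

end
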